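(* For each positive integer $n$ let $X_n$ be the random variable `size' on the set of $(2n+1,2n+3)$-core partitions with distinct parts, equipped with the uniform distribution. Then the kurtosis of $X_n$ satisfies $$ \lim_{n\to\infty}\frac{\mathbb{E}\big[(X_n-\mathbb{E}[X_n])^4\big]}{\mathrm{Var}(X_n)^{2}}=\frac{145309380}{16792853}. $$
   Context: A partition is a non-increasing finite sequence $\lambda=(\lambda_1,\dots,\lambda_k)$, $k\ge 0$, of positive integers (the empty partition is allowed); its size is $\lambda_1+\dots+\lambda_k$, and it has distinct parts if the $\lambda_i$ are pairwise distinct. The hook length of a cell $(i,j)$, $1\le j\le\lambda_i$, of its Ferrers (Young) diagram is $\lambda_i-i+\lambda'_j-j+1$, where $\lambda'$ is the conjugate partition. A partition is an $(s,t)$-core partition if none of its hook lengths equals $s$ and none equals $t$. For $s=2n+1$, $t=2n+3$ (relatively prime) the set of $(s,t)$-core partitions is finite. *)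

theory Defs
  imports "HOL-Probability.Probability"
begin

text \<open>Partitions are lists of their parts; rows and columns of the Ferrers diagram are numbered
  from 1, so the part with index \<open>i\<close> is \<open>xs ! (i - 1)\<close>.\<close>

definition is_partition :: "nat list \<Rightarrow> bool" where
  "is_partition xs \<longleftrightarrow> sorted_wrt (\<ge>) xs \<and> (\<forall>x\<in>set xs. 0 < x)"

definition cells :: "nat list \<Rightarrow> (nat \<times> nat) set" where
  "cells xs = {(i, j). 1 \<le> i \<and> i \<le> length xs \<and> 1 \<le> j \<and> j \<le> xs ! (i - 1)}"

text \<open>The \<open>j\<close>-th part of the conjugate partition, that is, the length of the \<open>j\<close>-th column.\<close>

definition conjugate_part :: "nat list \<Rightarrow> nat \<Rightarrow> nat" where
  "conjugate_part xs j = card {i. (i, j) \<in> cells xs}"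

definition hook_length :: "nat list \<Rightarrow> nat \<Rightarrow> nat \<Rightarrow> int" where
  "hook_length xs i j =
     int (xs ! (i - 1)) - int i + int (conjugate_part xs j) - int j + 1"

definition is_core :: "nat \<Rightarrow> nat \<Rightarrow> nat list \<Rightarrow> bool" where
  "is_core s t xs \<longleftrightarrow> is_partition xs \<and>
     (\<forall>(i, j)\<in>cells xs. hook_length xs i j \<noteq> int s \<and> hook_length xs i j \<noteq> int t)"

definition distinct_cores :: "nat \<Rightarrow> nat \<Rightarrow> nat list set" where
  "distinct_cores s t = {xs. is_core s t xs \<and> distinct xs}"

text \<open>\<open>pmf_of_set\<close> is unspecified on infinite sets. For coprime positive \<open>s\<close> and \<open>t\<close> the set
  \<open>distinct_cores s t\<close> is finite, and it always contains the empty partition.\<close>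

definition uniform_core :: "nat \<Rightarrow> nat list pmf" where
  "uniform_core n = pmf_of_set (distinct_cores (2 * n + 1) (2 * n + 3))"

definition partition_size :: "nat list \<Rightarrow> real" where
  "partition_size xs = real (sum_list xs)"

definition kurtosis :: "'a pmf \<Rightarrow> ('a \<Rightarrow> real) \<Rightarrow> real" where
  "kurtosis p X =
     measure_pmf.expectation p (\<lambda>x. (X x - measure_pmf.expectation p X) ^ 4) /
     (measure_pmf.variance p X)\<^sup>2"

end

theory Submission
  imports Defs "HOL-Computational_Algebra.Formal_Power_Series" "HOL-Library.Poly_Mapping"
begin

text \<open>
  Let \<open>s = 2n + 1\<close> and \<open>t = 2n + 3\<close>. A partition is determined by the set of hook lengths of its
  first column. For an \<open>(s, t)\<close>-core this set is closed under subtraction of \<open>s\<close> and \<open>t\<close>, and the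
  parts are distinct if and only if it has no two consecutive elements. The numbers of elements in
  the residue classes \<open>2, 4, \<dots>, 2n, 1, 3, \<dots>, 2n - 1\<close> modulo \<open>s\<close> then form a sequence of heights
  that rises by at most one per step, by at most two from residue \<open>2n\<close> to residue 1, and no two
  residues \<open>r\<close> and \<open>r + 1\<close> between 1 and \<open>2n\<close> both have positive height.
  Folded into pairs it becomes a closed walk (\<open>loops\<close>, \<open>bij_loops\<close>). If \<open>k\<close> is the sum of the
  heights and \<open>S\<close> the sum of their squares, twice the size is \<open>2 n S - k ^ 2\<close> up to a term of lower
  order (\<open>cores_loops\<close>). So the limits of the joint moments of \<open>S / n ^ 2\<close> and \<open>k ^ 2 / n ^ 3\<close>
  determine those of the size divided by \<open>n ^ 3\<close> (\<open>size_limit\<close>), and the kurtosis is a rational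
  function of four of them.

  For the joint moments the walks are counted with weights recording \<open>k\<close> and \<open>S\<close>. Decomposing them
  at the ends of runs of positive heights yields a few algebraic equations between the generating
  function and its versions with all heights raised by one (\<open>loops_gf\<close>). Raising heights acts
  linearly on the statistics: \<open>k\<close> becomes \<open>k + n\<close> and \<open>S\<close> becomes \<open>S + 2k + n\<close>. Extracting the
  moment of index \<open>(i, l)\<close> in \<open>(S, k)\<close> therefore turns these equations into recursions between power
  series in one variable \<open>x\<close>, and all solutions are Laurent polynomials in \<open>eps = sqrt (1 - 4x)\<close>.
  For the closed walks the pole in \<open>eps\<close> has order \<open>4i + 3l + 2\<close> (\<open>loops_leading\<close>); its leading
  coefficient follows a finite recursion in \<open>i\<close> and \<open>l\<close>, the discrete counterpart of the Riccati
  equation for integral functionals of Brownian excursions. A pole of even order \<open>2q + 2\<close> with leading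
  coefficient \<open>c\<close> means coefficients asymptotic to \<open>c 4 ^ n n ^ q / q!\<close> (\<open>leading_transfer\<close>), and
  \<open>4 ^ n\<close> is the number of walks. For \<open>l\<close> even the order of the pole is even, and only such moments occur.
\<close>

unbundle no vec_syntax
unbundle fps_syntax

section \<open>Poles at \<open>x = 1/4\<close> and asymptotics of coefficients\<close>

text \<open>The probability that a simple random walk is back at its start after \<open>2 n\<close> steps, that is
  \<open>(2n choose n) / 4 ^ n\<close>.\<close>

definition return_prob :: "nat \<Rightarrow> real" where
  "return_prob n = (\<Prod>k<n. (2 * real k + 1) / (2 * real k + 2))"

lemma return_prob_0 [simp]: "return_prob 0 = 1"
  by (simp add: return_prob_def)

lemma return_prob_Suc: "return_prob (Suc n) = return_prob n * ((2 * real n + 1) / (2 * real n + 2))"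
  by (simp add: return_prob_def)

lemma return_prob_pos: "return_prob n > 0"
  unfolding return_prob_def by (intro prod_pos) auto

lemma return_prob_antimono: "return_prob (Suc n) \<le> return_prob n"
  using return_prob_pos[of n] unfolding return_prob_Suc
  by (intro mult_left_le) (auto simp: field_simps)

lemma return_prob_square_le: "(return_prob n)\<^sup>2 * (2 * real n + 1) \<le> 1"
proof (induction n)
  case (Suc n)
  have "(return_prob (Suc n))\<^sup>2 * (2 * real (Suc n) + 1)
      = ((return_prob n)\<^sup>2 * (2 * real n + 1)) * ((2 * real n + 1) * (2 * real n + 3) / (2 * real n + 2)\<^sup>2)"
    unfolding return_prob_Suc by (simp add: power2_eq_square field_simps)
  also have "\<dots> \<le> 1 * 1"
  proof (rule mult_mono[OF Suc])
    show "(2 * real n + 1) * (2 * real n + 3) / (2 * real n + 2)\<^sup>2 \<le> 1"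
      by (simp add: divide_simps power2_eq_square) (simp add: algebra_simps)
  qed auto
  finally show ?case by simp
qed simp

lemma return_prob_tendsto_0: "return_prob \<longlonglongrightarrow> 0"
proof (rule tendsto_sandwich)
  have "return_prob n \<le> 1 / sqrt (real n)" if "n > 0" for n
  proof (rule power2_le_imp_le)
    have "(return_prob n)\<^sup>2 * real n \<le> (return_prob n)\<^sup>2 * (2 * real n + 1)"
      by (intro mult_left_mono) auto
    also have "\<dots> \<le> 1" by (rule return_prob_square_le)
    finally show "(return_prob n)\<^sup>2 \<le> (1 / sqrt (real n))\<^sup>2"
      using that by (simp add: field_simps)
  qed auto
  then show "\<forall>\<^sub>F n in sequentially. return_prob n \<le> 1 / sqrt (real n)"
    by (intro eventually_mono[OF eventually_gt_at_top[of 0]]) auto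
  show "\<forall>\<^sub>F n in sequentially. 0 \<le> return_prob n"
    using return_prob_pos less_imp_le by (intro always_eventually) blast
  show "(\<lambda>n. 1 / sqrt (real n)) \<longlonglongrightarrow> 0" by real_asymp
qed auto

definition fourX :: "real fps" where "fourX = fps_const 4 * fps_X"

definition central_fps :: "real fps" where
  "central_fps = Abs_fps (\<lambda>n. 4 ^ n * return_prob n)"

text \<open>The square root of \<open>1 - 4x\<close>. It vanishes at the dominant singularity \<open>x = 1/4\<close>, and orders of
  growth are measured in powers of it.\<close>

definition eps :: "real fps" where "eps = (1 - fourX) * central_fps"

lemma fourX_mult_nth: "(fourX * F) $ n = (if n = 0 then 0 else 4 * F $ (n - 1))"
  by (cases n) (simp_all add: fourX_def mult.assoc)

lemma central_fps_ode: "fps_deriv central_fps * (1 - fourX) = fps_const 2 * central_fps"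
proof (rule fps_ext)
  fix n
  have "(fps_deriv central_fps * (1 - fourX)) $ n
      = fps_deriv central_fps $ n - (fourX * fps_deriv central_fps) $ n"
    by (simp add: algebra_simps)
  also have "\<dots> = (fps_const 2 * central_fps) $ n"
  proof (cases n)
    case 0
    then show ?thesis
      by (simp add: fourX_def central_fps_def return_prob_Suc)
  next
    case (Suc m)
    have "return_prob (Suc (Suc m)) * (2 * real m + 4) = return_prob (Suc m) * (2 * real m + 3)"
      unfolding return_prob_Suc[of "Suc m"] by (simp add: field_simps)
    then have "4 * 4 ^ Suc m * (return_prob (Suc (Suc m)) * (2 * real m + 4))
        = 4 * 4 ^ Suc m * (return_prob (Suc m) * (2 * real m + 3))"
      by (simp only:)
    then show ?thesis
      by (simp add: Suc fourX_mult_nth central_fps_def algebra_simps)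
  qed
  finally show "(fps_deriv central_fps * (1 - fourX)) $ n = (fps_const 2 * central_fps) $ n" .
qed

text \<open>The differential equation makes the derivative of the left-hand side vanish.\<close>

lemma central_fps_square: "central_fps * central_fps * (1 - fourX) = 1"
proof -
  have d4: "fps_deriv fourX = fps_const 4" by (simp add: fourX_def)
  have "fps_deriv (central_fps * central_fps * (1 - fourX))
      = 2 * central_fps * (fps_deriv central_fps * (1 - fourX)) - central_fps * central_fps * fps_const 4"
    by (simp add: d4 algebra_simps)
  also have "\<dots> = (fps_const 2 * fps_const 2 - fps_const 4) * (central_fps * central_fps)"
    unfolding central_fps_ode by (simp add: algebra_simps numeral_fps_const)
  also have "\<dots> = 0" by simp
  finally have "fps_deriv (central_fps * central_fps * (1 - fourX)) = 0" .
  then have "central_fps * central_fps * (1 - fourX)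
      = fps_const ((central_fps * central_fps * (1 - fourX)) $ 0)"
    by (simp only: fps_deriv_eq_0_iff)
  also have "(central_fps * central_fps * (1 - fourX)) $ 0 = 1"
    by (simp add: central_fps_def fourX_def)
  finally show ?thesis by simp
qed

lemma eps_square: "eps * eps = 1 - fourX"
proof -
  have "eps * eps = (1 - fourX) * (central_fps * central_fps * (1 - fourX))"
    by (simp add: eps_def mult_ac)
  then show ?thesis by (simp add: central_fps_square)
qed

lemma eps_nth_0 [simp]: "eps $ 0 = 1"
  by (simp add: eps_def central_fps_def fourX_def)

lemma eps_nonzero [simp]: "eps \<noteq> 0"
  using eps_nth_0 by force

lemma eps_nth: "eps $ n / 4 ^ n = return_prob n - (if n = 0 then 0 else return_prob (n - 1))"
proof -
  have "eps $ n = central_fps $ n - (fourX * central_fps) $ n"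
    by (simp add: eps_def algebra_simps)
  then show ?thesis
    by (cases n) (simp_all add: fourX_mult_nth central_fps_def field_simps)
qed

text \<open>The value at \<open>x = 1/4\<close>: the partial sums are the coefficients of
  \<open>eps / (1 - 4x) = (1 - 4x) ^ (-1/2)\<close>, scaled, and these are return probabilities.\<close>

lemma eps_sums_0: "(\<lambda>n. eps $ n / 4 ^ n) sums 0"
proof -
  have "(\<Sum>k<Suc n. eps $ k / 4 ^ k) = return_prob n" for n
    by (induction n) (simp_all add: eps_nth)
  then have "(\<lambda>n. \<Sum>k<Suc n. eps $ k / 4 ^ k) \<longlonglongrightarrow> 0"
    using return_prob_tendsto_0 by simp
  then show ?thesis
    unfolding sums_def by (rule LIMSEQ_imp_Suc)
qed

lemma eps_abs_summable: "summable (\<lambda>n. \<bar>eps $ n / 4 ^ n\<bar>)"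
proof -
  have "(\<lambda>n. - (eps $ Suc n / 4 ^ Suc n)) = (\<lambda>n. \<bar>eps $ Suc n / 4 ^ Suc n\<bar>)"
    unfolding eps_nth using return_prob_antimono
    by (auto simp: abs_real_def fun_eq_iff) (metis order_antisym_conv linorder_not_le less_le)
  moreover have "summable (\<lambda>n. - (eps $ Suc n / 4 ^ Suc n))"
    using sums_summable[OF eps_sums_0] by (intro summable_minus) (subst summable_Suc_iff)
  ultimately show ?thesis by (subst summable_Suc_iff[symmetric]) simp
qed

text \<open>At \<open>x = 1/4\<close> the coefficients of \<open>eps\<close> are absolutely summable with sum 0. By Tannery's
  theorem the scaled coefficients of the product tend to \<open>L\<close> times that sum, so multiplication by
  \<open>eps\<close> lowers the order of growth.\<close>

lemma eps_convolution_tendsto_0: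
  assumes lim: "(\<lambda>n. F $ n / (4 ^ n * real n ^ q)) \<longlonglongrightarrow> L"
  shows "(\<lambda>n. (eps * F) $ n / (4 ^ n * real n ^ q)) \<longlonglongrightarrow> 0"
proof -
  define g where "g n = F $ n / 4 ^ n" for n
  have glim: "(\<lambda>n. g n / real n ^ q) \<longlonglongrightarrow> L"
    using lim by (simp add: g_def)
  obtain K where K: "\<bar>g n\<bar> \<le> K * real n ^ q" if "n \<ge> 1" for n
  proof -
    obtain K where "\<bar>g n / real n ^ q\<bar> \<le> K" for n
      using convergent_imp_Bseq[OF convergentI[OF glim]] by (auto simp: Bseq_def)
    then show ?thesis by (intro that[of K]) (auto simp: divide_simps)
  qed
  define K' where "K' = \<bar>K\<bar> + \<bar>g 0\<bar>"
  have K': "\<bar>g m\<bar> \<le> K' * real n ^ q" if "m \<le> n" "n \<ge> 1" for m n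
  proof (cases "m = 0")
    case True
    have "K' * 1 \<le> K' * real n ^ q"
      using that by (intro mult_left_mono) (auto simp: K'_def)
    moreover have "\<bar>g 0\<bar> \<le> K'" by (simp add: K'_def)
    ultimately show ?thesis using True by simp
  next
    case False
    then have "\<bar>g m\<bar> \<le> K * real m ^ q" using K by simp
    also have "\<dots> \<le> K' * real n ^ q"
      using that by (intro mult_mono power_mono) (auto simp: K'_def)
    finally show ?thesis .
  qed
  define a where "a k n = (if k \<le> n then eps $ k / 4 ^ k * (g (n - k) / real n ^ q) else 0)" for k n
  have shift_lim: "(\<lambda>n. a k n) \<longlonglongrightarrow> eps $ k / 4 ^ k * L" for k
  proof -
    have "(\<lambda>n. g n / real n ^ q * (real n / real (n + k)) ^ q) \<longlonglongrightarrow> L * 1 ^ q"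
      by (intro tendsto_mult glim tendsto_power) real_asymp
    moreover have "\<forall>\<^sub>F n in sequentially. g n / real n ^ q * (real n / real (n + k)) ^ q
        = g n / real (n + k) ^ q"
      using eventually_gt_at_top[of 0] by eventually_elim (simp add: power_divide)
    ultimately have "(\<lambda>n. g n / real (n + k) ^ q) \<longlonglongrightarrow> L"
      using Lim_transform_eventually by fastforce
    then have "(\<lambda>n. eps $ k / 4 ^ k * (g n / real (n + k) ^ q)) \<longlonglongrightarrow> eps $ k / 4 ^ k * L"
      by (rule tendsto_mult_left)
    then have "(\<lambda>n. a k (n + k)) \<longlonglongrightarrow> eps $ k / 4 ^ k * L"
      by (simp add: a_def)
    then show ?thesis by (rule LIMSEQ_offset)
  qed
  have "\<forall>\<^sub>F (k, n) in at_top \<times>\<^sub>F sequentially. norm (a k n) \<le> \<bar>eps $ k / 4 ^ k\<bar> * K'"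
  proof -
    have "norm (a k n) \<le> \<bar>eps $ k / 4 ^ k\<bar> * K'" if "n \<ge> 1" for k n
    proof (cases "k \<le> n")
      case True
      have "\<bar>g (n - k) / real n ^ q\<bar> \<le> K'"
        using K'[of "n - k" n] that by (simp add: abs_divide divide_simps)
      then show ?thesis
        using True by (simp only: a_def if_True real_norm_def abs_mult) (intro mult_left_mono; simp)
    qed (simp add: a_def K'_def)
    then show ?thesis
      unfolding eventually_prod_filter
      by (intro exI[of _ "\<lambda>_. True"] exI[of _ "\<lambda>n. n \<ge> 1"]) (auto simp: eventually_ge_at_top)
  qed
  then have "(\<lambda>n. suminf (\<lambda>k. a k n)) \<longlonglongrightarrow> suminf (\<lambda>k. eps $ k / 4 ^ k * L)"
    using tannerys_theorem[of a "\<lambda>k. eps $ k / 4 ^ k * L" sequentially "\<lambda>k. \<bar>eps $ k / 4 ^ k\<bar> * K'"]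
      shift_lim summable_mult2[OF eps_abs_summable] by simp
  also have "suminf (\<lambda>k. eps $ k / 4 ^ k * L) = 0"
    using sums_mult2[OF eps_sums_0, of L] by (simp add: sums_iff)
  also have "(\<lambda>n. suminf (\<lambda>k. a k n)) = (\<lambda>n. (eps * F) $ n / (4 ^ n * real n ^ q))"
  proof
    fix n
    have "suminf (\<lambda>k. a k n) = (\<Sum>k\<le>n. a k n)"
      by (rule suminf_finite) (auto simp: a_def)
    also have "\<dots> = (\<Sum>k\<le>n. eps $ k * F $ (n - k) / (4 ^ n * real n ^ q))"
      by (rule sum.cong) (auto simp: a_def g_def simp flip: power_add)
    also have "\<dots> = (eps * F) $ n / (4 ^ n * real n ^ q)"
      by (simp add: fps_mult_nth sum_divide_distrib atLeast0AtMost)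
    finally show "suminf (\<lambda>k. a k n) = (eps * F) $ n / (4 ^ n * real n ^ q)" .
  qed
  finally show ?thesis .
qed

text \<open>Polynomials in \<open>eps\<close>, in Horner form: the rule \<open>step\<close> adds exactly one factor \<open>eps\<close>, so
  the previous lemma applies to it in an induction.\<close>

inductive_set eps_polys :: "real fps set" where
  const: "fps_const c \<in> eps_polys"
| step: "G \<in> eps_polys \<Longrightarrow> fps_const c + eps * G \<in> eps_polys"

lemma eps_polys_const_mult: "G \<in> eps_polys \<Longrightarrow> fps_const d * G \<in> eps_polys"
proof (induction rule: eps_polys.induct)
  case (step G c)
  have "fps_const d * (fps_const c + eps * G) = fps_const (d * c) + eps * (fps_const d * G)"
    by (simp add: algebra_simps)
  then show ?case using step eps_polys.step by metis
qed (simp add: eps_polys.const)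

lemma eps_polys_add_const: "G \<in> eps_polys \<Longrightarrow> fps_const d + G \<in> eps_polys"
proof (induction rule: eps_polys.induct)
  case (step G c)
  have "fps_const d + (fps_const c + eps * G) = fps_const (d + c) + eps * G"
    by (simp add: algebra_simps flip: fps_const_add)
  then show ?case using step eps_polys.step by metis
qed (simp add: eps_polys.const)

lemma eps_polys_add: "F \<in> eps_polys \<Longrightarrow> G \<in> eps_polys \<Longrightarrow> F + G \<in> eps_polys"
proof (induction arbitrary: G rule: eps_polys.induct)
  case (step F c)
  from \<open>G \<in> eps_polys\<close> show ?case
  proof cases
    case (const d)
    then show ?thesis
      using eps_polys_add_const[OF eps_polys.step[OF step.hyps]] by (simp add: add.commute)
  next
    case (step G' d)
    have "fps_const c + eps * F + (fps_const d + eps * G') = fps_const (c + d) + eps * (F + G')"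
      by (simp add: algebra_simps flip: fps_const_add)
    then show ?thesis using step step.IH eps_polys.step by metis
  qed
qed (rule eps_polys_add_const)

lemma eps_polys_eps_mult: "G \<in> eps_polys \<Longrightarrow> eps * G \<in> eps_polys"
  using eps_polys.step[of G 0] by simp

lemma eps_polys_mult: "F \<in> eps_polys \<Longrightarrow> G \<in> eps_polys \<Longrightarrow> F * G \<in> eps_polys"
proof (induction rule: eps_polys.induct)
  case (step F c)
  have "(fps_const c + eps * F) * G = fps_const c * G + eps * (F * G)"
    by (simp add: algebra_simps)
  then show ?case
    using step by (metis eps_polys_add eps_polys_const_mult eps_polys_eps_mult)
qed (rule eps_polys_const_mult)

lemma eps_polys_eps: "eps \<in> eps_polys"
  using eps_polys.step[OF eps_polys.const[of 1], of 0] by simp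

lemma eps_polys_uminus: "G \<in> eps_polys \<Longrightarrow> - G \<in> eps_polys"
  using eps_polys_const_mult[of G "-1"] by (simp flip: fps_const_neg)

lemma fourX_eps: "fourX = 1 - eps * eps"
  by (simp add: eps_square)

lemma eps_theta_eps: "eps * fps_XD eps = fps_const (- 1/2) * fourX"
proof -
  have "fps_deriv (eps * eps) = - fps_const 4"
    by (simp add: eps_square fourX_def)
  then have "fps_const 2 * (eps * fps_deriv eps) = - fps_const 4"
    by (simp add: numeral_fps_const[symmetric] algebra_simps)
  then have "fps_const (1/2) * fps_const 2 * (eps * fps_deriv eps) = fps_const (1/2) * (- fps_const 4)"
    by (simp only: mult.assoc)
  then have "eps * fps_deriv eps = - fps_const 2"
    by simp
  then have "eps * fps_XD eps = - fps_const 2 * fps_X"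
    by (simp add: fps_XD_def mult_ac)
  then show ?thesis by (simp add: fourX_def mult.assoc[symmetric])
qed

lemma fps_XD_mult: "fps_XD (F * G) = fps_XD F * G + F * fps_XD (G :: 'a :: comm_ring_1 fps)"
  by (simp add: fps_XD_def algebra_simps)

lemma fps_XD_power: "fps_XD (F ^ n) * F = of_nat n * fps_XD F * (F :: 'a :: comm_ring_1 fps) ^ n"
proof (induction n)
  case 0
  then show ?case by (simp add: fps_XD_def)
next
  case (Suc n)
  have "fps_XD (F ^ Suc n) * F = fps_XD F * F ^ Suc n + F * (fps_XD (F ^ n) * F)"
    by (simp add: fps_XD_mult algebra_simps)
  then show ?case unfolding Suc by (simp add: algebra_simps)
qed

lemma fourX_eps_polys: "fourX \<in> eps_polys"
  unfolding fourX_eps using eps_polys_add_const[of "-(eps * eps)" 1]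
  by (simp add: eps_polys_uminus eps_polys_mult eps_polys_eps)

lemma eps_polys_eps_theta: "G \<in> eps_polys \<Longrightarrow> eps * fps_XD G \<in> eps_polys"
proof (induction rule: eps_polys.induct)
  case (const c)
  then show ?case using eps_polys.const[of 0] by (simp add: fps_XD_def)
next
  case (step G c)
  have "eps * fps_XD (fps_const c + eps * G) = eps * fps_XD eps * G + eps * (eps * fps_XD G)"
    by (simp add: fps_XD_mult algebra_simps) (simp add: fps_XD_def)
  also have "\<dots> \<in> eps_polys"
    unfolding eps_theta_eps mult.assoc[of "fps_const _"] using step
    by (metis eps_polys_add eps_polys_const_mult eps_polys_mult fourX_eps_polys eps_polys_eps_mult)
  finally show ?case .
qed

text \<open>\<open>F = eps ^ (-m) (c + eps G)\<close> with a polynomial \<open>G\<close> in \<open>eps\<close>: a pole of order \<open>m\<close> with leading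
  coefficient \<open>c\<close>, where \<open>c = 0\<close> only bounds the order. Writing \<open>m\<close> as a difference of natural
  numbers treats zeros and poles alike without leaving the ring of power series.\<close>

definition leading :: "int \<Rightarrow> real \<Rightarrow> real fps \<Rightarrow> bool" where
  "leading m c F \<longleftrightarrow> (\<exists>a b. \<exists>G\<in>eps_polys. m = int a - int b \<and>
     F * eps ^ a = eps ^ b * (fps_const c + eps * G))"

lemma leadingI:
  "m = int a - int b \<Longrightarrow> G \<in> eps_polys \<Longrightarrow>
   F * eps ^ a = eps ^ b * (fps_const c + eps * G) \<Longrightarrow> leading m c F"
  unfolding leading_def by blast

lemma leading_const: "leading 0 c (fps_const c)"
  by (rule leadingI[of _ 0 0 "fps_const 0"]) (auto simp: eps_polys.const simp del: fps_const_0_eq_0)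

lemma leading_zero: "leading m 0 0"
proof -
  have "m = int (nat m) - int (nat (- m))" by simp
  then show ?thesis
    by (rule leadingI[of _ _ _ "fps_const 0"]) (use eps_polys.const[of 0] in auto)
qed

lemma leading_eps: "leading (- 1) 1 eps"
  by (rule leadingI[of _ 0 1 "fps_const 0"]) (use eps_polys.const[of 0] in auto)

lemma leading_weaken:
  assumes "leading m c F" "m < m'"
  shows "leading m' 0 F"
proof -
  obtain a b G where G: "G \<in> eps_polys" "m = int a - int b"
    "F * eps ^ a = eps ^ b * (fps_const c + eps * G)"
    using assms(1) unfolding leading_def by blast
  define d where "d = nat (m' - m) - 1"
  have "F * eps ^ (a + Suc d) = F * eps ^ a * eps ^ Suc d"
    by (simp only: power_add mult.assoc)
  also have "\<dots> = eps ^ b * (fps_const 0 + eps * (eps ^ d * (fps_const c + eps * G)))"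
    unfolding G by (simp add: algebra_simps)
  finally have eq: "F * eps ^ (a + Suc d) = eps ^ b * (fps_const 0 + eps * (eps ^ d * (fps_const c + eps * G)))" .
  have "eps ^ d \<in> eps_polys"
    using eps_polys.const[of 1] by (induction d) (auto intro: eps_polys_mult eps_polys_eps)
  then show ?thesis
    using G assms(2)
    by (intro leadingI[OF _ _ eq]) (auto simp: d_def intro!: eps_polys_mult eps_polys.step)
qed

lemma leading_add:
  assumes "leading m c F" "leading m d G"
  shows "leading m (c + d) (F + G)"
proof -
  obtain a b H where F: "H \<in> eps_polys" "m = int a - int b"
    "F * eps ^ a = eps ^ b * (fps_const c + eps * H)"
    using assms(1) unfolding leading_def by blast
  obtain a' b' H' where G: "H' \<in> eps_polys" "m = int a' - int b'"
    "G * eps ^ a' = eps ^ b' * (fps_const d + eps * H')"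
    using assms(2) unfolding leading_def by blast
  have b: "a + b' = a' + b" using F G by linarith
  have "(F + G) * eps ^ (a + a') = (F * eps ^ a) * eps ^ a' + (G * eps ^ a') * eps ^ a"
    by (simp add: power_add algebra_simps)
  also have "\<dots> = eps ^ (a' + b) * (fps_const c + eps * H) + eps ^ (a + b') * (fps_const d + eps * H')"
    unfolding F G by (simp add: power_add algebra_simps)
  also have "\<dots> = eps ^ (a' + b) * (fps_const (c + d) + eps * (H + H'))"
    unfolding b by (simp add: algebra_simps flip: fps_const_add)
  finally show ?thesis
    using F G by (intro leadingI[of _ "a + a'" "a' + b" "H + H'"]) (auto intro: eps_polys_add)
qed

lemma leading_mult:
  assumes "leading m c F" "leading m' d G"
  shows "leading (m + m') (c * d) (F * G)"
proof -
  obtain a b H where F: "H \<in> eps_polys" "m = int a - int b"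
    "F * eps ^ a = eps ^ b * (fps_const c + eps * H)"
    using assms(1) unfolding leading_def by blast
  obtain a' b' H' where G: "H' \<in> eps_polys" "m' = int a' - int b'"
    "G * eps ^ a' = eps ^ b' * (fps_const d + eps * H')"
    using assms(2) unfolding leading_def by blast
  let ?K = "fps_const c * H' + H * (fps_const d + eps * H')"
  have "(F * G) * eps ^ (a + a') = (F * eps ^ a) * (G * eps ^ a')"
    by (simp add: power_add algebra_simps)
  also have "\<dots> = eps ^ (b + b') * (fps_const (c * d) + eps * ?K)"
    unfolding F G by (simp add: power_add algebra_simps flip: fps_const_mult)
  finally show ?thesis
    using F G by (intro leadingI[of _ "a + a'" "b + b'" ?K])
      (auto intro!: eps_polys_add eps_polys_mult eps_polys.step eps_polys.const)
qed

lemma leading_const_mult: "leading m c F \<Longrightarrow> leading m (d * c) (fps_const d * F)"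
  using leading_mult[OF leading_const] by fastforce

lemma leading_diff: "leading m c F \<Longrightarrow> leading m d G \<Longrightarrow> leading m (c - d) (F - G)"
  using leading_add[OF _ leading_const_mult[of m d G "-1"], of c F] by (simp flip: fps_const_neg)

lemma leading_sum:
  assumes "\<And>x. x \<in> A \<Longrightarrow> leading m (c x) (F x)"
  shows "leading m (\<Sum>x\<in>A. c x) (\<Sum>x\<in>A. F x)"
  using assms by (induction A rule: infinite_finite_induct) (auto intro: leading_add leading_zero)

lemma leading_divide_eps:
  assumes "leading m c (eps * F)"
  shows "leading (m + 1) c F"
proof -
  obtain a b G where G: "G \<in> eps_polys" "m = int a - int b"
    "eps * F * eps ^ a = eps ^ b * (fps_const c + eps * G)"
    using assms unfolding leading_def by blast
  then show ?thesis
    by (intro leadingI[of _ "Suc a" b G]) (auto simp: mult_ac)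
qed

text \<open>For \<open>\<theta> = x d/dx\<close> one has \<open>eps \<theta>(eps) = -2x\<close> and \<open>4x = 1 - eps ^ 2\<close>, hence
  \<open>\<theta>(eps ^ (-m)) = m/2 (eps ^ (-m-2) - eps ^ (-m))\<close>.\<close>

lemma leading_theta:
  assumes "leading m c F"
  shows "leading (m + 2) (of_int m / 2 * c) (fps_XD F)"
proof -
  obtain a b G where G: "G \<in> eps_polys" "m = int a - int b"
    and eq: "F * eps ^ a = eps ^ b * (fps_const c + eps * G)"
    using assms unfolding leading_def by blast
  let ?P = "fps_const c + eps * G" and ?t = "fps_XD eps"
  have "fps_XD (F * eps ^ a) * eps = fps_XD F * eps ^ a * eps + of_nat a * ?t * (F * eps ^ a)"
    unfolding fps_XD_mult distrib_right mult.assoc fps_XD_power by (simp add: mult_ac)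
  moreover have "fps_XD (eps ^ b * ?P) * eps = of_nat b * ?t * (eps ^ b * ?P) + eps ^ b * fps_XD ?P * eps"
    unfolding fps_XD_mult distrib_right by (simp add: mult_ac fps_XD_power[simplified mult_ac])
  ultimately have "fps_XD F * eps ^ a * eps
      = eps ^ b * ((of_nat b - of_nat a) * ?t * ?P + eps * fps_XD ?P)"
    unfolding eq by (simp add: algebra_simps)
  then have "eps * (fps_XD F * eps ^ a * eps)
      = eps * (eps ^ b * ((of_nat b - of_nat a) * ?t * ?P + eps * fps_XD ?P))"
    by simp
  then have "fps_XD F * eps ^ (a + 2)
      = eps ^ b * ((of_nat b - of_nat a) * (eps * ?t) * ?P + eps * (eps * fps_XD ?P))"
    by (simp add: algebra_simps power2_eq_square)
  also have "(of_nat b - of_nat a) * (eps * ?t) = fps_const (of_int m / 2) * fourX"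
    unfolding eps_theta_eps
    by (simp add: G mult.assoc[symmetric] fps_of_nat[symmetric] diff_divide_distrib flip: fps_const_sub)

  also have "fps_const (of_int m / 2) * fourX * ?P + eps * (eps * fps_XD ?P)
      = fps_const (of_int m / 2 * c) + eps * (fps_const (of_int m / 2) * (G + - (eps * ?P)) + eps * fps_XD ?P)"
    by (simp add: fourX_eps algebra_simps flip: fps_const_mult)
  finally have *: "fps_XD F * eps ^ (a + 2) = eps ^ b * (fps_const (of_int m / 2 * c)
      + eps * (fps_const (of_int m / 2) * (G + - (eps * ?P)) + eps * fps_XD ?P))" .
  show ?thesis
    using G(2)
    by (intro leadingI[OF _ _ *] eps_polys_add eps_polys_const_mult eps_polys_eps_theta eps_polys.step
        eps_polys_uminus eps_polys_eps_mult G(1)) auto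
qed

lemma leading_theta_power:
  assumes "leading m c F"
  shows "\<exists>c'. leading (m + 2 * int p) c' ((fps_XD ^^ p) F)"
proof (induction p)
  case 0
  show ?case using assms by auto
next
  case (Suc p)
  then obtain c' where "leading (m + 2 * int p) c' ((fps_XD ^^ p) F)" by blast
  from leading_theta[OF this] show ?case by (auto simp: algebra_simps)
qed

lemma pole_coeff:
  "inverse ((1 - fourX) ^ Suc q) $ n = 4 ^ n * real ((q + n) choose n)"
  unfolding fourX_def by (subst one_minus_const_fps_X_neg_power') (simp_all add: mult.commute)

text \<open>The coefficients of \<open>(1 - 4x) ^ (-q-1)\<close> are \<open>4 ^ n\<close> times a binomial coefficient asymptotic to
  \<open>n ^ q / q!\<close>; every further factor \<open>eps\<close> makes the scaled coefficients vanish in the limit.\<close>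

lemma leading_transfer:
  assumes "leading (2 * int (Suc q)) c F"
  shows "(\<lambda>n. F $ n / (4 ^ n * real n ^ q)) \<longlonglongrightarrow> c / fact q"
proof -
  obtain a b G where G: "G \<in> eps_polys" "2 * int (Suc q) = int a - int b"
    and eq: "F * eps ^ a = eps ^ b * (fps_const c + eps * G)"
    using assms unfolding leading_def by blast
  have "a = 2 * Suc q + b" using G(2) by linarith
  then have "eps ^ b * (F * eps ^ (2 * Suc q)) = eps ^ b * (fps_const c + eps * G)"
    unfolding eq[symmetric] by (simp only: power_add mult_ac)
  then have "F * eps ^ (2 * Suc q) = fps_const c + eps * G"
    by simp
  also have "eps ^ (2 * Suc q) = (1 - fourX) ^ Suc q"
    unfolding power_mult by (simp add: power2_eq_square eps_square)
  finally have "F * (1 - fourX) ^ Suc q * inverse ((1 - fourX) ^ Suc q)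
      = (fps_const c + eps * G) * inverse ((1 - fourX) ^ Suc q)"
    by simp
  moreover have "(1 - fourX) ^ Suc q * inverse ((1 - fourX) ^ Suc q) = 1"
    by (rule inverse_mult_eq_1') (simp add: fourX_def fps_power_zeroth_eq_one)
  ultimately have F: "F = (fps_const c + eps * G) * inverse ((1 - fourX) ^ Suc q)"
    by (simp only: mult.assoc mult_1_right)
  let ?I = "inverse ((1 - fourX) ^ Suc q)"
  have base: "(\<lambda>n. (fps_const c * ?I) $ n / (4 ^ n * real n ^ q)) \<longlonglongrightarrow> c / fact q" for c
  proof -
    have "(\<lambda>n. real ((q + n) choose n) / real n ^ q) \<longlonglongrightarrow> 1 / fact q"
      using fact_binomial_limit[of q, where 'a = real] by simp
    from tendsto_mult_left[OF this, of c] show ?thesis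
      unfolding fps_mult_left_const_nth pole_coeff by (simp add: field_simps)
  qed
  have conv: "\<exists>L. (\<lambda>n. (H * ?I) $ n / (4 ^ n * real n ^ q)) \<longlonglongrightarrow> L" if "H \<in> eps_polys" for H
    using that
  proof (induction rule: eps_polys.induct)
    case (const c)
    then show ?case using base by blast
  next
    case (step H d)
    then obtain L where "(\<lambda>n. (H * ?I) $ n / (4 ^ n * real n ^ q)) \<longlonglongrightarrow> L" by blast
    from tendsto_add[OF base[of d] eps_convolution_tendsto_0[OF this]]
    show ?case by (intro exI) (simp add: algebra_simps add_divide_distrib)
  qed
  obtain L where "(\<lambda>n. (G * ?I) $ n / (4 ^ n * real n ^ q)) \<longlonglongrightarrow> L"
    using conv[OF G(1)] by blast
  from tendsto_add[OF base[of c] eps_convolution_tendsto_0[OF this]]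
  show ?thesis unfolding F by (simp add: algebra_simps add_divide_distrib)
qed

section \<open>The generating function of closed walks\<close>

text \<open>Let \<open>C\<^sub>v\<close> count the sequences of heights above \<open>v\<close> that are empty or begin with \<open>v + 1\<close> and rise by
  at most one per step, a height \<open>h\<close> having weight \<open>w h\<close>. The first entry \<open>v + 1\<close> is followed by a
  sequence counted by \<open>C\<close> for \<open>v + 1\<close>, and from the next entry \<open>v + 1\<close> on by one counted by \<open>C\<^sub>v\<close>
  again; the coefficients below express this decomposition.\<close>

fun climb_coeff :: "(nat \<Rightarrow> 'a::comm_ring_1) \<Rightarrow> nat \<Rightarrow> nat \<Rightarrow> 'a" where
  "climb_coeff w v 0 = 1"
| "climb_coeff w v (Suc n) =
     w (Suc v) * (\<Sum>i\<le>n. climb_coeff w (Suc v) i * climb_coeff w v (n - i))"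

declare climb_coeff.simps [simp del]

definition climb :: "(nat \<Rightarrow> 'a::comm_ring_1) \<Rightarrow> nat \<Rightarrow> 'a fps" where
  "climb w v = Abs_fps (climb_coeff w v)"

definition weighted_X :: "(nat \<Rightarrow> 'a::comm_ring_1) \<Rightarrow> nat \<Rightarrow> 'a fps" where
  "weighted_X w v = fps_const (w v) * fps_X"

lemma weighted_X_mult_nth: "(weighted_X w v * F) $ n = (case n of 0 \<Rightarrow> 0 | Suc m \<Rightarrow> w v * F $ m)"
  by (cases n) (simp_all add: weighted_X_def mult.assoc)

lemma climb_eq: "climb w v = 1 + weighted_X w (Suc v) * (climb w (Suc v) * climb w v)"
proof (rule fps_ext)
  fix n
  show "climb w v $ n = (1 + weighted_X w (Suc v) * (climb w (Suc v) * climb w v)) $ n"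
    unfolding fps_add_nth weighted_X_mult_nth
    by (cases n) (simp_all add: climb_def climb_coeff.simps fps_mult_nth atLeast0AtMost)
qed

text \<open>Unrolled, \<open>bridge w v\<close> is the sum over \<open>m \<ge> v\<close> of \<open>C\<close> for \<open>m + 1\<close> times the product of
  \<open>w i x C\<^sub>i\<^sub>-\<^sub>1 C\<^sub>i\<close> over \<open>v < i \<le> m\<close>: one sequence climbs to height \<open>m\<close> while another descends
  from height \<open>m + 1\<close>, and each level between contributes to both. The recursion on coefficients
  avoids the infinite sum.\<close>

fun bridge_coeff :: "(nat \<Rightarrow> 'a::comm_ring_1) \<Rightarrow> nat \<Rightarrow> nat \<Rightarrow> 'a" where
  "bridge_coeff w v 0 = 1"
| "bridge_coeff w v (Suc n) = climb w (Suc v) $ Suc n +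
     w (Suc v) * (\<Sum>i\<le>n. (climb w (Suc v) * climb w v) $ (n - i) * bridge_coeff w (Suc v) i)"

declare bridge_coeff.simps [simp del]

definition bridge :: "(nat \<Rightarrow> 'a::comm_ring_1) \<Rightarrow> nat \<Rightarrow> 'a fps" where
  "bridge w v = Abs_fps (bridge_coeff w v)"

lemma bridge_eq:
  "bridge w v = climb w (Suc v) + weighted_X w (Suc v) * climb w (Suc v) * climb w v * bridge w (Suc v)"
proof (rule fps_ext)
  fix n
  show "bridge w v $ n =
    (climb w (Suc v) + weighted_X w (Suc v) * climb w (Suc v) * climb w v * bridge w (Suc v)) $ n"
  proof (cases n)
    case 0
    then show ?thesis
      by (simp add: bridge_def bridge_coeff.simps climb_def climb_coeff.simps weighted_X_def)
  next
    case (Suc m)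
    have "(climb w (Suc v) * climb w v * bridge w (Suc v)) $ m
        = (bridge w (Suc v) * (climb w (Suc v) * climb w v)) $ m"
      by (simp add: mult_ac)
    also have "\<dots> = (\<Sum>i\<le>m. (climb w (Suc v) * climb w v) $ (m - i) * bridge w (Suc v) $ i)"
      by (subst fps_mult_nth) (simp add: mult_ac atLeast0AtMost)
    finally show ?thesis
      by (simp add: Suc mult.assoc[of "weighted_X _ _"] weighted_X_mult_nth bridge_def bridge_coeff.simps)
  qed
qed

text \<open>A state \<open>(a, b)\<close> records the heights of the residue classes \<open>2i\<close> and \<open>2i - 1\<close> of a core; the
  rules for one step are the order relations between neighbouring classes and the exclusion of
  consecutive elements.\<close>

type_synonym state = "nat \<times> nat"

definition step :: "state \<Rightarrow> state \<Rightarrow> bool" where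
  "step s s' \<longleftrightarrow> fst s' \<le> Suc (fst s) \<and> snd s' \<le> Suc (snd s) \<and>
     (fst s' = 0 \<or> snd s' = 0) \<and> (fst s = 0 \<or> snd s' = 0)"

fun walk :: "state \<Rightarrow> state list \<Rightarrow> bool" where
  "walk s [] \<longleftrightarrow> True"
| "walk s (s' # l) \<longleftrightarrow> step s s' \<and> walk s' l"

definition state_weight :: "(nat \<Rightarrow> 'a::comm_ring_1) \<Rightarrow> state \<Rightarrow> 'a" where
  "state_weight w s = w (fst s) * w (snd s)"

definition succs :: "state \<Rightarrow> state set" where
  "succs s = {s'. step s s'}"

lemma finite_succs [simp]: "finite (succs s)"
proof (rule finite_subset)
  show "succs s \<subseteq> {..Suc (fst s)} \<times> {..Suc (snd s)}"
    by (auto simp: succs_def step_def)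
qed simp

definition walks :: "nat \<Rightarrow> state \<Rightarrow> state list set" where
  "walks n s = {l. length l = n \<and> walk s l}"

lemma walks_0: "walks 0 s = {[]}"
  by (auto simp: walks_def)

lemma walks_Suc: "walks (Suc n) s = (\<Union>s'\<in>succs s. (#) s' ` walks n s')"
  by (auto simp: walks_def succs_def length_Suc_conv)

lemma finite_walks [simp]: "finite (walks n s)"
  by (induction n arbitrary: s) (auto simp: walks_0 walks_Suc)

definition pathsum :: "(nat \<Rightarrow> 'a::comm_ring_1) \<Rightarrow> nat \<Rightarrow> (state \<Rightarrow> 'a) \<Rightarrow> state \<Rightarrow> 'a" where
  "pathsum w n g s = (\<Sum>l\<in>walks n s. (\<Prod>x\<leftarrow>l. state_weight w x) * g (last (s # l)))"

lemma pathsum_0 [simp]: "pathsum w 0 g s = g s"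
  by (simp add: pathsum_def walks_0)

lemma pathsum_Suc: "pathsum w (Suc n) g s = (\<Sum>s'\<in>succs s. state_weight w s' * pathsum w n g s')"
proof -
  have "pathsum w (Suc n) g s
      = (\<Sum>s'\<in>succs s. \<Sum>l\<in>(#) s' ` walks n s'. (\<Prod>x\<leftarrow>l. state_weight w x) * g (last (s # l)))"
    unfolding pathsum_def walks_Suc by (rule sum.UNION_disjoint) auto
  also have "\<dots> = (\<Sum>s'\<in>succs s. \<Sum>l\<in>walks n s'. (\<Prod>x\<leftarrow>s' # l. state_weight w x) * g (last (s # s' # l)))"
    by (rule sum.cong[OF refl], subst sum.reindex) auto
  also have "\<dots> = (\<Sum>s'\<in>succs s. state_weight w s' * pathsum w n g s')"
    by (simp add: pathsum_def sum_distrib_left mult.assoc)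
  finally show ?thesis .
qed

lemma pathsum_Suc_last: "pathsum w (Suc n) g s = pathsum w n (pathsum w 1 g) s"
  by (induction n arbitrary: s) (simp_all add: pathsum_Suc)

lemma sum_succs_B:
  assumes "w 0 = 1"
  shows "(\<Sum>s'\<in>succs (0, h). state_weight w s' * f s')
       = f (0, 0) + w 1 * f (1, 0) + (\<Sum>i\<in>{1..Suc h}. w i * f (0, i))"
proof -
  have "succs (0, h) = {(0, 0), (1, 0)} \<union> Pair 0 ` {1..Suc h}"
    by (force simp: succs_def step_def)
  also have "(\<Sum>s'\<in>\<dots>. state_weight w s' * f s')
      = (\<Sum>s'\<in>{(0, 0), (1, 0)}. state_weight w s' * f s') + (\<Sum>s'\<in>Pair 0 ` {1..Suc h}. state_weight w s' * f s')"
    by (rule sum.union_disjoint) auto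
  also have "(\<Sum>s'\<in>Pair 0 ` {1..Suc h}. state_weight w s' * f s') = (\<Sum>i\<in>{1..Suc h}. w i * f (0, i))"
    by (subst sum.reindex) (auto simp: inj_on_def state_weight_def assms)
  finally show ?thesis by (simp add: state_weight_def assms)
qed

lemma sum_succs_A:
  assumes "w 0 = 1" "a > 0"
  shows "(\<Sum>s'\<in>succs (a, 0). state_weight w s' * f s') = f (0, 0) + (\<Sum>i\<in>{1..Suc a}. w i * f (i, 0))"
proof -
  have "succs (a, 0) = insert (0, 0) ((\<lambda>i. (i, 0)) ` {1..Suc a})"
    using assms(2) by (force simp: succs_def step_def)
  also have "(\<Sum>s'\<in>\<dots>. state_weight w s' * f s')
      = state_weight w (0, 0) * f (0, 0) + (\<Sum>s'\<in>(\<lambda>i. (i, 0)) ` {1..Suc a}. state_weight w s' * f s')"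
    by (rule sum.insert) auto
  also have "(\<Sum>s'\<in>(\<lambda>i. (i, 0)) ` {1..Suc a}. state_weight w s' * f s') = (\<Sum>i\<in>{1..Suc a}. w i * f (i, 0))"
    by (subst sum.reindex) (auto simp: inj_on_def state_weight_def assms)
  finally show ?thesis by (simp add: state_weight_def assms)
qed

text \<open>Walks whose first state is \<open>(0, 0)\<close> or \<open>(1, 0)\<close>, weighted by a function of the last first
  coordinate. This is what remains of a walk from \<open>(0, h)\<close> once its initial run of positive second
  coordinates is over; for \<open>n = 0\<close> the first coordinate is still 0.\<close>

definition startsum :: "(nat \<Rightarrow> 'a::comm_ring_1) \<Rightarrow> nat \<Rightarrow> (nat \<Rightarrow> 'a) \<Rightarrow> 'a" where
  "startsum w n g = (case n of 0 \<Rightarrow> g 0 | Suc m \<Rightarrow>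
     pathsum w m (g \<circ> fst) (0, 0) + w 1 * pathsum w m (g \<circ> fst) (1, 0))"

definition path_gf :: "(nat \<Rightarrow> 'a::comm_ring_1) \<Rightarrow> (nat \<Rightarrow> 'a) \<Rightarrow> state \<Rightarrow> 'a fps" where
  "path_gf w g s = Abs_fps (\<lambda>n. pathsum w n (g \<circ> fst) s)"

definition start_gf :: "(nat \<Rightarrow> 'a::comm_ring_1) \<Rightarrow> (nat \<Rightarrow> 'a) \<Rightarrow> 'a fps" where
  "start_gf w g = Abs_fps (\<lambda>n. startsum w n g)"

text \<open>The initial runs of positive second coordinates from a state \<open>(0, h)\<close>, cut where they reach a
  new minimum.\<close>

fun descend :: "(nat \<Rightarrow> 'a::comm_ring_1) \<Rightarrow> nat \<Rightarrow> 'a fps" where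
  "descend w 0 = climb w 0"
| "descend w (Suc h) = climb w (Suc h) * descend w h"

lemma descend_eq: "descend w h = 1 + (\<Sum>i\<in>{1..Suc h}. weighted_X w i * descend w i)"
proof (induction h)
  case 0
  show ?case using climb_eq[of w 0] by simp
next
  case (Suc h)
  have "descend w (Suc h)
      = (1 + weighted_X w (Suc (Suc h)) * (climb w (Suc (Suc h)) * climb w (Suc h))) * descend w h"
    by (simp only: climb_eq[symmetric] descend.simps)
  then have "descend w (Suc h) = descend w h + weighted_X w (Suc (Suc h)) * descend w (Suc (Suc h))"
    by (simp only: descend.simps distrib_right mult_1_left mult.assoc)
  then show ?case by (subst (asm) Suc) (simp add: add_ac)
qed

lemma pathsum_add: "pathsum w n (\<lambda>s. g s + h s) s = pathsum w n g s + pathsum w n h s"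
  by (simp add: pathsum_def distrib_left sum.distrib)

lemma start_gf_add: "start_gf w (\<lambda>a. g a + h a) = start_gf w g + start_gf w h"
  by (rule fps_ext)
     (simp add: start_gf_def startsum_def pathsum_add o_def algebra_simps split: nat.split)

lemma start_gf_eq: "start_gf w g = fps_const (g 0) + fps_X * path_gf w g (0, 0) + weighted_X w 1 * path_gf w g (1, 0)"
  by (rule fps_ext) (auto simp: start_gf_def startsum_def path_gf_def weighted_X_mult_nth split: nat.split)

lemma path_gf_eq: "path_gf w g s = fps_const (g (fst s)) + fps_X * (\<Sum>s'\<in>succs s. fps_const (state_weight w s') * path_gf w g s')"
proof (rule fps_ext)
  fix n
  show "path_gf w g s $ n = (fps_const (g (fst s)) + fps_X * (\<Sum>s'\<in>succs s. fps_const (state_weight w s') * path_gf w g s')) $ n"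
    by (cases n) (simp_all add: path_gf_def pathsum_Suc fps_sum_nth)
qed

lemma path_gf_B_eq:
  assumes "w 0 = 1"
  shows "path_gf w g (0, h) = start_gf w g + (\<Sum>i\<in>{1..Suc h}. weighted_X w i * path_gf w g (0, i))"
proof -
  have "(\<Sum>s'\<in>succs (0, h). fps_const (state_weight w s') * path_gf w g s')
      = path_gf w g (0, 0) + fps_const (w 1) * path_gf w g (1, 0) + (\<Sum>i\<in>{1..Suc h}. fps_const (w i) * path_gf w g (0, i))"
    using sum_succs_B[of "\<lambda>i. fps_const (w i)" "path_gf w g" h] by (simp add: assms state_weight_def)
  then show ?thesis
    by (subst path_gf_eq, subst start_gf_eq) (simp add: weighted_X_def algebra_simps sum_distrib_left)
qed

lemma path_gf_A_eq:
  assumes "w 0 = 1" "a > 0"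
  shows "path_gf w g (a, 0) = fps_const (g a) + fps_X * path_gf w g (0, 0) + (\<Sum>i\<in>{1..Suc a}. weighted_X w i * path_gf w g (i, 0))"
proof -
  have "(\<Sum>s'\<in>succs (a, 0). fps_const (state_weight w s') * path_gf w g s')
      = path_gf w g (0, 0) + (\<Sum>i\<in>{1..Suc a}. fps_const (w i) * path_gf w g (i, 0))"
    using sum_succs_A[of "\<lambda>i. fps_const (w i)" a "path_gf w g"] assms by (simp add: state_weight_def)
  then show ?thesis
    by (subst path_gf_eq) (simp add: weighted_X_def algebra_simps sum_distrib_left)
qed

text \<open>Every term of the sum carries a factor \<open>x\<close>, so the system determines the coefficients one after
  the other.\<close>

lemma descend_unique:
  assumes "\<And>h. F h = c + (\<Sum>i\<in>{1..Suc h}. weighted_X w i * F i)"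
  shows "F h = descend w h * c"
proof -
  define G where "G h = F h - descend w h * c" for h
  have G: "G h = (\<Sum>i\<in>{1..Suc h}. weighted_X w i * G i)" for h
    unfolding G_def right_diff_distrib sum_subtractf
    by (subst assms, subst descend_eq) (simp add: algebra_simps sum_distrib_left sum_distrib_right)
  have "G h $ n = 0" for n
  proof (induction n arbitrary: h)
    case 0
    show ?case by (subst G) (simp add: fps_sum_nth weighted_X_mult_nth del: fps_mult_nth_0)
  next
    case (Suc n)
    show ?case by (subst G) (simp add: fps_sum_nth weighted_X_mult_nth Suc)
  qed
  then have "G h = 0" by (simp add: fps_eq_iff)
  then show ?thesis by (simp add: G_def)
qed

lemma path_gf_B: "w 0 = 1 \<Longrightarrow> path_gf w g (0, h) = descend w h * start_gf w g"
  by (rule descend_unique) (rule path_gf_B_eq)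

text \<open>The system for the first coordinate has the same shape as the one for the second. A run of
  positive first coordinates is counted by \<open>descend w 0\<close>; after it the walk stops or enters
  \<open>(0, 0)\<close>.\<close>

lemma start_gf_total:
  assumes "w 0 = 1"
  shows "start_gf w (\<lambda>_. 1) = climb w 0 * (1 + fps_X * climb w 0 * start_gf w (\<lambda>_. 1))"
proof -
  define F where "F a = (if a = 0 then start_gf w (\<lambda>_. 1) else path_gf w (\<lambda>_. 1) (a, 0))" for a
  have "F 0 = descend w 0 * (1 + fps_X * path_gf w (\<lambda>_. 1) (0, 0))"
  proof (rule descend_unique)
    fix h
    have "(\<Sum>i\<in>{1..Suc h}. weighted_X w i * F i) = (\<Sum>i\<in>{1..Suc h}. weighted_X w i * path_gf w (\<lambda>_. 1) (i, 0))"
      by (rule sum.cong) (auto simp: F_def)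
    then show "F h = 1 + fps_X * path_gf w (\<lambda>_. 1) (0, 0) + (\<Sum>i\<in>{1..Suc h}. weighted_X w i * F i)"
      using path_gf_A_eq[of w h, OF assms, of "\<lambda>_. 1"] start_gf_eq[of w "\<lambda>_. 1"] by (cases "h = 0") (simp_all add: F_def)
  qed
  then show ?thesis by (simp add: F_def path_gf_B[of w, OF assms] mult.assoc)
qed

lemma start_gf_total':
  assumes "w 0 = 1"
  shows "start_gf w (\<lambda>_. 1) * (1 - fps_X * climb w 0 - weighted_X w 1 * climb w 1) = 1"
proof -
  let ?N = "start_gf w (\<lambda>_. 1)" and ?C = "climb w 0" and ?k = "1 - weighted_X w 1 * climb w 1"
  have k: "?C * ?k = 1"
    using climb_eq[of w 0] by (simp add: algebra_simps)
  have "?N * ?k = ?C * ?k * (1 + fps_X * ?C * ?N)"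
    by (subst start_gf_total[of w, OF assms]) (simp add: mult_ac)
  also have "\<dots> = 1 + fps_X * ?C * ?N" unfolding k by simp
  finally show ?thesis by (simp add: algebra_simps)
qed

definition ends_at :: "nat \<Rightarrow> nat \<Rightarrow> 'a::comm_ring_1" where
  "ends_at m a = of_bool (a = m)"

definition ends_above :: "nat \<Rightarrow> nat \<Rightarrow> 'a::comm_ring_1" where
  "ends_above m a = of_bool (m \<le> a)"

text \<open>The last state has first coordinate \<open>m + 1\<close> only if it is \<open>(m + 1, 0)\<close>, and then the state before
  it can be any one whose first coordinate is at least \<open>m\<close>.\<close>

lemma startsum_ends_at:
  assumes "w 0 = 1"
  shows "startsum w (Suc n) (ends_at (Suc m)) = w (Suc m) * startsum w n (ends_above m)"
proof -
  have last: "pathsum w 1 (ends_at (Suc m) \<circ> fst) = (\<lambda>s. w (Suc m) * (ends_above m \<circ> fst) s)"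
  proof
    fix s :: state
    have "pathsum w 1 (ends_at (Suc m) \<circ> fst) s = (\<Sum>s'\<in>succs s. if s' = (Suc m, 0) then w (Suc m) else 0)"
    proof -
      have "state_weight w s' * ends_at (Suc m) (fst s') = (if s' = (Suc m, 0) then w (Suc m) else 0)"
        if "s' \<in> succs s" for s'
        using that by (auto simp: ends_at_def state_weight_def assms succs_def step_def prod_eq_iff)
      then show ?thesis by (simp add: pathsum_Suc cong: sum.cong)
    qed
    also have "\<dots> = w (Suc m) * (ends_above m \<circ> fst) s"
    proof -
      have "(Suc m, 0) \<in> succs s \<longleftrightarrow> m \<le> fst s" by (auto simp: succs_def step_def)
      then show ?thesis by (simp add: ends_above_def)
    qed
    finally show "pathsum w 1 (ends_at (Suc m) \<circ> fst) s = w (Suc m) * (ends_above m \<circ> fst) s" .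
  qed
  have lin: "pathsum w k (\<lambda>s. c * g s) s = c * pathsum w k g s" for k c g s
    by (simp add: pathsum_def sum_distrib_left mult_ac)
  show ?thesis
  proof (cases n)
    case 0
    then show ?thesis by (auto simp: startsum_def ends_at_def ends_above_def)
  next
    case (Suc k)
    then show ?thesis
      by (simp add: startsum_def pathsum_Suc_last[of w k] last[unfolded o_def] lin algebra_simps o_def del: One_nat_def)
  qed
qed

lemma start_gf_ends_at_Suc:
  "w 0 = 1 \<Longrightarrow> start_gf w (ends_at (Suc m)) = weighted_X w (Suc m) * start_gf w (ends_above m)"
proof (rule fps_ext)
  fix n
  assume w0: "w 0 = 1"
  show "start_gf w (ends_at (Suc m)) $ n = (weighted_X w (Suc m) * start_gf w (ends_above m)) $ n"
  proof (cases n)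
    case 0
    then show ?thesis by (simp add: start_gf_def weighted_X_def startsum_def ends_at_def)
  next
    case (Suc k)
    then show ?thesis by (simp add: start_gf_def weighted_X_mult_nth startsum_ends_at w0)
  qed
qed

lemma start_gf_ends_above_split:
  "start_gf w (ends_above m) = start_gf w (ends_at m) + start_gf w (ends_above (Suc m))"
  unfolding start_gf_add[symmetric]
  by (rule arg_cong[of _ _ "start_gf w"]) (auto simp: ends_above_def ends_at_def fun_eq_iff)

lemma pathsum_ends_above_eq_0:
  "fst s + n < m \<Longrightarrow> pathsum w n (ends_above m \<circ> fst) s = 0"
proof (induction n arbitrary: s)
  case (Suc n)
  have "pathsum w n (ends_above m \<circ> fst) s' = 0" if "s' \<in> succs s" for s'
    using Suc.prems that by (intro Suc.IH) (auto simp: succs_def step_def)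
  then show ?case by (simp add: pathsum_Suc o_def)
qed (auto simp: ends_above_def)

lemma start_gf_ends_above_nth_0: "n < m \<Longrightarrow> start_gf w (ends_above m) $ n = 0"
  by (auto simp: start_gf_def startsum_def pathsum_ends_above_eq_0 ends_above_def split: nat.split)

text \<open>The last step gives a three-term recursion in \<open>m\<close>, which has many solutions; this one is singled
  out because a walk needs \<open>m\<close> steps to reach \<open>m\<close>. The defect \<open>D m\<close> of the claim is divisible by
  \<open>x ^ (m + 1)\<close> and equals \<open>D (m + 1)\<close> times a power series, so it is divisible by every power of
  \<open>x\<close>.\<close>

lemma start_gf_ends_above_Suc:
  assumes "w 0 = 1"
  shows "start_gf w (ends_above (Suc m)) = weighted_X w (Suc m) * climb w (Suc m) * start_gf w (ends_above m)"
proof -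
  define D where
    "D m = start_gf w (ends_above (Suc m)) - weighted_X w (Suc m) * climb w (Suc m) * start_gf w (ends_above m)" for m
  have D_step: "D m = climb w (Suc m) * D (Suc m)" for m
  proof -
    let ?s = "\<lambda>m. start_gf w (ends_above m)" and ?c = "climb w" and ?x = "weighted_X w"
    have c: "?c (Suc m) = 1 + ?x (Suc (Suc m)) * (?c (Suc (Suc m)) * ?c (Suc m))"
      by (rule climb_eq)
    have s: "?s (Suc m) = ?x (Suc m) * ?s m + ?s (Suc (Suc m))"
      by (subst start_gf_ends_above_split) (simp add: start_gf_ends_at_Suc assms)
    have "?c (Suc m) * D (Suc m) = ?c (Suc m) * ?s (Suc (Suc m))
        - (?x (Suc (Suc m)) * (?c (Suc (Suc m)) * ?c (Suc m))) * ?s (Suc m)"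
      by (simp add: D_def algebra_simps)
    also have "?x (Suc (Suc m)) * (?c (Suc (Suc m)) * ?c (Suc m)) = ?c (Suc m) - 1"
      using c by (simp add: algebra_simps)
    also have "?c (Suc m) * ?s (Suc (Suc m)) - (?c (Suc m) - 1) * ?s (Suc m)
        = ?s (Suc m) - ?c (Suc m) * (?s (Suc m) - ?s (Suc (Suc m)))"
      by (simp add: algebra_simps)
    also have "?s (Suc m) - ?s (Suc (Suc m)) = ?x (Suc m) * ?s m"
      using s by simp
    finally show ?thesis by (simp add: D_def mult_ac)
  qed
  have D_low: "D m $ n = 0" if "n \<le> m" for m n
    using that
    by (auto simp: D_def start_gf_ends_above_nth_0 mult.assoc weighted_X_mult_nth fps_mult_nth[of "climb _ _"] split: nat.split)
  have D_all: "\<forall>n<k + m. D m $ n = 0" for k m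
  proof (induction k arbitrary: m)
    case (Suc k)
    then have "\<forall>n<k + Suc m. D (Suc m) $ n = 0" by blast
    then show ?case by (auto simp: D_step[of m] fps_mult_nth)
  qed (use D_low in auto)
  have "D m $ n = 0" for n
    using D_all[where k = "Suc n" and m = m] by simp
  then have "D m = 0" by (simp add: fps_eq_iff)
  then show ?thesis by (simp add: D_def)
qed

lemma climb_start_gf_ends_at:
  assumes "w 0 = 1"
  shows "climb w m * start_gf w (ends_at m) = start_gf w (ends_above m)"
proof (cases m)
  case 0
  have "climb w 0 * (1 - weighted_X w 1 * climb w 1) = 1"
    using climb_eq[of w 0] by (simp add: algebra_simps)
  moreover have "start_gf w (ends_at 0) = (1 - weighted_X w 1 * climb w 1) * start_gf w (ends_above 0)"
    using start_gf_ends_above_split[of w 0] start_gf_ends_above_Suc[of w 0, OF assms] by (simp add: algebra_simps)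
  ultimately show ?thesis using 0 by (simp flip: mult.assoc)
next
  case (Suc k)
  then show ?thesis
    by (simp add: start_gf_ends_at_Suc start_gf_ends_above_Suc assms mult_ac)
qed

lemma walk_last_le: "walk s l \<Longrightarrow> fst (last (s # l)) \<le> fst s + length l"
  by (induction s l rule: walk.induct) (auto simp: step_def)

text \<open>The walks that describe cores. The second coordinate starts one above the first coordinate at
  the end, which closes the two height sequences to one cycle: subtracting \<open>2n + 3\<close> from an element
  of residue 1 gives residue \<open>2n\<close> two levels lower.\<close>

definition loops :: "nat \<Rightarrow> state list set" where
  "loops n = {l. length l = n \<and> walk (0, Suc (fst (last ((0, 0) # l)))) l}"

lemma loops_Union:
  "loops n = (\<Union>m\<in>{..n}. {l \<in> walks n (0, Suc m). fst (last ((0, Suc m) # l)) = m})" (is "_ = ?R")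
proof
  show "loops n \<subseteq> ?R"
  proof
    fix l assume l: "l \<in> loops n"
    define m where "m = fst (last ((0, 0) # l))"
    have "fst (last ((0, k) # l)) = m" for k by (simp add: m_def)
    moreover have "m \<le> n"
      using l walk_last_le[of "(0, Suc m)" l] by (auto simp: loops_def m_def split: if_splits)
    moreover from m_def have "l \<in> walks n (0, Suc m)"
      using l by (simp only: loops_def walks_def m_def mem_Collect_eq)
    ultimately show "l \<in> ?R" by (intro UN_I[of m] CollectI conjI) simp_all
  qed
  show "?R \<subseteq> loops n" by (auto simp: loops_def walks_def)
qed

lemma finite_loops [simp]: "finite (loops n)"
  by (simp add: loops_Union)

text \<open>Fix the last first coordinate \<open>m\<close>. The initial run from \<open>(0, m + 1)\<close> contributes
  \<open>descend w (m + 1)\<close> and the rest \<open>start_gf w (ends_at m)\<close>; their product is \<open>P m C\<^sub>m\<^sub>+\<^sub>1\<close>, and the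
  sum of these is an unrolled \<open>bridge\<close>. For the coefficient of \<open>x ^ n\<close> only \<open>m \<le> n\<close> matters.\<close>

lemma loops_gf:
  assumes w0: "w 0 = 1"
  defines "T \<equiv> Abs_fps (\<lambda>n. \<Sum>l\<in>loops n. \<Prod>x\<leftarrow>l. state_weight w x)"
  shows "T * (1 - fps_X * climb w 0 - weighted_X w 1 * climb w 1) = bridge w 0"
proof -
  define N where "N = start_gf w (\<lambda>_. 1)"
  define P where "P m = N * (\<Prod>i<m. weighted_X w (Suc i) * climb w (Suc i) * climb w i)" for m
  have N: "N = start_gf w (ends_above 0)"
    unfolding N_def by (rule arg_cong[of _ _ "start_gf w"]) (simp add: ends_above_def fun_eq_iff)
  have P: "descend w m * start_gf w (ends_at m) = P m" for m
  proof (induction m)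
    case 0
    then show ?case by (simp add: P_def N climb_start_gf_ends_at w0)
  next
    case (Suc m)
    have "descend w (Suc m) * start_gf w (ends_at (Suc m))
        = weighted_X w (Suc m) * climb w (Suc m) * climb w m * (descend w m * start_gf w (ends_at m))"
      by (simp add: start_gf_ends_at_Suc w0 climb_start_gf_ends_at[symmetric] mult_ac)
    then show ?case unfolding Suc by (simp add: P_def mult_ac)
  qed
  have telescope: "N * bridge w 0 = (\<Sum>m<k. P m * climb w (Suc m)) + P k * bridge w k" for k
  proof (induction k)
    case (Suc k)
    have "P k * bridge w k = P k * climb w (Suc k) + P (Suc k) * bridge w (Suc k)"
      by (subst bridge_eq) (simp add: P_def algebra_simps)
    then show ?case unfolding Suc by simp
  qed (simp add: P_def)
  have P_low: "(P k * F) $ n = 0" if "n < k" for k n F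
  proof -
    have "\<forall>F. \<forall>n<k. ((\<Prod>i<k. weighted_X w (Suc i) * climb w (Suc i) * climb w i) * F) $ n = 0"
    proof (induction k)
      case (Suc k)
      have "((\<Prod>i<Suc k. weighted_X w (Suc i) * climb w (Suc i) * climb w i) * F)
          = weighted_X w (Suc k) * ((\<Prod>i<k. weighted_X w (Suc i) * climb w (Suc i) * climb w i) * (climb w (Suc k) * climb w k * F))" for F
        by (simp add: mult_ac)
      then show ?case
        using Suc by (auto simp: weighted_X_mult_nth split: nat.split simp del: prod.lessThan_Suc)
    qed simp
    from this[rule_format, of n "N * F"] that show ?thesis by (simp add: P_def mult_ac)
  qed
  have "T $ n = (N * bridge w 0) $ n" for n
  proof -
    have "T $ n = (\<Sum>m\<le>n. \<Sum>l\<in>{l \<in> walks n (0, Suc m). fst (last ((0, Suc m) # l)) = m}. \<Prod>x\<leftarrow>l. state_weight w x)"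
      unfolding T_def fps_nth_Abs_fps loops_Union by (rule sum.UNION_disjoint) (auto split: if_splits)
    also have "\<dots> = (\<Sum>m\<le>n. path_gf w (ends_at m) (0, Suc m) $ n)"
    proof (rule sum.cong[OF refl])
      fix m
      show "(\<Sum>l\<in>{l \<in> walks n (0, Suc m). fst (last ((0, Suc m) # l)) = m}. \<Prod>x\<leftarrow>l. state_weight w x)
          = path_gf w (ends_at m) (0, Suc m) $ n"
        unfolding path_gf_def fps_nth_Abs_fps pathsum_def
        by (rule sum.mono_neutral_cong_left) (auto simp: ends_at_def)
    qed
    also have "\<dots> = (\<Sum>m<Suc n. (P m * climb w (Suc m)) $ n)"
      by (simp add: path_gf_B w0 mult.assoc P lessThan_Suc_atMost) (simp add: mult.commute)
    also have "\<dots> = (N * bridge w 0) $ n"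
      by (subst telescope[of "Suc n"]) (simp add: P_low fps_sum_nth)
    finally show ?thesis .
  qed
  then have "T = N * bridge w 0" by (simp add: fps_eq_iff)
  then have "T * (1 - fps_X * climb w 0 - weighted_X w 1 * climb w 1)
      = N * (1 - fps_X * climb w 0 - weighted_X w 1 * climb w 1) * bridge w 0"
    by (simp only: mult_ac)
  also have "N * (1 - fps_X * climb w 0 - weighted_X w 1 * climb w 1) = 1"
    unfolding N_def by (rule start_gf_total'[of w, OF w0])
  finally show ?thesis by simp
qed

section \<open>Moments of the statistics\<close>

text \<open>An object with sum of heights \<open>k\<close> and sum of squares \<open>S\<close> is represented by the monomial with
  exponent \<open>(k, S)\<close>. Real combinations of these monomials form a commutative ring, so the identities
  for general weights apply, and linear functionals read off the moments.\<close>

type_synonym stat_ring = "(nat \<times> nat) \<Rightarrow>\<^sub>0 real"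

definition pairing :: "(nat \<times> nat \<Rightarrow> real) \<Rightarrow> stat_ring \<Rightarrow> real" where
  "pairing \<phi> f = (\<Sum>x\<in>Poly_Mapping.keys f. Poly_Mapping.lookup f x * \<phi> x)"

lemma pairing_superset:
  "finite A \<Longrightarrow> Poly_Mapping.keys f \<subseteq> A \<Longrightarrow> pairing \<phi> f = (\<Sum>x\<in>A. Poly_Mapping.lookup f x * \<phi> x)"
  unfolding pairing_def by (rule sum.mono_neutral_left) (auto simp: in_keys_iff)

lemma pairing_zero [simp]: "pairing \<phi> 0 = 0"
  by (simp add: pairing_def)

lemma pairing_single [simp]: "pairing \<phi> (Poly_Mapping.single x c) = c * \<phi> x"
  by (subst pairing_superset[of "{x}"]) auto

lemma pairing_one [simp]: "pairing \<phi> 1 = \<phi> 0"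
  using pairing_single[of \<phi> 0 1] by simp

lemma pairing_add: "pairing \<phi> (f + g) = pairing \<phi> f + pairing \<phi> g"
proof -
  let ?A = "Poly_Mapping.keys f \<union> Poly_Mapping.keys g"
  show ?thesis
    using Poly_Mapping.keys_add[of f g]
    by (simp add: pairing_superset[of ?A] lookup_add distrib_right sum.distrib)
qed

lemma pairing_sum: "pairing \<phi> (\<Sum>x\<in>A. f x) = (\<Sum>x\<in>A. pairing \<phi> (f x))"
  by (induction A rule: infinite_finite_induct) (auto simp: pairing_add)

lemma pairing_diff: "pairing \<phi> (f - g) = pairing \<phi> f - pairing \<phi> g"
  using pairing_add[of \<phi> "f - g" g] by simp

lemma pairing_linear: "pairing (\<lambda>x. \<Sum>i\<in>A. c i * \<phi> i x) f = (\<Sum>i\<in>A. c i * pairing (\<phi> i) f)"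
  unfolding pairing_def sum_distrib_left by (subst sum.swap) (simp add: mult_ac)

lemma stat_ring_induct [case_names zero add]:
  assumes "P 0" "\<And>f x c. P f \<Longrightarrow> P (f + Poly_Mapping.single x c)"
  shows "P (f :: stat_ring)"
proof (induction f rule: update_induct)
  case (update f a b)
  have "Poly_Mapping.update a b f = f + Poly_Mapping.single a b"
    using update.hyps(1)
    by (intro poly_mapping_eqI) (auto simp: lookup_update lookup_add lookup_single in_keys_iff when_def)
  then show ?case using assms(2) update.IH by simp
qed (rule assms)

lemma pairing_mult: "pairing \<phi> (f * g) = pairing (\<lambda>x. pairing (\<lambda>y. \<phi> (x + y)) g) f"
proof (induction f rule: stat_ring_induct)
  case (add f x c)
  have "pairing \<phi> (Poly_Mapping.single x c * g) = c * pairing (\<lambda>y. \<phi> (x + y)) g"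
  proof (induction g rule: stat_ring_induct)
    case (add g y d)
    then show ?case by (simp add: distrib_left pairing_add mult_single)
  qed simp
  then show ?case using add by (simp add: distrib_right pairing_add)
qed simp

definition stat_monomial :: "nat \<Rightarrow> nat \<Rightarrow> nat \<times> nat \<Rightarrow> real" where
  "stat_monomial i l x = real (snd x) ^ i * real (fst x) ^ l"

definition moment :: "stat_ring fps \<Rightarrow> nat \<Rightarrow> nat \<Rightarrow> real fps" where
  "moment F i l = Abs_fps (\<lambda>n. pairing (stat_monomial i l) (F $ n))"

text \<open>The Leibniz rule for moments: the statistics \<open>k\<close> and \<open>S\<close> are additive when objects are
  combined.\<close>

definition binomial_conv :: "(nat \<Rightarrow> nat \<Rightarrow> 'a::comm_ring_1) \<Rightarrow> (nat \<Rightarrow> nat \<Rightarrow> 'a) \<Rightarrow> nat \<Rightarrow> nat \<Rightarrow> 'a" where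
  "binomial_conv f g i l = (\<Sum>p\<in>{..i} \<times> {..l}.
     of_nat ((i choose fst p) * (l choose snd p)) * f (fst p) (snd p) * g (i - fst p) (l - snd p))"

lemma stat_monomial_add: "stat_monomial i l (x + y) = (\<Sum>p\<in>{..i} \<times> {..l}.
    real ((i choose fst p) * (l choose snd p)) * stat_monomial (fst p) (snd p) x * stat_monomial (i - fst p) (l - snd p) y)"
proof -
  have "stat_monomial i l (x + y) = (real (snd x) + real (snd y)) ^ i * (real (fst x) + real (fst y)) ^ l"
    by (simp add: stat_monomial_def)
  also have "\<dots> = (\<Sum>a\<le>i. \<Sum>b\<le>l. real ((i choose a) * (l choose b)) * stat_monomial a b x * stat_monomial (i - a) (l - b) y)"
    unfolding binomial_ring sum_product by (simp add: stat_monomial_def mult_ac)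
  finally show ?thesis by (simp add: sum.cartesian_product case_prod_beta)
qed

lemma moment_mult: "moment (F * G) i l = binomial_conv (moment F) (moment G) i l"
proof (rule fps_ext)
  fix n
  let ?c = "\<lambda>p. real ((i choose fst p) * (l choose snd p))"
  have prod: "pairing (stat_monomial i l) (f * g) = (\<Sum>p\<in>{..i} \<times> {..l}.
      ?c p * pairing (stat_monomial (fst p) (snd p)) f * pairing (stat_monomial (i - fst p) (l - snd p)) g)" for f g
  proof -
    have "pairing (\<lambda>y. stat_monomial i l (x + y)) g
        = (\<Sum>p\<in>{..i} \<times> {..l}. (?c p * pairing (stat_monomial (i - fst p) (l - snd p)) g) * stat_monomial (fst p) (snd p) x)" for x
      unfolding stat_monomial_add pairing_linear by (simp add: mult_ac)
    then show ?thesis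
      unfolding pairing_mult by (simp only: pairing_linear) (simp add: mult_ac)
  qed
  have "moment (F * G) i l $ n = (\<Sum>j=0..n. \<Sum>p\<in>{..i} \<times> {..l}.
      ?c p * pairing (stat_monomial (fst p) (snd p)) (F $ j) * pairing (stat_monomial (i - fst p) (l - snd p)) (G $ (n - j)))"
    by (simp add: moment_def fps_mult_nth pairing_sum prod)
  also have "\<dots> = (\<Sum>p\<in>{..i} \<times> {..l}. \<Sum>j=0..n.
      ?c p * pairing (stat_monomial (fst p) (snd p)) (F $ j) * pairing (stat_monomial (i - fst p) (l - snd p)) (G $ (n - j)))"
    by (rule sum.swap)
  also have "\<dots> = binomial_conv (moment F) (moment G) i l $ n"
    by (simp add: binomial_conv_def moment_def fps_sum_nth mult.assoc fps_mult_nth[of "Abs_fps _"] sum_distrib_left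
             flip: fps_of_nat fps_const_mult del: of_nat_mult)
  finally show "moment (F * G) i l $ n = binomial_conv (moment F) (moment G) i l $ n" .
qed

lemma moment_add: "moment (F + G) i l = moment F i l + moment G i l"
  by (rule fps_ext) (simp add: moment_def pairing_add)

lemma moment_diff: "moment (F - G) i l = moment F i l - moment G i l"
  by (rule fps_ext) (simp add: moment_def pairing_diff)

lemma moment_one: "moment 1 i l = of_bool (i = 0 \<and> l = 0)"
  by (rule fps_ext) (auto simp: moment_def stat_monomial_def zero_prod_def)

lemma moment_X: "moment fps_X i l = of_bool (i = 0 \<and> l = 0) * fps_X"
  by (rule fps_ext) (auto simp: moment_def stat_monomial_def zero_prod_def fps_X_def)

text \<open>The passage from the level \<open>v\<close> to \<open>v + 1\<close>: raising the \<open>n\<close> heights of an object by one turns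
  \<open>k\<close> into \<open>k + n\<close> and \<open>S\<close> into \<open>S + 2k + n\<close>.\<close>

definition shift_stat :: "nat \<Rightarrow> stat_ring \<Rightarrow> stat_ring \<Rightarrow> bool" where
  "shift_stat n f g \<longleftrightarrow> (\<forall>\<phi>. pairing \<phi> g = pairing (\<lambda>x. \<phi> (fst x + n, snd x + 2 * fst x + n)) f)"

lemma shift_stat_mult:
  assumes "shift_stat m f f'" "shift_stat n g g'"
  shows "shift_stat (m + n) (f * g) (f' * g')"
  using assms unfolding shift_stat_def pairing_mult
  by (simp add: algebra_simps)

lemma shift_stat_sum:
  "(\<And>i. i \<in> A \<Longrightarrow> shift_stat n (f i) (g i)) \<Longrightarrow> shift_stat n (\<Sum>i\<in>A. f i) (\<Sum>i\<in>A. g i)"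
  by (simp add: shift_stat_def pairing_sum)

lemma shift_stat_add:
  "shift_stat n f f' \<Longrightarrow> shift_stat n g g' \<Longrightarrow> shift_stat n (f + g) (f' + g')"
  by (simp add: shift_stat_def pairing_add)

lemma shift_stat_one: "shift_stat 0 1 1"
  by (simp add: shift_stat_def zero_prod_def)

definition stat_weight :: "nat \<Rightarrow> stat_ring" where
  "stat_weight h = Poly_Mapping.single (h, h\<^sup>2) 1"

lemma stat_weight_0 [simp]: "stat_weight 0 = 1"
  using single_one[where 'a = "nat \<times> nat" and 'b = real] by (simp add: stat_weight_def zero_prod_def)

lemma shift_stat_weight: "shift_stat 1 (stat_weight h) (stat_weight (Suc h))"
  by (simp add: shift_stat_def stat_weight_def power2_eq_square algebra_simps mult_2_right)

lemma shift_climb_coeff: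
  "shift_stat n (climb_coeff stat_weight v n) (climb_coeff stat_weight (Suc v) n)"
proof (induction n arbitrary: v rule: less_induct)
  case (less n)
  show ?case
  proof (cases n)
    case 0
    then show ?thesis by (simp add: climb_coeff.simps shift_stat_one)
  next
    case (Suc m)
    have "shift_stat m (\<Sum>i\<le>m. climb_coeff stat_weight (Suc v) i * climb_coeff stat_weight v (m - i))
       (\<Sum>i\<le>m. climb_coeff stat_weight (Suc (Suc v)) i * climb_coeff stat_weight (Suc v) (m - i))"
    proof (rule shift_stat_sum)
      fix i assume "i \<in> {..m}"
      then have "shift_stat (i + (m - i)) (climb_coeff stat_weight (Suc v) i * climb_coeff stat_weight v (m - i))
         (climb_coeff stat_weight (Suc (Suc v)) i * climb_coeff stat_weight (Suc v) (m - i))"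
        by (intro shift_stat_mult less) (auto simp: Suc)
      then show "shift_stat m (climb_coeff stat_weight (Suc v) i * climb_coeff stat_weight v (m - i))
         (climb_coeff stat_weight (Suc (Suc v)) i * climb_coeff stat_weight (Suc v) (m - i))"
        using \<open>i \<in> {..m}\<close> by simp
    qed
    from shift_stat_mult[OF shift_stat_weight[of "Suc v"] this] show ?thesis
      by (simp add: Suc climb_coeff.simps)
  qed
qed

definition shifted :: "stat_ring fps \<Rightarrow> stat_ring fps \<Rightarrow> bool" where
  "shifted F G \<longleftrightarrow> (\<forall>n. shift_stat n (F $ n) (G $ n))"

lemma shifted_climb: "shifted (climb stat_weight v) (climb stat_weight (Suc v))"
  by (simp add: shifted_def climb_def shift_climb_coeff)

lemma shifted_mult: "shifted F F' \<Longrightarrow> shifted G G' \<Longrightarrow> shifted (F * G) (F' * G')"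
  unfolding shifted_def fps_mult_nth
  by (intro allI shift_stat_sum) (metis shift_stat_mult le_add_diff_inverse atLeastAtMost_iff)

lemma shifted_weighted_X: "shifted (weighted_X stat_weight v) (weighted_X stat_weight (Suc v))"
  unfolding shifted_def
proof
  fix n
  consider "n = 1" | "weighted_X stat_weight v $ n = 0" "weighted_X stat_weight (Suc v) $ n = 0"
  proof (cases "n = 1")
    case False
    then show ?thesis using that(2) by (cases n) (auto simp: weighted_X_def mult.assoc)
  qed
  then show "shift_stat n (weighted_X stat_weight v $ n) (weighted_X stat_weight (Suc v) $ n)"
  proof cases
    case 1
    then show ?thesis using shift_stat_weight[of v] by (simp add: weighted_X_def)
  next
    case 2
    show ?thesis unfolding 2 by (simp add: shift_stat_def)
  qed
qed

lemma shifted_bridge: "shifted (bridge stat_weight v) (bridge stat_weight (Suc v))"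
proof -
  have "shift_stat n (bridge_coeff stat_weight v n) (bridge_coeff stat_weight (Suc v) n)" for n
  proof (induction n arbitrary: v rule: less_induct)
    case (less n)
    show ?case
    proof (cases n)
      case 0
      then show ?thesis by (simp add: bridge_coeff.simps shift_stat_one)
    next
      case (Suc m)
      let ?w = stat_weight
      let ?c = "climb stat_weight"
      have cc: "shifted (?c (Suc v) * ?c v) (?c (Suc (Suc v)) * ?c (Suc v))" for v
        by (intro shifted_mult shifted_climb)
      have "shift_stat m (\<Sum>i\<le>m. (?c (Suc v) * ?c v) $ (m - i) * bridge_coeff ?w (Suc v) i)
        (\<Sum>i\<le>m. (?c (Suc (Suc v)) * ?c (Suc v)) $ (m - i) * bridge_coeff ?w (Suc (Suc v)) i)"
      proof (rule shift_stat_sum)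
        fix i assume "i \<in> {..m}"
        then have "shift_stat ((m - i) + i) ((?c (Suc v) * ?c v) $ (m - i) * bridge_coeff ?w (Suc v) i)
          ((?c (Suc (Suc v)) * ?c (Suc v)) $ (m - i) * bridge_coeff ?w (Suc (Suc v)) i)"
          using cc by (intro shift_stat_mult less) (auto simp: Suc shifted_def)
        then show "shift_stat m ((?c (Suc v) * ?c v) $ (m - i) * bridge_coeff ?w (Suc v) i)
          ((?c (Suc (Suc v)) * ?c (Suc v)) $ (m - i) * bridge_coeff ?w (Suc (Suc v)) i)"
          using \<open>i \<in> {..m}\<close> by simp
      qed
      from shift_stat_mult[OF shift_stat_weight[of "Suc v"] this]
      show ?thesis
        using shifted_climb[of "Suc v"] unfolding Suc bridge_coeff.simps shifted_def
        by (intro shift_stat_add) auto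
    qed
  qed
  then show ?thesis by (simp add: shifted_def bridge_def)
qed

lemma shifted_one: "shifted 1 1"
  unfolding shifted_def by (auto simp: shift_stat_def zero_prod_def)

lemma shifted_diff: "shifted F F' \<Longrightarrow> shifted G G' \<Longrightarrow> shifted (F - G) (F' - G')"
  by (simp add: shifted_def shift_stat_def pairing_diff)

lemma shifted_add: "shifted F F' \<Longrightarrow> shifted G G' \<Longrightarrow> shifted (F + G) (F' + G')"
  by (simp add: shifted_def shift_stat_def pairing_add)

text \<open>Expand \<open>(S + 2k + n) ^ i (k + n) ^ l\<close>; multiplication of the \<open>n\<close>-th coefficient by \<open>n\<close> is
  \<open>x d/dx\<close>.\<close>

lemma moment_shifted:
  assumes "shifted F G"
  shows "moment G i l = (\<Sum>q\<in>(SIGMA b:{..i}. {..b}) \<times> {..l}. case q of ((b, c), d) \<Rightarrow>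
      fps_const (real ((i choose b) * (b choose c) * (l choose d)) * 2 ^ (b - c)) *
      (fps_XD ^^ (c + d)) (moment F (i - b) (l - d + (b - c))))"
proof (rule fps_ext)
  fix n
  let ?A = "(SIGMA b:{..i}. {..b}) \<times> {..l}"
  let ?k = "\<lambda>b c d. real ((i choose b) * (b choose c) * (l choose d)) * 2 ^ (b - c)"
  have expand: "stat_monomial i l (k + n, s + 2 * k + n) = (\<Sum>q\<in>?A. case q of ((b, c), d) \<Rightarrow>
      (?k b c d * real n ^ (c + d)) * stat_monomial (i - b) (l - d + (b - c)) (k, s))" for k s
  proof -
    have "stat_monomial i l (k + n, s + 2 * k + n)
        = ((real n + 2 * real k) + real s) ^ i * (real n + real k) ^ l"
      by (simp add: stat_monomial_def add_ac)
    also have "\<dots> = (\<Sum>b\<le>i. \<Sum>c\<le>b. \<Sum>d\<le>l.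
        (?k b c d * real n ^ (c + d)) * stat_monomial (i - b) (l - d + (b - c)) (k, s))"
    proof -
      have "((real n + 2 * real k) + real s) ^ i = (\<Sum>b\<le>i. \<Sum>c\<le>b.
          real (i choose b) * (real (b choose c) * real n ^ c * (2 * real k) ^ (b - c)) * real s ^ (i - b))"
        unfolding binomial_ring[of "real n + 2 * real k"] binomial_ring[of "real n"]
        by (simp add: sum_distrib_left sum_distrib_right)
      moreover have "(real n + real k) ^ l = (\<Sum>d\<le>l. real (l choose d) * real n ^ d * real k ^ (l - d))"
        by (rule binomial_ring)
      ultimately have "((real n + 2 * real k) + real s) ^ i * (real n + real k) ^ l
          = (\<Sum>b\<le>i. \<Sum>c\<le>b. \<Sum>d\<le>l.
          real (i choose b) * (real (b choose c) * real n ^ c * (2 * real k) ^ (b - c)) * real s ^ (i - b)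
          * (real (l choose d) * real n ^ d * real k ^ (l - d)))"
        by (simp only: sum_distrib_right) (simp only: sum_distrib_left)
      then show ?thesis
        by (simp only: stat_monomial_def power_add power_mult_distrib fst_conv snd_conv of_nat_mult mult_ac)
    qed
    also have "\<dots> = (\<Sum>p\<in>(SIGMA b:{..i}. {..b}). \<Sum>d\<le>l.
        (?k (fst p) (snd p) d * real n ^ (snd p + d)) * stat_monomial (i - fst p) (l - d + (fst p - snd p)) (k, s))"
      by (subst sum.Sigma) (auto simp: case_prod_beta)
    also have "\<dots> = (\<Sum>q\<in>?A. case q of ((b, c), d) \<Rightarrow>
      (?k b c d * real n ^ (c + d)) * stat_monomial (i - b) (l - d + (b - c)) (k, s))"
      by (simp only: sum.cartesian_product case_prod_unfold)
    finally show ?thesis .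
  qed
  have "moment G i l $ n = pairing (\<lambda>x. stat_monomial i l (fst x + n, snd x + 2 * fst x + n)) (F $ n)"
    using assms by (simp add: moment_def shifted_def shift_stat_def)
  also have "\<dots> = (\<Sum>q\<in>?A. case q of ((b, c), d) \<Rightarrow>
      (?k b c d * real n ^ (c + d)) * pairing (stat_monomial (i - b) (l - d + (b - c))) (F $ n))"
    unfolding expand case_prod_beta prod.collapse by (rule pairing_linear)
  also have "\<dots> = (\<Sum>q\<in>?A. case q of ((b, c), d) \<Rightarrow>
      fps_const (?k b c d) * (fps_XD ^^ (c + d)) (moment F (i - b) (l - d + (b - c)))) $ n"
    by (simp add: fps_sum_nth case_prod_beta fps_mult_fps_XD_shift moment_def mult_ac)
  finally show "moment G i l $ n = (\<Sum>q\<in>?A. case q of ((b, c), d) \<Rightarrow>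
      fps_const (?k b c d) * (fps_XD ^^ (c + d)) (moment F (i - b) (l - d + (b - c)))) $ n" .
qed

section \<open>Leading coefficients of the moments\<close>

text \<open>The leading part of the change of the moments when all heights are raised by one: \<open>S ^ i k ^ l\<close>
  gains \<open>2 i S ^ (i-1) k ^ (l+1)\<close> and \<open>l n S ^ i k ^ (l-1)\<close>, and by \<open>leading_theta\<close> the factor \<open>n\<close>
  multiplies the leading coefficient by half the order of the pole.\<close>

definition drift :: "int \<Rightarrow> (nat \<Rightarrow> nat \<Rightarrow> real) \<Rightarrow> nat \<Rightarrow> nat \<Rightarrow> real" where
  "drift d f i l = 2 * real i * f (i - 1) (l + 1)
     + real l * (of_int (4 * int i + 3 * (int l - 1) + d) / 2) * f i (l - 1)"

text \<open>The orders follow the Brownian scaling: \<open>n\<close>, \<open>k\<close> and \<open>S\<close> are of size \<open>eps ^ (-2)\<close>, \<open>eps ^ (-3)\<close>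
  and \<open>eps ^ (-4)\<close>.\<close>

definition moment_leading :: "int \<Rightarrow> real \<Rightarrow> stat_ring fps \<Rightarrow> nat \<Rightarrow> nat \<Rightarrow> bool" where
  "moment_leading d c F i l \<longleftrightarrow> leading (4 * int i + 3 * int l + d) c (moment F i l)"

lemma leading_of_eq: "leading m c F \<Longrightarrow> m = m' \<Longrightarrow> c = c' \<Longrightarrow> leading m' c' F"
  by simp

text \<open>Every factor of the expansion in \<open>moment_shifted\<close> that is taken from \<open>2k\<close> or \<open>n\<close> instead of \<open>S\<close>
  or \<open>k\<close> lowers the order by at least one; exactly the two terms of \<open>drift\<close> lose only one
  order.\<close>

lemma leading_shift_difference:
  assumes sh: "shifted F G"
    and lead: "\<And>i' l'. 2 * i' + l' < 2 * i + l \<Longrightarrow> moment_leading d (f i' l') F i' l'"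
  shows "leading (4 * int i + 3 * int l + d - 1) (drift d f i l) (moment G i l - moment F i l)"
proof -
  define A where "A = (SIGMA b:{..i}. {..b}) \<times> {..l}"
  define h where "h q = (case q of ((b, c), d') \<Rightarrow>
      if b = 1 \<and> c = 0 \<and> d' = 0 then 2 * real i * f (i - 1) (l + 1)
      else if b = 0 \<and> c = 0 \<and> d' = 1 then real l * (of_int (4 * int i + 3 * (int l - 1) + d) / 2 * f i (l - 1))
      else 0)" for q :: "(nat \<times> nat) \<times> nat"
  define H where "H q = (case q of ((b, c), d') \<Rightarrow>
      fps_const (real ((i choose b) * (b choose c) * (l choose d')) * 2 ^ (b - c)) *
      (fps_XD ^^ (c + d')) (moment F (i - b) (l - d' + (b - c))))" for q :: "(nat \<times> nat) \<times> nat"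
  have finA [simp]: "finite A" by (simp add: A_def)
  have inA: "((0, 0), 0) \<in> A" by (auto simp: A_def)
  have "moment G i l = (\<Sum>q\<in>A. H q)"
    unfolding A_def H_def by (rule moment_shifted[OF sh])
  also have "\<dots> = H ((0, 0), 0) + (\<Sum>q\<in>A - {((0, 0), 0)}. H q)"
    by (rule sum.remove[OF finA inA])
  also have "H ((0, 0), 0) = moment F i l" by (simp add: H_def)
  finally have diff: "moment G i l - moment F i l = (\<Sum>q\<in>A - {((0, 0), 0)}. H q)" by simp
  have "leading (4 * int i + 3 * int l + d - 1) (\<Sum>q\<in>A - {((0, 0), 0)}. h q) (\<Sum>q\<in>A - {((0, 0), 0)}. H q)"
  proof (rule leading_sum)
    fix q assume q: "q \<in> A - {((0, 0), 0)}"
    obtain b c d' where q_eq: "q = ((b, c), d')" by (metis prod.exhaust)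
    have le: "b \<le> i" "c \<le> b" "d' \<le> l" and nz: "b > 0 \<or> d' > 0"
      using q by (auto simp: A_def q_eq)
    let ?i = "i - b" and ?l = "l - d' + (b - c)"
    let ?k = "real ((i choose b) * (b choose c) * (l choose d')) * 2 ^ (b - c)"
    have "2 * ?i + ?l < 2 * i + l" using le nz by auto
    then have base: "leading (4 * int ?i + 3 * int ?l + d) (f ?i ?l) (moment F ?i ?l)"
      by (rule lead[unfolded moment_leading_def])
    have ord: "4 * int ?i + 3 * int ?l + d = 4 * int i + 3 * int l + d - int b - 3 * int c - 3 * int d'"
      using le by (simp add: of_nat_diff)
    show "leading (4 * int i + 3 * int l + d - 1) (h q) (H q)"
    proof (cases "(b = 1 \<and> c = 0 \<and> d' = 0) \<or> (b = 0 \<and> c = 0 \<and> d' = 1)")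
      case True
      then show ?thesis
      proof (elim disjE conjE)
        assume *: "b = 1" "c = 0" "d' = 0"
        show ?thesis
        proof -
          have "leading (4 * int i + 3 * int l + d - 1) (?k * f ?i ?l) (fps_const ?k * moment F ?i ?l)"
          proof (rule leading_of_eq[OF leading_const_mult[OF base, of ?k]])
            show "4 * int ?i + 3 * int ?l + d = 4 * int i + 3 * int l + d - 1"
              unfolding ord unfolding * by simp
          qed simp
          then show ?thesis
            unfolding q_eq h_def H_def * by (simp add: mult.commute)
        qed
      next
        assume *: "b = 0" "c = 0" "d' = 1"
        have "leading (4 * int ?i + 3 * int ?l + d + 2) (?k * (of_int (4 * int ?i + 3 * int ?l + d) / 2 * f ?i ?l)) (H q)"
          using leading_const_mult[OF leading_theta[OF base], of ?k] * by (simp add: q_eq H_def)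
        then show ?thesis
        proof (rule leading_of_eq)
          show "4 * int ?i + 3 * int ?l + d + 2 = 4 * int i + 3 * int l + d - 1"
            unfolding ord unfolding * by simp
          show "?k * (of_int (4 * int ?i + 3 * int ?l + d) / 2 * f ?i ?l) = h q"
            unfolding ord unfolding q_eq h_def * by (simp add: algebra_simps)
        qed
      qed
    next
      case False
      obtain c' where "leading (4 * int ?i + 3 * int ?l + d + 2 * int (c + d')) c'
          ((fps_XD ^^ (c + d')) (moment F ?i ?l))"
        using leading_theta_power[OF base, of "c + d'"] by (elim exE)
      from leading_const_mult[OF this, of ?k]
      have "leading (4 * int ?i + 3 * int ?l + d + 2 * int (c + d')) (?k * c') (H q)"
        by (simp add: q_eq H_def)
      then have "leading (4 * int i + 3 * int l + d - 1) 0 (H q)"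
      proof (rule leading_weaken)
        have "b + c + d' \<ge> 2" using False nz le(2) by presburger
        then have "int b + int c + int d' \<ge> 2" by linarith
        then show "4 * int ?i + 3 * int ?l + d + 2 * int (c + d') < 4 * int i + 3 * int l + d - 1"
          unfolding ord by simp
      qed
      moreover from False have "\<not> (b = 1 \<and> c = 0 \<and> d' = 0)" "\<not> (b = 0 \<and> c = 0 \<and> d' = 1)"
        by blast+
      then have "h q = 0" unfolding q_eq h_def prod.case by (simp only: if_False)
      ultimately show ?thesis by simp
    qed
  qed
  also have "(\<Sum>q\<in>A - {((0, 0), 0)}. h q) = drift d f i l"
  proof -
    have "(\<Sum>q\<in>A - {((0, 0), 0)}. h q)
        = (\<Sum>q\<in>{((1, 0), 0), ((0, 0), 1)}. h q)"
    proof (rule sum.mono_neutral_cong)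
      fix q assume "q \<in> {((1, 0), 0), ((0, 0), 1)} - (A - {((0, 0), 0)})"
      then have "q = ((1, 0), 0) \<or> q = ((0, 0), 1)" "q \<notin> A" by auto
      then show "h q = 0"
      proof (elim disjE)
        assume *: "q = ((1, 0), 0)" and "q \<notin> A"
        then have "i = 0" by (simp add: A_def)
        then show ?thesis by (simp add: * h_def)
      next
        assume *: "q = ((0, 0), 1)" and "q \<notin> A"
        then have "l = 0" by (simp add: A_def)
        then show ?thesis by (simp add: * h_def)
      qed
    next
      fix q assume "q \<in> A - {((0, 0), 0)} - {((1, 0), 0), ((0, 0), 1)}"
      moreover obtain b c d' where q: "q = ((b, c), d')" by (metis prod.exhaust)
      ultimately have "\<not> (b = 1 \<and> c = 0 \<and> d' = 0)" "\<not> (b = 0 \<and> c = 0 \<and> d' = 1)"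
        by auto
      then show "h q = 0" unfolding q h_def prod.case by (simp only: if_False)
    qed simp_all
    then show ?thesis by (simp add: h_def drift_def)
  qed
  finally show ?thesis by (simp add: diff)
qed

text \<open>Leading coefficients of the moments. Up to lower orders, raising all heights by one differs from
  the identity by \<open>drift\<close>, and the equations for the generating functions become a discrete Riccati
  equation \<open>psi ^ 2 = 1 - 4x + drift psi\<close> and the linear equations \<open>psi bridge = 1 + drift bridge / 2\<close>
  and \<open>psi loops = bridge\<close>. In each, the coefficients are determined in the order of
  increasing \<open>2i + l\<close>.\<close>

function lead_psi :: "nat \<Rightarrow> nat \<Rightarrow> real" where
  "lead_psi i l = (if i = 0 \<and> l = 0 then 1 else
     ((if i = 0 then 0 else 2 * real i * lead_psi (i - 1) (l + 1))
     + (if l = 0 then 0 else real l * (of_int (4 * int i + 3 * (int l - 1) - 1) / 2) * lead_psi i (l - 1))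
     - (\<Sum>p\<in>{..i} \<times> {..l} - {(0, 0), (i, l)}. real ((i choose fst p) * (l choose snd p)) *
          lead_psi (fst p) (snd p) * lead_psi (i - fst p) (l - snd p))) / 2)"
  by auto
termination
  by (relation "Wellfounded.measure (\<lambda>(i, l). 2 * i + l)") auto

function lead_bridge :: "nat \<Rightarrow> nat \<Rightarrow> real" where
  "lead_bridge i l = (if i = 0 \<and> l = 0 then 1 else
     ((if i = 0 then 0 else 2 * real i * lead_bridge (i - 1) (l + 1))
     + (if l = 0 then 0 else real l * (of_int (4 * int i + 3 * (int l - 1) + 1) / 2) * lead_bridge i (l - 1))) / 2
     - (\<Sum>p\<in>{..i} \<times> {..l} - {(i, l)}. real ((i choose fst p) * (l choose snd p)) *
          lead_bridge (fst p) (snd p) * lead_psi (i - fst p) (l - snd p)))"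
  by auto
termination
  by (relation "Wellfounded.measure (\<lambda>(i, l). 2 * i + l)") auto

function lead_loops :: "nat \<Rightarrow> nat \<Rightarrow> real" where
  "lead_loops i l = lead_bridge i l
     - (\<Sum>p\<in>{..i} \<times> {..l} - {(i, l)}. real ((i choose fst p) * (l choose snd p)) *
          lead_loops (fst p) (snd p) * lead_psi (i - fst p) (l - snd p))"
  by auto
termination
  by (relation "Wellfounded.measure (\<lambda>(i, l). 2 * i + l)") auto

declare lead_psi.simps [simp del] lead_bridge.simps [simp del] lead_loops.simps [simp del]

text \<open>The products \<open>U\<^sub>v = w v x C\<^sub>v\<close>; the next lemmas state all equations in terms of them.\<close>

definition excursion :: "nat \<Rightarrow> stat_ring fps" where
  "excursion v = weighted_X stat_weight v * climb stat_weight v"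

lemma excursion_eq: "excursion v * (1 - excursion (Suc v)) = weighted_X stat_weight v"
proof -
  have "climb stat_weight v * (1 - excursion (Suc v)) = 1"
    unfolding excursion_def using climb_eq[of stat_weight v] by (simp add: algebra_simps)
  then show ?thesis by (simp add: excursion_def mult.assoc)
qed

lemma shifted_excursion: "shifted (excursion v) (excursion (Suc v))"
  unfolding excursion_def by (intro shifted_mult shifted_weighted_X shifted_climb)

lemma excursion_0: "excursion 0 = fps_X * climb stat_weight 0"
  by (simp add: excursion_def weighted_X_def)

definition loops_fps :: "stat_ring fps" where
  "loops_fps = Abs_fps (\<lambda>n. \<Sum>l\<in>loops n. \<Prod>x\<leftarrow>l. state_weight stat_weight x)"

lemma loops_fps_eq: "loops_fps * (1 - excursion 0 - excursion 1) = bridge stat_weight 0"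
  unfolding loops_fps_def excursion_0 using loops_gf[of stat_weight] by (simp add: excursion_def)

lemma bridge_excursion_eq:
  "bridge stat_weight 0 * (1 - excursion 2) = 1 + fps_const (stat_weight 1) * excursion 0 * bridge stat_weight 1"
proof -
  have "climb stat_weight 1 * (1 - excursion 2) = 1"
    unfolding excursion_def using climb_eq[of stat_weight 1] by (simp add: algebra_simps numeral_2_eq_2)
  moreover have "bridge stat_weight 0
      = climb stat_weight 1 * (1 + fps_const (stat_weight 1) * excursion 0 * bridge stat_weight 1)"
    by (subst bridge_eq) (simp add: excursion_0 weighted_X_def algebra_simps)
  ultimately have "bridge stat_weight 0 * (1 - excursion 2) = climb stat_weight 1 *
      (1 + fps_const (stat_weight 1) * excursion 0 * bridge stat_weight 1) * (1 - excursion 2)"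
    by simp
  also have "\<dots> = (climb stat_weight 1 * (1 - excursion 2)) * (1 + fps_const (stat_weight 1) * excursion 0 * bridge stat_weight 1)"
    by (simp only: mult_ac)
  finally show ?thesis by (simp only: \<open>climb stat_weight 1 * (1 - excursion 2) = 1\<close> mult_1_left)
qed

text \<open>Normalised such that the moment with index \<open>(0, 0)\<close> is \<open>eps\<close>.\<close>

definition psi :: "nat \<Rightarrow> stat_ring fps" where "psi v = 1 - 2 * excursion v"

lemma shifted_psi: "shifted (psi v) (psi (Suc v))"
  unfolding psi_def using shifted_excursion[of v]
  by (simp only: mult_2) (intro shifted_diff shifted_add shifted_one)

lemma moment_00_shifted: "shifted F G \<Longrightarrow> moment G 0 0 = moment F 0 0"
proof -
  assume "shifted F G"
  from moment_shifted[OF this, of 0 0] show ?thesis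
    by (simp add: Sigma_def)
qed

lemma moment_mult_00: "moment (F * G) 0 0 = moment F 0 0 * moment G 0 0"
  by (simp add: moment_mult binomial_conv_def)

lemma psi_eq: "(1 - psi 0) * (1 + psi 1) = 4 * fps_X"
proof -
  have "(1 - psi 0) * (1 + psi 1) = 4 * (excursion 0 * (1 - excursion 1))"
    by (simp add: psi_def algebra_simps)
  then show ?thesis using excursion_eq[of 0] by (simp add: weighted_X_def)
qed

lemma moment_4X: "moment (4 * fps_X) i l = of_bool (i = 0 \<and> l = 0) * fourX"
proof -
  have "4 * fps_X = fps_X + fps_X + fps_X + (fps_X :: stat_ring fps)" by simp
  then have "moment (4 * fps_X) i l = of_bool (i = 0 \<and> l = 0) * (fps_X + fps_X + fps_X + fps_X)"
    by (simp only: moment_add moment_X) (simp add: algebra_simps)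
  moreover have "fps_X + fps_X + fps_X + fps_X = fourX"
    by (simp add: fourX_def flip: numeral_fps_const)
  ultimately show ?thesis by simp
qed

text \<open>Raising heights does not affect the number of objects, so the equation for \<open>psi\<close> becomes
  quadratic; the constant term selects the root.\<close>

lemma moment_psi_00: "moment (psi 0) 0 0 = eps"
proof -
  let ?p = "moment (psi 0) 0 0"
  have p1: "moment (psi 1) 0 0 = ?p"
    using moment_00_shifted[OF shifted_psi[of 0]] by simp
  have "moment ((1 - psi 0) * (1 + psi 1)) 0 0 = fourX"
    unfolding psi_eq by (simp add: moment_4X)
  then have "(1 - ?p) * (1 + ?p) = fourX"
    by (simp add: moment_mult_00 moment_diff moment_add moment_one p1[simplified])
  then have "?p * ?p = eps * eps"
    by (simp add: fourX_eps algebra_simps)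
  then have "(?p - eps) * (?p + eps) = 0" by (simp add: algebra_simps)
  moreover have "?p + eps \<noteq> 0"
  proof -
    have "psi 0 $ 0 = 1" by (simp add: psi_def excursion_0)
    then have "(?p + eps) $ 0 = 2" by (simp add: moment_def stat_monomial_def)
    then show ?thesis by force
  qed
  ultimately show ?thesis by simp
qed

lemma moment_leading_shifted:
  assumes "shifted F G"
    and "\<And>i' l'. 2 * i' + l' \<le> 2 * i + l \<Longrightarrow> moment_leading d (f i' l') F i' l'"
  shows "moment_leading d (f i l) G i l"
proof -
  have "leading (4 * int i + 3 * int l + d - 1) (drift d f i l) (moment G i l - moment F i l)"
    using assms by (intro leading_shift_difference) auto
  then have "leading (4 * int i + 3 * int l + d) 0 (moment G i l - moment F i l)"
    by (rule leading_weaken) simp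
  from leading_add[OF assms(2)[of i l, unfolded moment_leading_def] this]
  show ?thesis by (simp add: moment_leading_def)
qed

lemma leading_binomial_conv:
  assumes "\<And>a b. (a, b) \<in> P \<Longrightarrow> a \<le> i \<and> b \<le> l"
    and "\<And>a b. (a, b) \<in> P \<Longrightarrow> moment_leading d (f a b) F a b"
    and "\<And>a b. (a, b) \<in> P \<Longrightarrow> moment_leading e (g (i - a) (l - b)) G (i - a) (l - b)"
  shows "leading (4 * int i + 3 * int l + d + e)
    (\<Sum>p\<in>P. real ((i choose fst p) * (l choose snd p)) * f (fst p) (snd p) * g (i - fst p) (l - snd p))
    (\<Sum>p\<in>P. of_nat ((i choose fst p) * (l choose snd p)) * moment F (fst p) (snd p) * moment G (i - fst p) (l - snd p))"
proof (rule leading_sum)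
  fix p assume p: "p \<in> P"
  obtain a b where ab: "p = (a, b)" by force
  let ?c = "(i choose a) * (l choose b)"
  have F: "leading (4 * int a + 3 * int b + d) (f a b) (moment F a b)"
    and G: "leading (4 * int (i - a) + 3 * int (l - b) + e) (g (i - a) (l - b)) (moment G (i - a) (l - b))"
    using assms(2,3)[of a b] p ab unfolding moment_leading_def by blast+
  have le: "a \<le> i" "b \<le> l" using assms(1)[of a b] p ab by auto
  have ord: "4 * int a + 3 * int b + d + (4 * int (i - a) + 3 * int (l - b) + e)
      = 4 * int i + 3 * int l + d + e"
    using le by (simp add: of_nat_diff)
  from leading_mult[OF F G] have "leading (4 * int i + 3 * int l + d + e)
     (f a b * g (i - a) (l - b)) (moment F a b * moment G (i - a) (l - b))"
    unfolding ord .
  from leading_const_mult[OF this, of "real ?c"]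
  show "leading (4 * int i + 3 * int l + d + e)
    (real ((i choose fst p) * (l choose snd p)) * f (fst p) (snd p) * g (i - fst p) (l - snd p))
    (of_nat ((i choose fst p) * (l choose snd p)) * moment F (fst p) (snd p) * moment G (i - fst p) (l - snd p))"
    unfolding ab fst_conv snd_conv fps_of_nat[symmetric] by (simp only: mult.assoc)
qed

text \<open>What remains of a product of moments when the terms with the unknown moment, or with a factor
  known to vanish, are split off.\<close>

definition partial_conv :: "(nat \<times> nat) set \<Rightarrow> stat_ring fps \<Rightarrow> stat_ring fps \<Rightarrow> nat \<Rightarrow> nat \<Rightarrow> real fps" where
  "partial_conv Q F G i l = (\<Sum>p\<in>{..i} \<times> {..l} - Q.
     of_nat ((i choose fst p) * (l choose snd p)) * moment F (fst p) (snd p) * moment G (i - fst p) (l - snd p))"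

lemma moment_mult_split: "moment (F * G) i l = moment F i l * moment G 0 0 + partial_conv {(i, l)} F G i l"
  unfolding moment_mult binomial_conv_def partial_conv_def
  by (subst sum.remove[of _ "(i, l)"]) auto

lemma moment_mult_split2:
  "(i, l) \<noteq> (0, 0) \<Longrightarrow> moment (F * G) i l
     = moment F 0 0 * moment G i l + moment F i l * moment G 0 0 + partial_conv {(0, 0), (i, l)} F G i l"
  unfolding moment_mult_split partial_conv_def
  by (subst sum.remove[of _ "(0, 0)"]) (auto simp: insert_commute simp flip: Diff_insert2)

lemma leading_half: "leading m d (fps_const 2 * F) \<Longrightarrow> d = 2 * c \<Longrightarrow> leading m c F"
  using leading_const_mult[of m "2 * c" "fps_const 2 * F" "1/2"] by (simp flip: mult.assoc)

text \<open>Compare moments in \<open>(1 - psi 0) (1 + psi 1) = 4x\<close>. The two extreme terms of the product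
  \<open>psi 0 psi 1\<close> give \<open>2 eps\<close> times the moment in question, up to lower order.\<close>

lemma psi_leading: "moment_leading (- 1) (lead_psi i l) (psi 0) i l"
proof (induction "2 * i + l" arbitrary: i l rule: less_induct)
  case less
  show ?case
  proof (cases "(i, l) = (0, 0)")
    case True
    then show ?thesis by (simp add: moment_leading_def moment_psi_00 leading_eps lead_psi.simps)
  next
    case False
    let ?w = "4 * int i + 3 * int l"
    define D where "D = moment (psi 1) i l - moment (psi 0) i l"
    define R where "R = partial_conv {(0, 0), (i, l)} (psi 0) (psi 1) i l"
    define r where "r = (\<Sum>p\<in>{..i} \<times> {..l} - {(0, 0), (i, l)}. real ((i choose fst p) * (l choose snd p)) *
          lead_psi (fst p) (snd p) * lead_psi (i - fst p) (l - snd p))"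
    have psi1: "moment (psi 1) 0 0 = eps"
      using moment_00_shifted[OF shifted_psi[of 0]] moment_psi_00 by simp
    have "psi 0 * psi 1 = 1 + (psi 1 - psi 0) - 4 * fps_X"
      using psi_eq by (simp add: algebra_simps)
    then have "moment (psi 0 * psi 1) i l = D"
      using False by (auto simp: moment_add moment_diff moment_one moment_4X D_def)
    then have "eps * moment (psi 1) i l + moment (psi 0) i l * eps + R = D"
      using False by (simp only: moment_mult_split2 psi1 moment_psi_00 R_def not_False_eq_True)
    then have eq: "fps_const 2 * (eps * moment (psi 0) i l) = D - eps * D - R"
      by (simp add: D_def algebra_simps flip: numeral_fps_const)
    have D: "leading (?w - 1 - 1) (drift (- 1) lead_psi i l) D"
      unfolding D_def using leading_shift_difference[OF shifted_psi[of 0], where d = "-1" and f = lead_psi] less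
      by (simp add: add.commute)
    have eD: "leading (?w - 2) 0 (eps * D)"
      by (rule leading_weaken[OF leading_mult[OF leading_eps D]]) simp
    have R: "leading (?w + (- 1) + (- 1)) r R"
      unfolding r_def R_def partial_conv_def
    proof (rule leading_binomial_conv)
      fix a b assume ab: "(a, b) \<in> {..i} \<times> {..l} - {(0, 0), (i, l)}"
      then have less': "2 * a + b < 2 * i + l" "2 * (i - a) + (l - b) < 2 * i + l"
        by auto
      show "a \<le> i \<and> b \<le> l" using ab by auto
      show "moment_leading (- 1) (lead_psi a b) (psi 0) a b"
        using less less' by blast
      show "moment_leading (- 1) (lead_psi (i - a) (l - b)) (psi 1) (i - a) (l - b)"
        using moment_leading_shifted[OF shifted_psi[of 0], of "i - a" "l - b" "- 1" lead_psi] less less'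
        by simp
    qed
    have "leading (?w - 2) (drift (- 1) lead_psi i l - 0 - r) (fps_const 2 * (eps * moment (psi 0) i l))"
      unfolding eq using D R by (intro leading_diff eD) simp_all
    then have "leading (?w - 2) ((drift (- 1) lead_psi i l - r) / 2) (eps * moment (psi 0) i l)"
      by (rule leading_half) simp
    moreover have "(drift (- 1) lead_psi i l - r) / 2 = lead_psi i l"
      using False by (subst lead_psi.simps) (auto simp: drift_def r_def)
    ultimately show ?thesis
      using leading_divide_eps[of "?w - 2"] by (simp add: moment_leading_def)
  qed
qed

lemma psi_leading_all: "moment_leading (- 1) (lead_psi i l) (psi v) i l"
proof (induction v arbitrary: i l)
  case (Suc v)
  show ?case by (rule moment_leading_shifted[OF shifted_psi]) (rule Suc)
qed (rule psi_leading)

lemma moment_psi_00_all: "moment (psi v) 0 0 = eps"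
  by (induction v) (simp_all add: moment_psi_00 moment_00_shifted[OF shifted_psi])

lemma bridge_psi_eq:
  defines "E \<equiv> fps_const (stat_weight 1)"
  shows "bridge stat_weight 0 + bridge stat_weight 0 * psi 2
    = 1 + 1 + bridge stat_weight 1 - bridge stat_weight 1 * psi 0 + (E - 1) * ((1 - psi 0) * bridge stat_weight 1)"
proof -
  have "bridge stat_weight 0 + bridge stat_weight 0 * psi 2 = 2 * (bridge stat_weight 0 * (1 - excursion 2))"
    by (simp add: psi_def algebra_simps)
  also have "\<dots> = 2 + E * (2 * excursion 0) * bridge stat_weight 1"
    unfolding bridge_excursion_eq E_def by (simp add: algebra_simps)
  also have "2 * excursion 0 = 1 - psi 0" by (simp add: psi_def)
  finally show ?thesis by (simp add: algebra_simps)
qed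

lemma moment_fps_const_weight: "moment (fps_const (stat_weight 1) - 1) i l = of_bool (\<not> (i = 0 \<and> l = 0))"
  unfolding moment_diff moment_one
  by (rule fps_ext) (auto simp: moment_def stat_weight_def stat_monomial_def)

lemma moment_zero_00: "moment (fps_const (stat_weight 1) - 1) 0 0 = 0"
  by (simp add: moment_fps_const_weight del: One_nat_def)

text \<open>A factor \<open>w 1\<close> changes the statistics by a constant only, so replacing it by 1 is invisible in the
  leading order.\<close>

lemma weight_leading: "moment_leading (- 1) 0 (fps_const (stat_weight 1) - 1) i l"
proof (cases "i = 0 \<and> l = 0")
  case True
  then show ?thesis by (simp add: moment_leading_def moment_zero_00 leading_zero del: One_nat_def)
next
  case False
  then have "moment (fps_const (stat_weight 1) - 1) i l = fps_const 1"
    by (auto simp: moment_fps_const_weight simp del: One_nat_def)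
  then show ?thesis
    unfolding moment_leading_def using leading_weaken[OF leading_const[of 1], of "4 * int i + 3 * int l + - 1"] False
    by auto
qed

lemma one_minus_psi_leading: "moment_leading 0 (of_bool (i = 0 \<and> l = 0)) (1 - psi 0) i l"
proof -
  have "moment_leading 0 (of_bool (i = 0 \<and> l = 0)) 1 i l"
    unfolding moment_leading_def moment_one using leading_const[of 1] leading_zero by auto
  moreover have "moment_leading 0 0 (psi 0) i l"
    using leading_weaken[OF psi_leading[of i l, unfolded moment_leading_def]] by (simp add: moment_leading_def)
  ultimately show ?thesis
    unfolding moment_leading_def moment_diff using leading_diff by fastforce
qed

lemma bridge_leading: "moment_leading 1 (lead_bridge i l) (bridge stat_weight 0) i l"
proof (induction "2 * i + l" arbitrary: i l rule: less_induct)
  case less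
  let ?w = "4 * int i + 3 * int l"
  let ?b0 = "bridge stat_weight 0" and ?b1 = "bridge stat_weight 1"
  let ?E = "fps_const (stat_weight 1)"
  have sh: "shifted ?b0 ?b1" using shifted_bridge[of 0] by simp
  define D where "D = moment ?b1 i l - moment ?b0 i l"
  define R1 where "R1 = partial_conv {(i, l)} ?b0 (psi 2) i l"
  define R2 where "R2 = partial_conv {(i, l)} ?b1 (psi 0) i l"
  define Z where "Z = moment ((?E - 1) * ((1 - psi 0) * ?b1)) i l"
  define r where "r = (\<Sum>p\<in>{..i} \<times> {..l} - {(i, l)}. real ((i choose fst p) * (l choose snd p)) *
          lead_bridge (fst p) (snd p) * lead_psi (i - fst p) (l - snd p))"
  define c where "c = (of_bool (i = 0 \<and> l = 0) :: real)"
  have "moment (?b0 + ?b0 * psi 2) i l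
      = moment (1 + 1 + ?b1 - ?b1 * psi 0 + (?E - 1) * ((1 - psi 0) * ?b1)) i l"
    by (simp only: bridge_psi_eq)
  also have "\<dots> = (of_bool (i = 0 \<and> l = 0) + of_bool (i = 0 \<and> l = 0)) + moment ?b1 i l - moment (?b1 * psi 0) i l + Z"
    by (simp only: moment_add moment_diff[of _ "?b1 * psi 0"] moment_one Z_def)
  also have "of_bool (i = 0 \<and> l = 0) + of_bool (i = 0 \<and> l = 0) = fps_const (2 * c)"
    by (auto simp: c_def simp flip: numeral_fps_const)
  finally have "moment ?b0 i l + (moment ?b0 i l * eps + R1)
      = fps_const (2 * c) + moment ?b1 i l - (moment ?b1 i l * eps + R2) + Z"
    by (simp only: moment_add moment_mult_split moment_psi_00_all R1_def R2_def)
  then have eq: "fps_const 2 * (eps * moment ?b0 i l) = fps_const (2 * c) + D - eps * D - R1 - R2 + Z"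
    by (simp add: D_def algebra_simps flip: numeral_fps_const)
  have IH: "moment_leading 1 (lead_bridge a b) ?b0 a b" if "2 * a + b < 2 * i + l" for a b
    using less that by blast
  have IH1: "moment_leading 1 (lead_bridge a b) ?b1 a b" if "2 * a + b < 2 * i + l" for a b
    using that by (intro moment_leading_shifted[OF sh] IH) simp
  have smaller: "2 * a + b < 2 * i + l" "a \<le> i" "b \<le> l" if "(a, b) \<in> {..i} \<times> {..l} - {(i, l)}" for a b
    using that by auto
  have D: "leading ?w (drift 1 lead_bridge i l) D"
    unfolding D_def using leading_shift_difference[OF sh, where d = 1 and f = lead_bridge] IH
    by simp
  have eD: "leading ?w 0 (eps * D)"
    by (rule leading_weaken[OF leading_mult[OF leading_eps D]]) simp
  have R1: "leading (?w + 1 + (- 1)) r R1"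
    unfolding r_def R1_def partial_conv_def
    by (rule leading_binomial_conv) (auto dest!: smaller intro: IH psi_leading_all)
  have R2: "leading (?w + 1 + (- 1)) r R2"
    unfolding r_def R2_def partial_conv_def
    by (rule leading_binomial_conv) (auto dest!: smaller intro: IH1 psi_leading_all simp del: One_nat_def)
  have Z: "leading ?w 0 Z"
  proof -
    define g where "g i l = (\<Sum>p\<in>{..i} \<times> {..l}. real ((i choose fst p) * (l choose snd p)) *
        of_bool (fst p = 0 \<and> snd p = 0) * lead_bridge (i - fst p) (l - snd p))" for i l
    have prod: "moment_leading 1 (g a b) ((1 - psi 0) * ?b1) a b" if "2 * a + b < 2 * i + l" for a b
    proof -
      have "leading (4 * int a + 3 * int b + 0 + 1) (g a b) (moment ((1 - psi 0) * ?b1) a b)"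
        unfolding g_def moment_mult binomial_conv_def
      proof (rule leading_binomial_conv)
        fix a' b' assume "(a', b') \<in> {..a} \<times> {..b}"
        then show "a' \<le> a \<and> b' \<le> b" by simp
        have "2 * (a - a') + (b - b') < 2 * i + l" using that by linarith
        then show "moment_leading 1 (lead_bridge (a - a') (b - b')) ?b1 (a - a') (b - b')"
          by (rule IH1)
      qed (rule one_minus_psi_leading)
      then show ?thesis by (simp add: moment_leading_def)
    qed
    have "Z = partial_conv {(0, 0)} (?E - 1) ((1 - psi 0) * ?b1) i l"
      unfolding Z_def moment_mult[of "?E - 1"] binomial_conv_def partial_conv_def
      by (subst sum.remove[of _ "(0, 0)"]) (auto simp: moment_zero_00 simp del: One_nat_def)
    moreover have "leading (?w + (- 1) + 1)
       (\<Sum>p\<in>{..i} \<times> {..l} - {(0, 0)}. real ((i choose fst p) * (l choose snd p)) * 0 * g (i - fst p) (l - snd p))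
       (partial_conv {(0, 0)} (?E - 1) ((1 - psi 0) * ?b1) i l)"
      unfolding partial_conv_def
    proof (rule leading_binomial_conv)
      fix a b assume "(a, b) \<in> {..i} \<times> {..l} - {(0, 0)}"
      then show "a \<le> i \<and> b \<le> l" "moment_leading 1 (g (i - a) (l - b)) ((1 - psi 0) * ?b1) (i - a) (l - b)"
        by (auto intro!: prod simp del: One_nat_def)
    qed (rule weight_leading)
    ultimately show ?thesis by simp
  qed
  have C: "leading ?w (2 * c) (fps_const (2 * c))"
    using leading_const[of "2 * c"] leading_zero by (auto simp: c_def)
  have "leading ?w (2 * c + drift 1 lead_bridge i l - 0 - r - r + 0) (fps_const 2 * (eps * moment ?b0 i l))"
    unfolding eq using R1 R2 by (intro leading_diff leading_add C D eD Z) simp_all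
  then have "leading ?w (c + drift 1 lead_bridge i l / 2 - r) (eps * moment ?b0 i l)"
    by (rule leading_half) (simp add: algebra_simps)
  moreover have "c + drift 1 lead_bridge i l / 2 - r = lead_bridge i l"
    by (subst lead_bridge.simps) (auto simp: drift_def r_def c_def)
  ultimately show ?case
    using leading_divide_eps[of "?w"] by (simp add: moment_leading_def)
qed

lemma loops_leading: "moment_leading 2 (lead_loops i l) loops_fps i l"
proof (induction "2 * i + l" arbitrary: i l rule: less_induct)
  case less
  let ?w = "4 * int i + 3 * int l"
  let ?b0 = "bridge stat_weight 0"
  define R1 where "R1 = partial_conv {(i, l)} loops_fps (psi 0) i l"
  define R2 where "R2 = partial_conv {(i, l)} loops_fps (psi 1) i l"
  define r where "r = (\<Sum>p\<in>{..i} \<times> {..l} - {(i, l)}. real ((i choose fst p) * (l choose snd p)) *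
          lead_loops (fst p) (snd p) * lead_psi (i - fst p) (l - snd p))"
  have IH: "moment_leading 2 (lead_loops a b) loops_fps a b" if "2 * a + b < 2 * i + l" for a b
    using less that by blast
  have smaller: "2 * a + b < 2 * i + l" "a \<le> i" "b \<le> l" if "(a, b) \<in> {..i} \<times> {..l} - {(i, l)}" for a b
    using that by auto
  have "loops_fps * psi 0 + loops_fps * psi 1 = 2 * (loops_fps * (1 - excursion 0 - excursion 1))"
    by (simp add: psi_def algebra_simps)
  then have "loops_fps * psi 0 + loops_fps * psi 1 = ?b0 + ?b0"
    by (simp only: loops_fps_eq mult_2)
  then have "moment (loops_fps * psi 0 + loops_fps * psi 1) i l = moment (?b0 + ?b0) i l"
    by simp
  then have "moment loops_fps i l * eps + R1 + (moment loops_fps i l * eps + R2) = moment ?b0 i l + moment ?b0 i l"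
    by (simp only: moment_add moment_mult_split moment_psi_00_all R1_def R2_def)
  then have eq: "fps_const 2 * (eps * moment loops_fps i l) = fps_const 2 * moment ?b0 i l - R1 - R2"
    by (simp add: algebra_simps flip: numeral_fps_const)
  have R1: "leading (?w + 2 + (- 1)) r R1"
    unfolding r_def R1_def partial_conv_def
    by (rule leading_binomial_conv) (auto dest!: smaller intro: IH psi_leading_all simp del: One_nat_def)
  have R2: "leading (?w + 2 + (- 1)) r R2"
    unfolding r_def R2_def partial_conv_def
    by (rule leading_binomial_conv) (auto dest!: smaller intro: IH psi_leading_all simp del: One_nat_def)
  have twice: "leading (?w + 1) (2 * lead_bridge i l - r - r) (fps_const 2 * (eps * moment loops_fps i l))"
  proof -
    have w: "?w + 2 + (- 1) = ?w + 1" by simp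
    show ?thesis
      unfolding eq
      by (rule leading_diff[OF leading_diff[OF leading_const_mult[OF bridge_leading[unfolded moment_leading_def]]
            R1[unfolded w]] R2[unfolded w]])
  qed
  have "lead_bridge i l - r = lead_loops i l"
    unfolding r_def by (rule lead_loops.simps[symmetric])
  then have "leading (?w + 1) (lead_loops i l) (eps * moment loops_fps i l)"
    by (rule_tac leading_half[OF twice]) simp
  from leading_divide_eps[OF this] show ?case
    unfolding moment_leading_def by (rule leading_of_eq) simp_all
qed

text \<open>There are \<open>4 ^ n\<close> loops of length \<open>n\<close>, since the counting series is \<open>eps ^ (-2)\<close>.\<close>

lemma moment_loops_00: "moment loops_fps 0 0 $ n = 4 ^ n"
proof -
  have b: "moment (bridge stat_weight 0) 0 0 * eps = 1"
  proof -
    let ?b0 = "bridge stat_weight 0" and ?b1 = "bridge stat_weight 1"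
    have sh: "moment ?b1 0 0 = moment ?b0 0 0"
      using moment_00_shifted[OF shifted_bridge[of 0]] by simp
    have "moment (?b0 + ?b0 * psi 2) 0 0
        = moment (1 + 1 + ?b1 - ?b1 * psi 0 + (fps_const (stat_weight 1) - 1) * ((1 - psi 0) * ?b1)) 0 0"
      by (simp only: bridge_psi_eq)
    then have "fps_const 2 * (moment ?b0 0 0 * eps) = fps_const 2"
      unfolding moment_add moment_diff moment_mult_00 moment_psi_00_all sh moment_one moment_zero_00[unfolded moment_diff moment_one]
      by (simp add: algebra_simps flip: numeral_fps_const)
    then show ?thesis by (simp flip: numeral_fps_const)
  qed
  have "loops_fps * psi 0 + loops_fps * psi 1 = 2 * (loops_fps * (1 - excursion 0 - excursion 1))"
    by (simp add: psi_def algebra_simps)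
  then have "moment (loops_fps * psi 0 + loops_fps * psi 1) 0 0 = moment (bridge stat_weight 0 + bridge stat_weight 0) 0 0"
    by (simp only: loops_fps_eq mult_2)
  then have "moment loops_fps 0 0 * eps + moment loops_fps 0 0 * eps
      = moment (bridge stat_weight 0) 0 0 + moment (bridge stat_weight 0) 0 0"
    by (simp only: moment_add moment_mult_00 moment_psi_00_all)
  then have "fps_const 2 * (moment loops_fps 0 0 * eps) = fps_const 2 * moment (bridge stat_weight 0) 0 0"
    by (simp add: mult.commute[of _ eps] flip: numeral_fps_const)
  then have "moment loops_fps 0 0 * eps = moment (bridge stat_weight 0) 0 0"
    using mult_left_cancel[of "fps_const (2 :: real)"] by (metis fps_const_nonzero_eq_nonzero zero_neq_numeral)
  then have "moment loops_fps 0 0 * (eps * eps) = 1"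
    using b by (simp only: mult.assoc[symmetric])
  then have inv: "moment loops_fps 0 0 = 1 + fourX * moment loops_fps 0 0"
    by (simp add: eps_square algebra_simps)
  show ?thesis
  proof (induction n)
    case 0
    show ?case by (subst inv) (simp add: fourX_def)
  next
    case (Suc n)
    show ?case by (subst inv) (simp add: fourX_mult_nth Suc)
  qed
qed

lemma moment_loops_nth:
  "moment loops_fps i l $ n = (\<Sum>x\<in>loops n.
     real (\<Sum>s\<leftarrow>x. (fst s)\<^sup>2 + (snd s)\<^sup>2) ^ i * real (\<Sum>s\<leftarrow>x. fst s + snd s) ^ l)"
proof -
  have "(\<Prod>s\<leftarrow>x. state_weight stat_weight s)
      = Poly_Mapping.single (\<Sum>s\<leftarrow>x. fst s + snd s, \<Sum>s\<leftarrow>x. (fst s)\<^sup>2 + (snd s)\<^sup>2) 1" for x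
    using single_one[where 'a = "nat \<times> nat" and 'b = real]
    by (induction x) (simp_all add: state_weight_def stat_weight_def mult_single zero_prod_def)
  then show ?thesis
    by (simp add: moment_def loops_fps_def pairing_sum stat_monomial_def)
qed

section \<open>First-column hook lengths of cores\<close>

lemma initial_segment_eq:
  assumes "finite S" "\<And>i j :: nat. i \<in> S \<Longrightarrow> j < i \<Longrightarrow> j \<in> S"
  shows "S = {..<card S}"
proof -
  define m where "m = (LEAST m. m \<notin> S)"
  have ex: "\<exists>m. m \<notin> S" using assms(1) by (metis finite_nat_set_iff_bounded less_irrefl)
  have "m \<notin> S" unfolding m_def by (rule LeastI_ex[OF ex])
  moreover have "i \<in> S" if "i < m" for i
    using that unfolding m_def by (meson not_less_Least)
  ultimately have "S = {..<m}"
    using assms(2) by (auto simp: set_eq_iff) (metis linorder_neqE_nat)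
  then show ?thesis by simp
qed

text \<open>The hook lengths of the first column.\<close>

fun beta_set :: "nat list \<Rightarrow> nat set" where
  "beta_set [] = {}"
| "beta_set (x # xs) = insert (x + length xs) (beta_set xs)"

definition beta_number :: "nat list \<Rightarrow> nat \<Rightarrow> nat" where
  "beta_number xs i = xs ! i + (length xs - 1 - i)"

lemma beta_conv: "beta_set xs = beta_number xs ` {..<length xs}"
proof (induction xs)
  case (Cons x xs)
  have "{..<length (x # xs)} = insert 0 (Suc ` {..<length xs})"
    by (simp add: lessThan_Suc_eq_insert_0)
  then show ?case
    unfolding beta_set.simps Cons by (simp add: beta_number_def image_image)
qed simp

lemma finite_beta [simp]: "finite (beta_set xs)"
  by (simp add: beta_conv)

lemma partition_nth_mono:
  "is_partition xs \<Longrightarrow> i \<le> j \<Longrightarrow> j < length xs \<Longrightarrow> xs ! j \<le> xs ! i"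
  unfolding is_partition_def
  by (metis le_neq_implies_less order_refl sorted_wrt_nth_less)

lemma partition_nth_pos: "is_partition xs \<Longrightarrow> i < length xs \<Longrightarrow> 0 < xs ! i"
  by (simp add: is_partition_def)

lemma is_partition_Cons:
  "is_partition (x # xs) \<longleftrightarrow> 0 < x \<and> (\<forall>y\<in>set xs. y \<le> x) \<and> is_partition xs"
  by (auto simp: is_partition_def)

lemma beta_number_mono:
  assumes "is_partition xs" "i < j" "j < length xs"
  shows "beta_number xs j + (j - i) \<le> beta_number xs i"
  using partition_nth_mono[OF assms(1), of i j] assms(2,3) by (simp add: beta_number_def)

lemma beta_less:
  assumes "is_partition (x # xs)" "b \<in> beta_set xs"
  shows "b < x + length xs"
proof -
  obtain i where i: "i < length xs" "b = beta_number xs i" using assms(2) by (auto simp: beta_conv)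
  then have "xs ! i \<le> x" using assms(1) by (auto simp: is_partition_Cons)
  then show ?thesis using i by (auto simp: beta_number_def)
qed

lemma card_beta: "is_partition xs \<Longrightarrow> card (beta_set xs) = length xs"
proof (induction xs)
  case (Cons x xs)
  then have "x + length xs \<notin> beta_set xs" using beta_less by blast
  then show ?case using Cons by (simp add: is_partition_Cons)
qed simp

lemma sum_beta: "is_partition xs \<Longrightarrow> 2 * \<Sum>(beta_set xs) = 2 * sum_list xs + length xs * (length xs - 1)"
proof (induction xs)
  case (Cons x xs)
  then have "x + length xs \<notin> beta_set xs" using beta_less by blast
  then show ?case using Cons
    by (cases "length xs") (simp_all add: is_partition_Cons algebra_simps)
qed simp

lemma conjugate_part_iff:
  assumes "is_partition xs" "1 \<le> j" "i < length xs"
  shows "i < conjugate_part xs j \<longleftrightarrow> j \<le> xs ! i"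
    and "conjugate_part xs j \<le> length xs"
proof -
  define S where "S = {i. i < length xs \<and> j \<le> xs ! i}"
  have fin: "finite S" by (simp add: S_def)
  have "{i. (i, j) \<in> cells xs} = Suc ` S"
  proof
    show "{i. (i, j) \<in> cells xs} \<subseteq> Suc ` S"
    proof
      fix i assume "i \<in> {i. (i, j) \<in> cells xs}"
      then have "i - 1 \<in> S" "i = Suc (i - 1)" by (auto simp: cells_def S_def)
      then show "i \<in> Suc ` S" by blast
    qed
    show "Suc ` S \<subseteq> {i. (i, j) \<in> cells xs}"
      using assms(2) by (auto simp: cells_def S_def)
  qed
  then have card: "conjugate_part xs j = card S"
    by (simp add: conjugate_part_def card_image)
  have "S = {..<card S}"
  proof (rule initial_segment_eq[OF fin])
    fix i j' assume "i \<in> S" "j' < i"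
    then show "j' \<in> S"
      using partition_nth_mono[OF assms(1), of j' i] by (auto simp: S_def)
  qed
  then show "i < conjugate_part xs j \<longleftrightarrow> j \<le> xs ! i"
    using assms(3) card by (auto simp: S_def)
  have "S \<subseteq> {..<length xs}" by (auto simp: S_def)
  from card_mono[OF _ this] show "conjugate_part xs j \<le> length xs" by (simp add: card)
qed

text \<open>The hook length in row \<open>i\<close> and column \<open>j\<close> is the beta number of the row minus the gap of the
  column, and the gaps of columns are the natural numbers that are not beta numbers.\<close>

definition gap :: "nat list \<Rightarrow> nat \<Rightarrow> nat" where
  "gap xs j = length xs - conjugate_part xs j + (j - 1)"

lemma hook_length_eq:
  assumes "is_partition xs" "(i, j) \<in> cells xs"
  shows "hook_length xs i j = int (beta_number xs (i - 1)) - int (gap xs j)"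
proof -
  have "1 \<le> j" "i - 1 < length xs" "1 \<le> i" using assms(2) by (auto simp: cells_def)
  then show ?thesis
    using conjugate_part_iff(2)[OF assms(1), of j "i - 1"]
    by (simp add: hook_length_def gap_def beta_number_def of_nat_diff)
qed

text \<open>If column \<open>j\<close> meets row \<open>i\<close> the beta number of the row exceeds the gap of the column, and
  otherwise it is smaller.\<close>

lemma gap_notin_beta:
  assumes "is_partition xs" "1 \<le> j"
  shows "gap xs j \<notin> beta_set xs"
proof
  assume "gap xs j \<in> beta_set xs"
  then obtain i where i: "i < length xs" "gap xs j = beta_number xs i" by (auto simp: beta_conv)
  note c = conjugate_part_iff[OF assms i(1)]
  show False
  proof (cases "j \<le> xs ! i")
    case True
    then show ?thesis using c i assms(2) by (simp add: gap_def beta_number_def)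
  next
    case False
    then show ?thesis using c i assms(2) by (simp add: gap_def beta_number_def)
  qed
qed

text \<open>If \<open>c\<close> beta numbers exceed \<open>m\<close>, then \<open>m\<close> is the gap of a column of length \<open>c\<close>.\<close>

lemma gap_exists:
  assumes p: "is_partition xs" and i: "i < length xs" and m: "m \<notin> beta_set xs" "m < beta_number xs i"
  shows "\<exists>j. 1 \<le> j \<and> j \<le> xs ! i \<and> gap xs j = m"
proof -
  let ?k = "length xs"
  define S where "S = {i. i < ?k \<and> m < beta_number xs i}"
  define c where "c = card S"
  have "S = {..<c}"
    unfolding c_def
  proof (rule initial_segment_eq)
    fix i j' assume "i \<in> S" "j' < i"
    then show "j' \<in> S" using beta_number_mono[OF p, of j' i] by (auto simp: S_def)
  qed (simp add: S_def)
  then have c: "i' < c \<longleftrightarrow> i' < ?k \<and> m < beta_number xs i'" for i' by (auto simp: S_def)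
  have ic: "i < c" using c i m by simp
  have ck: "c \<le> ?k" using c[of "c - 1"] ic by linarith
  define j where "j = m + c + 1 - ?k"
  have later: "xs ! i' + ?k < m + 1 + c" if "c \<le> i'" "i' < ?k" for i'
  proof -
    have "beta_number xs c \<noteq> m" using that m(1) by (auto simp: beta_conv)
    then have "beta_number xs c < m" using c[of c] that by simp
    then have "xs ! c + ?k < m + 1 + c" using that by (simp add: beta_number_def)
    then show ?thesis using partition_nth_mono[OF p, of c i'] that by simp
  qed
  have low: "?k \<le> m + c"
  proof (cases "c = ?k")
    case False
    then show ?thesis using later[of c] partition_nth_pos[OF p, of c] ck by simp
  qed simp
  have earlier: "j \<le> xs ! i'" if "i' < c" for i'
  proof -
    have "m < beta_number xs (c - 1)" using c[of "c - 1"] ic by simp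
    then have "j \<le> xs ! (c - 1)" using ck ic low by (simp add: beta_number_def j_def)
    also have "\<dots> \<le> xs ! i'" using partition_nth_mono[OF p, of i' "c - 1"] that ck by simp
    finally show ?thesis .
  qed
  have j1: "1 \<le> j" using low by (simp add: j_def)
  have "conjugate_part xs j = c"
  proof (rule antisym)
    show "conjugate_part xs j \<le> c"
    proof (rule ccontr)
      assume "\<not> conjugate_part xs j \<le> c"
      then have "c < conjugate_part xs j" by simp
      then have "c < ?k" using conjugate_part_iff(2)[OF p j1 i] by simp
      then show False
        using conjugate_part_iff(1)[OF p j1, of c] \<open>c < conjugate_part xs j\<close> later[of c] low
        by (simp add: j_def)
    qed
    show "c \<le> conjugate_part xs j"
    proof -
      have "c - 1 < ?k" using ic ck by simp
      then have "c - 1 < conjugate_part xs j"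
        using conjugate_part_iff(1)[OF p j1, of "c - 1"] earlier[of "c - 1"] ic by simp
      then show ?thesis by simp
    qed
  qed
  then have "gap xs j = m" using low ck by (simp add: gap_def j_def)
  then show ?thesis using j1 earlier[OF ic] by blast
qed

lemma hook_length_iff:
  assumes p: "is_partition xs" and "0 < s"
  shows "(\<exists>(i, j)\<in>cells xs. hook_length xs i j = int s) \<longleftrightarrow> (\<exists>b\<in>beta_set xs. s \<le> b \<and> b - s \<notin> beta_set xs)"
proof
  assume "\<exists>(i, j)\<in>cells xs. hook_length xs i j = int s"
  then obtain i j where ij: "(i, j) \<in> cells xs" "hook_length xs i j = int s" by blast
  then have "int (beta_number xs (i - 1)) - int (gap xs j) = int s" using hook_length_eq[OF p] by simp
  then have "s \<le> beta_number xs (i - 1)" "beta_number xs (i - 1) - s = gap xs j" by linarith+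
  moreover have "gap xs j \<notin> beta_set xs" using ij by (intro gap_notin_beta p) (auto simp: cells_def)
  moreover have "beta_number xs (i - 1) \<in> beta_set xs" using ij by (auto simp: beta_conv cells_def)
  ultimately show "\<exists>b\<in>beta_set xs. s \<le> b \<and> b - s \<notin> beta_set xs" by (intro bexI) auto
next
  assume "\<exists>b\<in>beta_set xs. s \<le> b \<and> b - s \<notin> beta_set xs"
  then obtain i where i: "i < length xs" "s \<le> beta_number xs i" "beta_number xs i - s \<notin> beta_set xs"
    by (auto simp: beta_conv)
  obtain j where j: "1 \<le> j" "j \<le> xs ! i" "gap xs j = beta_number xs i - s"
    using gap_exists[OF p i(1) i(3)] i(2) \<open>0 < s\<close> by auto
  have cell: "(Suc i, j) \<in> cells xs" using i j by (simp add: cells_def)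
  then have "hook_length xs (Suc i) j = int s"
    using hook_length_eq[OF p cell] i j by simp
  then show "\<exists>(i, j)\<in>cells xs. hook_length xs i j = int s" using cell by blast
qed

text \<open>The sets of first-column hook lengths of the \<open>(s, t)\<close>-cores with distinct parts: equal parts
  have consecutive beta numbers.\<close>

definition core_sets :: "nat \<Rightarrow> nat \<Rightarrow> nat set set" where
  "core_sets s t = {I. finite I \<and> 0 \<notin> I \<and> (\<forall>x\<in>I. s \<le> x \<longrightarrow> x - s \<in> I) \<and>
     (\<forall>x\<in>I. t \<le> x \<longrightarrow> x - t \<in> I) \<and> (\<forall>x\<in>I. Suc x \<notin> I)}"

lemma distinct_iff_beta:
  assumes p: "is_partition xs"
  shows "distinct xs \<longleftrightarrow> (\<forall>x\<in>beta_set xs. Suc x \<notin> beta_set xs)"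
proof
  assume d: "distinct xs"
  show "\<forall>x\<in>beta_set xs. Suc x \<notin> beta_set xs"
  proof (intro ballI notI)
    fix x assume "x \<in> beta_set xs" "Suc x \<in> beta_set xs"
    then obtain i j where ij: "i < length xs" "j < length xs" "x = beta_number xs j" "Suc x = beta_number xs i"
      by (auto simp: beta_conv)
    have "i < j"
      using ij beta_number_mono[OF p, of j i] by (cases i j rule: linorder_cases) auto
    then have "xs ! i \<noteq> xs ! j" "xs ! j \<le> xs ! i"
      using d ij partition_nth_mono[OF p] by (auto simp: nth_eq_iff_index_eq)
    then show False using ij \<open>i < j\<close> by (simp add: beta_number_def)
  qed
next
  assume n: "\<forall>x\<in>beta_set xs. Suc x \<notin> beta_set xs"
  have ne: "xs ! i \<noteq> xs ! j" if "i < j" "j < length xs" for i j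
  proof
    assume "xs ! i = xs ! j"
    then have "xs ! Suc i = xs ! i"
      using partition_nth_mono[OF p, of i "Suc i"] partition_nth_mono[OF p, of "Suc i" j] that by simp
    then have "beta_number xs i = Suc (beta_number xs (Suc i))" using that by (simp add: beta_number_def)
    moreover have "beta_number xs i \<in> beta_set xs" "beta_number xs (Suc i) \<in> beta_set xs"
      using that by (auto simp: beta_conv)
    ultimately show False using n by metis
  qed
  show "distinct xs"
    unfolding distinct_conv_nth by (metis ne linorder_neqE_nat)
qed

lemma distinct_cores_iff:
  assumes "0 < s" "0 < t"
  shows "xs \<in> distinct_cores s t \<longleftrightarrow> is_partition xs \<and> beta_set xs \<in> core_sets s t"
proof -
  have "0 \<notin> beta_set xs" if "is_partition xs"
  proof
    assume "0 \<in> beta_set xs"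
    then obtain i where "i < length xs" "beta_number xs i = 0" by (auto simp: beta_conv)
    then show False using partition_nth_pos[OF that, of i] by (simp add: beta_number_def)
  qed
  then show ?thesis
    using hook_length_iff[OF _ assms(1), of xs] hook_length_iff[OF _ assms(2), of xs] distinct_iff_beta[of xs]
    by (auto simp: distinct_cores_def is_core_def core_sets_def split: prod.splits)
qed

lemma beta_inj: "is_partition xs \<Longrightarrow> is_partition ys \<Longrightarrow> beta_set xs = beta_set ys \<Longrightarrow> xs = ys"
proof (induction xs arbitrary: ys)
  case Nil
  then show ?case by (cases ys) auto
next
  case (Cons x xs)
  then obtain y ys' where ys: "ys = y # ys'" by (cases ys) auto
  have len: "length xs = length ys'"
    using card_beta[OF Cons.prems(1)] card_beta[OF Cons.prems(2)] Cons.prems(3) by (simp add: ys)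
  have lx: "\<forall>b\<in>beta_set xs. b < x + length xs" and ly: "\<forall>b\<in>beta_set ys'. b < y + length ys'"
    using beta_less Cons.prems ys by blast+
  have "insert (x + length xs) (beta_set xs) = insert (y + length ys') (beta_set ys')"
    using Cons.prems(3) by (simp add: ys)
  moreover from this have top: "x + length xs = y + length ys'"
    using lx ly by (metis insert_iff less_asym)
  moreover have "x + length xs \<notin> beta_set xs" "x + length xs \<notin> beta_set ys'"
    using lx ly top by auto
  ultimately have "x + length xs = y + length ys'" "beta_set xs = beta_set ys'"
    by (simp_all add: insert_ident)
  then show ?case using Cons.IH[of ys'] Cons.prems len by (simp add: ys is_partition_Cons)
qed

lemma beta_surj: "finite I \<Longrightarrow> 0 \<notin> I \<Longrightarrow> \<exists>xs. is_partition xs \<and> beta_set xs = I"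
proof (induction I rule: finite_linorder_max_induct)
  case empty
  then show ?case by (intro exI[of _ "[]"]) (simp add: is_partition_def)
next
  case (insert b A)
  then obtain xs where xs: "is_partition xs" "beta_set xs = A" by auto
  have "b - length xs \<ge> y \<and> length xs < b" if "y \<in> set xs" for y
  proof -
    have "xs \<noteq> []" using that by auto
    then have "beta_number xs 0 \<in> A" using xs(2) by (auto simp: beta_conv)
    then have "beta_number xs 0 < b" using insert by auto
    moreover have "y \<le> xs ! 0"
      using that partition_nth_mono[OF xs(1), of 0] by (auto simp: in_set_conv_nth)
    moreover have "0 < xs ! 0" using partition_nth_pos[OF xs(1)] \<open>xs \<noteq> []\<close> by simp
    moreover have "0 < length xs" using \<open>xs \<noteq> []\<close> by simp
    ultimately show ?thesis by (simp add: beta_number_def) linarith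
  qed
  moreover have "0 < b" using insert.prems by (cases b) auto
  ultimately have "length xs < b" by (cases xs) auto
  then have "is_partition ((b - length xs) # xs) \<and> beta_set ((b - length xs) # xs) = insert b A"
    using xs \<open>\<And>y. y \<in> set xs \<Longrightarrow> b - length xs \<ge> y \<and> length xs < b\<close> by (auto simp: is_partition_Cons)
  then show ?case by blast
qed

lemma bij_beta:
  assumes "0 < s" "0 < t"
  shows "bij_betw beta_set (distinct_cores s t) (core_sets s t)"
  unfolding bij_betw_def
proof
  show "inj_on beta_set (distinct_cores s t)"
    using beta_inj by (auto simp: inj_on_def distinct_cores_iff[OF assms])
  show "beta_set ` distinct_cores s t = core_sets s t"
  proof
    show "core_sets s t \<subseteq> beta_set ` distinct_cores s t"
    proof
      fix I assume I: "I \<in> core_sets s t"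
      then obtain xs where "is_partition xs" "beta_set xs = I"
        using beta_surj[of I] by (auto simp: core_sets_def)
      then show "I \<in> beta_set ` distinct_cores s t" using I distinct_cores_iff[OF assms] by blast
    qed
  qed (auto simp: distinct_cores_iff[OF assms])
qed

section \<open>From cores to closed walks\<close>

text \<open>With \<open>h r\<close> the number of elements of residue \<open>r\<close> modulo \<open>s = 2n + 1\<close>, these are the conditions
  for closure under subtraction of \<open>t = s + 2\<close> and for the absence of consecutive elements. Subtracting
  \<open>t\<close> lowers residue and level by 2 and 1; residue 1 wraps around to \<open>2n\<close> two levels down, and
  \<open>s + 2 = t\<close> itself is forbidden since 0 is.\<close>

definition height_conds :: "nat \<Rightarrow> (nat \<Rightarrow> nat) \<Rightarrow> bool" where
  "height_conds n h \<longleftrightarrow> h 2 \<le> 1 \<and> h 1 \<le> h (2 * n) + 2 \<and>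
     (\<forall>r. 3 \<le> r \<and> r \<le> 2 * n \<longrightarrow> h r \<le> h (r - 2) + 1) \<and>
     (\<forall>r. 1 \<le> r \<and> r < 2 * n \<longrightarrow> h r = 0 \<or> h (Suc r) = 0)"

lemma height_condsD:
  assumes "height_conds n h"
  shows "h 2 \<le> 1" and "h 1 \<le> h (2 * n) + 2"
    and "3 \<le> r \<Longrightarrow> r \<le> 2 * n \<Longrightarrow> h r \<le> h (r - 2) + 1"
    and "1 \<le> r \<Longrightarrow> r < 2 * n \<Longrightarrow> h r = 0 \<or> h (Suc r) = 0"
proof -
  note C = assms[unfolded height_conds_def]
  show "h 2 \<le> 1" by (rule C[THEN conjunct1])
  show "h 1 \<le> h (2 * n) + 2" by (rule C[THEN conjunct2, THEN conjunct1])
  show "3 \<le> r \<Longrightarrow> r \<le> 2 * n \<Longrightarrow> h r \<le> h (r - 2) + 1"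
    by (rule C[THEN conjunct2, THEN conjunct2, THEN conjunct1, THEN spec, THEN mp]) (rule conjI)
  show "1 \<le> r \<Longrightarrow> r < 2 * n \<Longrightarrow> h r = 0 \<or> h (Suc r) = 0"
    by (rule C[THEN conjunct2, THEN conjunct2, THEN conjunct2, THEN spec, THEN mp]) (rule conjI)
qed

definition height :: "state list \<Rightarrow> nat \<Rightarrow> nat" where
  "height l r = (if even r then fst (l ! (r div 2 - 1)) else snd (l ! (r div 2)))"

lemma height_even [simp]: "height l (2 * i + 2) = fst (l ! i)"
  and height_odd [simp]: "height l (2 * i + 1) = snd (l ! i)"
  by (simp_all add: height_def)

lemma walk_iff_nth: "walk s l \<longleftrightarrow> (\<forall>i<length l. step ((s # l) ! i) (l ! i))"
proof (induction l arbitrary: s)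
  case (Cons x l)
  show ?case unfolding walk.simps Cons by (auto simp: nth_Cons less_Suc_eq_0_disj split: nat.splits)
qed simp

lemma residue_cases:
  fixes r n :: nat
  assumes "1 \<le> r" "r \<le> 2 * n"
  obtains i where "i < n" "r = 2 * i + 1" | i where "i < n" "r = 2 * i + 2"
proof (cases "even r")
  case True
  then obtain k where "r = 2 * k" by blast
  then show ?thesis using that(2)[of "k - 1"] assms by auto
next
  case False
  then obtain k where "r = 2 * k + 1" by (blast elim: oddE)
  then show ?thesis using that(1)[of k] assms by auto
qed

lemma loops_iff:
  assumes n: "0 < n" and len: "length l = n"
  shows "l \<in> loops n \<longleftrightarrow> height_conds n (height l)"
proof -
  let ?h = "height l"
  obtain n' where n': "n = Suc n'" using n by (cases n) auto
  have last: "fst (last ((0, 0) # l)) = ?h (2 * n)"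
  proof -
    have "l \<noteq> []" using assms by auto
    then have "last ((0, 0) # l) = l ! n'" using len by (simp add: last_conv_nth n')
    moreover have "2 * n = 2 * n' + 2" using n' by simp
    ultimately show ?thesis by (simp only: height_even)
  qed
  have "l \<in> loops n \<longleftrightarrow> (\<forall>i<n. step (((0, Suc (?h (2 * n))) # l) ! i) (l ! i))"
    using last len by (simp only: loops_def mem_Collect_eq walk_iff_nth simp_thms)
  also have "\<dots> \<longleftrightarrow> (\<forall>i<n. case i of
      0 \<Rightarrow> ?h 2 \<le> 1 \<and> ?h 1 \<le> ?h (2 * n) + 2 \<and> (?h 1 = 0 \<or> ?h 2 = 0)
    | Suc k \<Rightarrow> ?h (2 * i + 2) \<le> ?h (2 * k + 2) + 1 \<and> ?h (2 * i + 1) \<le> ?h (2 * k + 1) + 1 \<and>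
        (?h (2 * i + 1) = 0 \<or> ?h (2 * i + 2) = 0) \<and> (?h (2 * k + 2) = 0 \<or> ?h (2 * i + 1) = 0))"
  proof (intro all_cong1 imp_cong refl)
    fix i
    have h0: "height l 2 = fst (l ! 0)" "height l 1 = snd (l ! 0)" by (simp_all add: height_def)
    show "step (((0, Suc (?h (2 * n))) # l) ! i) (l ! i) = (case i of
      0 \<Rightarrow> ?h 2 \<le> 1 \<and> ?h 1 \<le> ?h (2 * n) + 2 \<and> (?h 1 = 0 \<or> ?h 2 = 0)
    | Suc k \<Rightarrow> ?h (2 * i + 2) \<le> ?h (2 * k + 2) + 1 \<and> ?h (2 * i + 1) \<le> ?h (2 * k + 1) + 1 \<and>
        (?h (2 * i + 1) = 0 \<or> ?h (2 * i + 2) = 0) \<and> (?h (2 * k + 2) = 0 \<or> ?h (2 * i + 1) = 0))"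
    proof (cases i)
      case 0
      then show ?thesis unfolding h0 by (auto simp: step_def)
    next
      case (Suc k)
      then show ?thesis unfolding height_even height_odd by (auto simp: step_def)
    qed
  qed
  also have "\<dots> \<longleftrightarrow> height_conds n ?h" (is "?L \<longleftrightarrow> _")
  proof
    assume L: ?L
    have L0: "?h 2 \<le> 1 \<and> ?h 1 \<le> ?h (2 * n) + 2 \<and> (?h 1 = 0 \<or> ?h 2 = 0)"
      using L[THEN spec, of 0, THEN mp, OF n] unfolding nat.case .
    have LS: "?h (2 * Suc k + 2) \<le> ?h (2 * k + 2) + 1" "?h (2 * Suc k + 1) \<le> ?h (2 * k + 1) + 1"
        "?h (2 * Suc k + 1) = 0 \<or> ?h (2 * Suc k + 2) = 0" "?h (2 * k + 2) = 0 \<or> ?h (2 * Suc k + 1) = 0"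
      if "Suc k < n" for k
    proof -
      have *: "?h (2 * Suc k + 2) \<le> ?h (2 * k + 2) + 1 \<and> ?h (2 * Suc k + 1) \<le> ?h (2 * k + 1) + 1 \<and>
        (?h (2 * Suc k + 1) = 0 \<or> ?h (2 * Suc k + 2) = 0) \<and> (?h (2 * k + 2) = 0 \<or> ?h (2 * Suc k + 1) = 0)"
        using L[THEN spec, of "Suc k", THEN mp, OF that] unfolding nat.case .
      show "?h (2 * Suc k + 2) \<le> ?h (2 * k + 2) + 1" "?h (2 * Suc k + 1) \<le> ?h (2 * k + 1) + 1"
        "?h (2 * Suc k + 1) = 0 \<or> ?h (2 * Suc k + 2) = 0" "?h (2 * k + 2) = 0 \<or> ?h (2 * Suc k + 1) = 0"
        by (rule conjunct1[OF *] conjunct1[OF conjunct2[OF *]] conjunct1[OF conjunct2[OF conjunct2[OF *]]]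
              conjunct2[OF conjunct2[OF conjunct2[OF *]]])+
    qed
    show "height_conds n ?h"
      unfolding height_conds_def
    proof (intro conjI allI impI)
      show "?h 2 \<le> 1" "?h 1 \<le> ?h (2 * n) + 2" using L0 by auto
    next
      fix r assume r: "3 \<le> r \<and> r \<le> 2 * n"
      then have "1 \<le> r" "r \<le> 2 * n" by auto
      then show "?h r \<le> ?h (r - 2) + 1"
      proof (cases rule: residue_cases)
        case (1 i)
        then obtain k where "i = Suc k" using r by (cases i) auto
        then have "r = 2 * Suc k + 1" "r - 2 = 2 * k + 1" "Suc k < n" using 1 by simp_all
        then show ?thesis using LS(2)[of k] by (simp only:)
      next
        case (2 i)
        then obtain k where "i = Suc k" using r by (cases i) auto
        then have "r = 2 * Suc k + 2" "r - 2 = 2 * k + 2" "Suc k < n" using 2 by simp_all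
        then show ?thesis using LS(1)[of k] by (simp only:)
      qed
    next
      fix r assume r: "1 \<le> r \<and> r < 2 * n"
      then have "1 \<le> r" "r \<le> 2 * n" by auto
      then show "?h r = 0 \<or> ?h (Suc r) = 0"
      proof (cases rule: residue_cases)
        case (1 i)
        then show ?thesis
        proof (cases i)
          case 0
          then have "r = 1" using 1 by simp
          then show ?thesis using L0 by (simp only: Suc_1)
        next
          case (Suc k)
          have "Suc r = 2 * Suc k + 2" "r = 2 * Suc k + 1" using 1 Suc by simp_all
          then show ?thesis using LS(3)[of k] 1(1) Suc by (simp only:)
        qed
      next
        case (2 i)
        then show ?thesis
        proof -
          have "Suc r = 2 * Suc i + 1" "Suc i < n" using 2 r by simp_all
          then show ?thesis using LS(4)[of i] 2(2) by (simp only:)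
        qed
      qed
    qed
  next
    assume H: "height_conds n ?h"
    note H12 = height_condsD(1,2)[OF H] and H3 = height_condsD(3)[OF H] and H4 = height_condsD(4)[OF H]
    show ?L
    proof (intro allI impI)
      fix i assume i: "i < n"
      show "case i of
          0 \<Rightarrow> ?h 2 \<le> 1 \<and> ?h 1 \<le> ?h (2 * n) + 2 \<and> (?h 1 = 0 \<or> ?h 2 = 0)
        | Suc k \<Rightarrow> ?h (2 * i + 2) \<le> ?h (2 * k + 2) + 1 \<and> ?h (2 * i + 1) \<le> ?h (2 * k + 1) + 1 \<and>
          (?h (2 * i + 1) = 0 \<or> ?h (2 * i + 2) = 0) \<and> (?h (2 * k + 2) = 0 \<or> ?h (2 * i + 1) = 0)"
      proof (cases i)
        case 0
        have "1 < 2 * n" using i by linarith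
        from H4[OF order_refl this] have "?h 1 = 0 \<or> ?h 2 = 0" unfolding Suc_1 .
        then have "?h 2 \<le> 1 \<and> ?h 1 \<le> ?h (2 * n) + 2 \<and> (?h 1 = 0 \<or> ?h 2 = 0)"
          by (intro conjI H12)
        then show ?thesis unfolding 0 nat.case .
      next
        case (Suc k)
        have eqs: "2 * i + 2 - 2 = 2 * k + 2" "2 * i + 1 - 2 = 2 * k + 1" "Suc (2 * i + 1) = 2 * i + 2"
          "2 * i = 2 * k + 2" "Suc (2 * k + 2) = 2 * i + 1"
          using Suc by simp_all
        have "?h (2 * i + 2) \<le> ?h (2 * k + 2) + 1"
          using H3[of "2 * i + 2"] i Suc unfolding eqs(1) by simp
        moreover have "?h (2 * i + 1) \<le> ?h (2 * k + 1) + 1"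
          using H3[of "2 * i + 1"] i Suc unfolding eqs(2) by simp
        moreover have "?h (2 * i + 1) = 0 \<or> ?h (2 * i + 2) = 0"
          using H4[of "2 * i + 1"] i unfolding eqs(3) by simp
        moreover have "?h (2 * k + 2) = 0 \<or> ?h (2 * i + 1) = 0"
          using H4[of "2 * k + 2"] i Suc unfolding eqs(5) by simp
        ultimately show ?thesis unfolding Suc nat.case by (intro conjI)
      qed
    qed
  qed
  finally show ?thesis .
qed

definition residue_set :: "nat \<Rightarrow> (nat \<Rightarrow> nat) \<Rightarrow> nat set" where
  "residue_set s h = {x. x mod s \<noteq> 0 \<and> x div s < h (x mod s)}"

lemma residue_set_iff: "r < s \<Longrightarrow> q * s + r \<in> residue_set s h \<longleftrightarrow> r \<noteq> 0 \<and> q < h r"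
  by (simp add: residue_set_def)

lemma residue_set_conv:
  assumes "0 < s"
  shows "residue_set s h = (\<lambda>(r, q). q * s + r) ` (SIGMA r:{1..<s}. {..<h r})"
proof
  show "residue_set s h \<subseteq> (\<lambda>(r, q). q * s + r) ` (SIGMA r:{1..<s}. {..<h r})"
  proof
    fix x assume "x \<in> residue_set s h"
    then have "(x mod s, x div s) \<in> (SIGMA r:{1..<s}. {..<h r})"
      using assms by (auto simp: residue_set_def)
    moreover have "x = (\<lambda>(r, q). q * s + r) (x mod s, x div s)" by simp
    ultimately show "x \<in> (\<lambda>(r, q). q * s + r) ` (SIGMA r:{1..<s}. {..<h r})" by blast
  qed
qed (auto simp: residue_set_iff)

lemma sum_residue_set:
  fixes f :: "nat \<Rightarrow> real"
  assumes "0 < s"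
  shows "(\<Sum>x\<in>residue_set s h. f x) = (\<Sum>r\<in>{1..<s}. \<Sum>q<h r. f (q * s + r))"
proof -
  have "inj_on (\<lambda>(r, q). q * s + r) (SIGMA r:{1..<s}. {..<h r})"
  proof (rule inj_onI, clarsimp)
    fix r q r' q' assume "r < s" "r' < s" "q * s + r = q' * s + r'"
    then show "r = r' \<and> q = q'"
      by (metis add.commute div_mult_self1 div_less add.right_neutral less_nat_zero_code mod_less mod_mult_self1 plus_nat.add_0)
  qed
  then show ?thesis
    unfolding residue_set_conv[OF assms]
    by (subst sum.reindex) (simp_all add: sum.Sigma case_prod_beta)
qed

lemma sum_arith_progression: "2 * (\<Sum>q<m. real (q * s + r)) = real s * (real m)\<^sup>2 - real s * real m + 2 * real r * real m"
  by (induction m) (simp_all add: power2_eq_square algebra_simps)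

lemma sum_residues:
  fixes n :: nat
  shows "(\<Sum>r\<in>{1..<2 * n + 1}. f r) = (\<Sum>i<n. f (2 * i + 1) + f (2 * i + 2) :: real)"
  by (induction n) (simp_all add: algebra_simps)

lemma residue_set_core:
  assumes n: "0 < n" and H: "height_conds n h"
  shows "residue_set (2 * n + 1) h \<in> core_sets (2 * n + 1) (2 * n + 3)"
proof -
  let ?s = "2 * n + 1" and ?I = "residue_set (2 * n + 1) h"
  note H12 = height_condsD(1,2)[OF H] and H3 = height_condsD(3)[OF H] and H4 = height_condsD(4)[OF H]
  have split: "\<exists>q r. x = q * ?s + r \<and> 1 \<le> r \<and> r \<le> 2 * n \<and> q < h r" if "x \<in> ?I" for x
  proof -
    have "x = (x div ?s) * ?s + x mod ?s" by (simp only: div_mult_mod_eq)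
    moreover have "x mod ?s < ?s" by simp
    ultimately show ?thesis
      using that unfolding residue_set_def
      by (rule_tac exI[of _ "x div ?s"], rule_tac exI[of _ "x mod ?s"])
         (simp only: mem_Collect_eq; linarith)
  qed
  have "finite ?I" by (subst residue_set_conv) auto
  moreover have "0 \<notin> ?I" by (simp add: residue_set_def)
  moreover have "x - ?s \<in> ?I" if x: "x \<in> ?I" "?s \<le> x" for x
  proof -
    obtain q r where qr: "x = q * ?s + r" "1 \<le> r" "r \<le> 2 * n" "q < h r" using split[OF x(1)] by blast
    then obtain p where "q = Suc p" using x(2) by (cases q) auto
    then have "x - ?s = p * ?s + r" using qr by simp
    moreover have "p * ?s + r \<in> ?I" using residue_set_iff[of r ?s p h] qr \<open>q = Suc p\<close> by simp
    ultimately show ?thesis by (simp only:)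
  qed
  moreover have "x - (2 * n + 3) \<in> ?I" if x: "x \<in> ?I" "2 * n + 3 \<le> x" for x
  proof -
    obtain q r where qr: "x = q * ?s + r" "1 \<le> r" "r \<le> 2 * n" "q < h r" using split[OF x(1)] by blast
    then obtain p where p: "q = Suc p" using x(2) by (cases q) auto
    consider "3 \<le> r" | "r = 2" | "r = 1" using qr by linarith
    then show ?thesis
    proof cases
      case 1
      have "x - (2 * n + 3) = p * ?s + (r - 2)" using qr p 1 by simp
      then show ?thesis
        using residue_set_iff[of "r - 2" ?s p h] H3[of r] qr p 1 by simp
    next
      case 2
      then show ?thesis using qr p H12 by simp
    next
      case 3
      then obtain p' where p': "p = Suc p'" using x(2) qr p by (cases p) auto
      have "x - (2 * n + 3) = p' * ?s + 2 * n" using qr p p' 3 by simp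
      moreover have "p' * ?s + 2 * n \<in> ?I"
        using residue_set_iff[of "2 * n" ?s p' h] H12 qr p p' 3 n by simp
      ultimately show ?thesis by (simp only:)
    qed
  qed
  moreover have "Suc x \<notin> ?I" if x: "x \<in> ?I" for x
  proof
    assume Sx: "Suc x \<in> ?I"
    obtain q r where qr: "x = q * ?s + r" "1 \<le> r" "r \<le> 2 * n" "q < h r" using split[OF x(1)] by blast
    show False
    proof (cases "r = 2 * n")
      case True
      then have "Suc x = Suc q * ?s + 0" using qr by simp
      then show False using Sx residue_set_iff[of 0 ?s "Suc q" h] by simp
    next
      case False
      have "Suc x = q * ?s + Suc r" using qr by simp
      then have "q < h (Suc r)" using Sx residue_set_iff[of "Suc r" ?s q h] qr False by simp
      then show False using H4[of r] qr False by simp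
    qed
  qed
  ultimately show ?thesis by (simp add: core_sets_def)
qed

definition residue_height :: "nat \<Rightarrow> nat set \<Rightarrow> nat \<Rightarrow> nat" where
  "residue_height s I r = card {q. q * s + r \<in> I}"

text \<open>The levels occupied in a residue class form an initial segment by closure under subtraction of
  \<open>s\<close>.\<close>

lemma residue_height_iff:
  assumes I: "I \<in> core_sets s t" and s: "0 < s"
  shows "q * s + r \<in> I \<longleftrightarrow> q < residue_height s I r"
proof -
  have fin: "finite {q. q * s + r \<in> I}"
  proof (rule finite_imageD)
    have "(\<lambda>q. q * s + r) ` {q. q * s + r \<in> I} \<subseteq> I" by auto
    then show "finite ((\<lambda>q. q * s + r) ` {q. q * s + r \<in> I})"
      using I by (auto simp: core_sets_def intro: finite_subset)
    show "inj_on (\<lambda>q. q * s + r) {q. q * s + r \<in> I}" using s by (auto simp: inj_on_def)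
  qed
  have down: "(q - k) * s + r \<in> I" if "q * s + r \<in> I" for q k
  proof (induction k)
    case (Suc k)
    show ?case
    proof (cases "q - k")
      case 0
      then show ?thesis using Suc by simp
    next
      case (Suc p)
      have minus: "x - s \<in> I" if "x \<in> I" "s \<le> x" for x
        using I that by (auto simp: core_sets_def)
      have "(q - k) * s + r - s \<in> I" using \<open>(q - k) * s + r \<in> I\<close> Suc by (intro minus) simp_all
      moreover have "q - Suc k = p" using Suc by simp
      ultimately show ?thesis using Suc by simp
    qed
  qed (use that in simp)
  have "{q. q * s + r \<in> I} = {..<residue_height s I r}"
    unfolding residue_height_def
  proof (rule initial_segment_eq[OF fin])
    fix i j assume "i \<in> {q. q * s + r \<in> I}" "j < i"
    then show "j \<in> {q. q * s + r \<in> I}" using down[of i "i - j"] by simp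
  qed
  then show ?thesis by blast
qed

lemma residue_height_conds:
  assumes n: "0 < n" and I: "I \<in> core_sets (2 * n + 1) (2 * n + 3)"
  shows "height_conds n (residue_height (2 * n + 1) I)"
proof -
  let ?s = "2 * n + 1" and ?h = "residue_height (2 * n + 1) I"
  have iff: "q * ?s + r \<in> I \<longleftrightarrow> q < ?h r" for q r
    by (rule residue_height_iff[OF I]) simp
  have zero: "0 \<notin> I" and minus: "\<And>x. x \<in> I \<Longrightarrow> 2 * n + 3 \<le> x \<Longrightarrow> x - (2 * n + 3) \<in> I"
    and cons: "\<And>x. x \<in> I \<Longrightarrow> Suc x \<notin> I"
    using I by (auto simp: core_sets_def)
  show ?thesis
    unfolding height_conds_def
  proof (intro conjI allI impI)
    show "?h 2 \<le> 1"
    proof (rule ccontr)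
      assume "\<not> ?h 2 \<le> 1"
      then have "1 * ?s + 2 \<in> I" using iff[of 1 2] by linarith
      then show False using minus[of "1 * ?s + 2"] zero by simp
    qed
    show "?h 1 \<le> ?h (2 * n) + 2"
    proof (rule ccontr)
      assume "\<not> ?h 1 \<le> ?h (2 * n) + 2"
      then have "(?h (2 * n) + 2) * ?s + 1 \<in> I" using iff[of "?h (2 * n) + 2" 1] by linarith
      then have "(?h (2 * n) + 2) * ?s + 1 - (2 * n + 3) \<in> I" by (rule minus) simp
      also have "(?h (2 * n) + 2) * ?s + 1 - (2 * n + 3) = ?h (2 * n) * ?s + 2 * n" by simp
      finally show False using iff[of "?h (2 * n)" "2 * n"] by simp
    qed
  next
    fix r assume r: "3 \<le> r \<and> r \<le> 2 * n"
    show "?h r \<le> ?h (r - 2) + 1"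
    proof (rule ccontr)
      assume "\<not> ?h r \<le> ?h (r - 2) + 1"
      then have "(?h (r - 2) + 1) * ?s + r \<in> I" using iff[of "?h (r - 2) + 1" r] by linarith
      then have "(?h (r - 2) + 1) * ?s + r - (2 * n + 3) \<in> I" by (rule minus) (use r in simp)
      also have "(?h (r - 2) + 1) * ?s + r - (2 * n + 3) = ?h (r - 2) * ?s + (r - 2)" using r by simp
      finally show False using iff[of "?h (r - 2)" "r - 2"] by simp
    qed
  next
    fix r assume r: "1 \<le> r \<and> r < 2 * n"
    show "?h r = 0 \<or> ?h (Suc r) = 0"
      using iff[of 0 r] iff[of 0 "Suc r"] cons[of r] by auto
  qed
qed

lemma height_conds_cong:
  assumes "0 < n" "\<And>r. 1 \<le> r \<Longrightarrow> r \<le> 2 * n \<Longrightarrow> h r = h' r"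
  shows "height_conds n h \<longleftrightarrow> height_conds n h'"
proof -
  have imp: "height_conds n g'" if "\<And>r. 1 \<le> r \<Longrightarrow> r \<le> 2 * n \<Longrightarrow> g r = g' r" "height_conds n g" for g g'
    unfolding height_conds_def
  proof (intro conjI allI impI)
    note D = height_condsD[OF that(2)]
    show "g' 2 \<le> 1" "g' 1 \<le> g' (2 * n) + 2"
      using D(1,2) that(1)[of 2] that(1)[of 1] that(1)[of "2 * n"] assms(1) by simp_all
    show "g' r \<le> g' (r - 2) + 1" if "3 \<le> r \<and> r \<le> 2 * n" for r
    proof -
      have "1 \<le> r - 2" "r - 2 \<le> 2 * n" using that by auto
      then show ?thesis using D(3)[of r] that \<open>\<And>r. 1 \<le> r \<Longrightarrow> r \<le> 2 * n \<Longrightarrow> g r = g' r\<close>[of r]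
        \<open>\<And>r. 1 \<le> r \<Longrightarrow> r \<le> 2 * n \<Longrightarrow> g r = g' r\<close>[of "r - 2"] by simp
    qed
    show "g' r = 0 \<or> g' (Suc r) = 0" if "1 \<le> r \<and> r < 2 * n" for r
      using D(4)[of r] that \<open>\<And>r. 1 \<le> r \<Longrightarrow> r \<le> 2 * n \<Longrightarrow> g r = g' r\<close>[of r]
        \<open>\<And>r. 1 \<le> r \<Longrightarrow> r \<le> 2 * n \<Longrightarrow> g r = g' r\<close>[of "Suc r"] by simp
  qed
  show ?thesis using imp[of h h'] imp[of h' h] assms(2) by auto
qed

lemma bij_loops:
  assumes n: "0 < n"
  shows "bij_betw (\<lambda>l. residue_set (2 * n + 1) (height l)) (loops n) (core_sets (2 * n + 1) (2 * n + 3))"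
proof -
  let ?s = "2 * n + 1"
  define G where "G I = map (\<lambda>i. (residue_height ?s I (2 * i + 2), residue_height ?s I (2 * i + 1))) [0..<n]" for I
  have len: "length l = n" if "l \<in> loops n" for l using that by (simp add: loops_def)
  have hG: "height (G I) r = residue_height ?s I r" if "1 \<le> r" "r \<le> 2 * n" for I r
    using that
  proof (cases rule: residue_cases)
    case (1 i)
    then show ?thesis unfolding 1(2) height_odd by (simp add: G_def)
  next
    case (2 i)
    then show ?thesis unfolding 2(2) height_even by (simp add: G_def)
  qed
  show ?thesis
  proof (rule bij_betwI[where g = G])
    show "(\<lambda>l. residue_set ?s (height l)) \<in> loops n \<rightarrow> core_sets ?s (2 * n + 3)"
      using residue_set_core[OF n] loops_iff[OF n] len by auto
    show "G \<in> core_sets ?s (2 * n + 3) \<rightarrow> loops n"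
    proof
      fix I assume "I \<in> core_sets ?s (2 * n + 3)"
      then have "height_conds n (residue_height ?s I)" by (rule residue_height_conds[OF n])
      then have "height_conds n (height (G I))"
        using height_conds_cong[OF n, of "height (G I)" "residue_height ?s I"] hG by blast
      then show "G I \<in> loops n" using loops_iff[OF n, of "G I"] by (simp add: G_def)
    qed
  next
    fix l assume l: "l \<in> loops n"
    have "residue_height ?s (residue_set ?s (height l)) r = height l r" if "1 \<le> r" "r \<le> 2 * n" for r
    proof -
      have "{q. q * ?s + r \<in> residue_set ?s (height l)} = {..<height l r}"
        using residue_set_iff[of r ?s _ "height l"] that by auto
      then show ?thesis by (simp add: residue_height_def)
    qed
    then have "residue_height ?s (residue_set ?s (height l)) (2 * i + 2) = fst (l ! i)"
      "residue_height ?s (residue_set ?s (height l)) (2 * i + 1) = snd (l ! i)" if "i < n" for i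
      using that height_even[of l i] height_odd[of l i] by simp_all
    then show "G (residue_set ?s (height l)) = l"
      using len[OF l] by (intro nth_equalityI) (simp_all add: G_def prod_eq_iff)
  next
    fix I assume I: "I \<in> core_sets ?s (2 * n + 3)"
    have iff: "q * ?s + r \<in> I \<longleftrightarrow> q < residue_height ?s I r" for q r
      by (rule residue_height_iff[OF I]) simp
    have "0 \<notin> I" using I by (simp add: core_sets_def)
    then have r0: "residue_height ?s I 0 = 0" using iff[of 0 0] by simp
    show "residue_set ?s (height (G I)) = I"
    proof (rule set_eqI)
      fix x
      define q r where "q = x div ?s" and "r = x mod ?s"
      have x: "x = q * ?s + r" by (simp only: q_def r_def div_mult_mod_eq)
      have r: "r < ?s" by (simp add: r_def)
      show "x \<in> residue_set ?s (height (G I)) \<longleftrightarrow> x \<in> I"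
      proof (cases "r = 0")
        case True
        have "x \<in> I \<longleftrightarrow> False" unfolding x using iff[of q r] r0 True by (simp only: not_less0)
        moreover have "x \<in> residue_set ?s (height (G I)) \<longleftrightarrow> False"
          unfolding x using residue_set_iff[OF r] True by blast
        ultimately show ?thesis by blast
      next
        case False
        then show ?thesis using residue_set_iff[OF r] iff hG[of r I] r unfolding x by simp
      qed
    qed
  qed
qed

lemma real_sum_list: "real (\<Sum>x\<leftarrow>xs. f x) = (\<Sum>x\<leftarrow>xs. real (f x))"
  by (induction xs) simp_all

definition height_sum :: "state list \<Rightarrow> nat" where
  "height_sum l = (\<Sum>s\<leftarrow>l. fst s + snd s)"

definition square_sum :: "state list \<Rightarrow> nat" where
  "square_sum l = (\<Sum>s\<leftarrow>l. (fst s)\<^sup>2 + (snd s)\<^sup>2)"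

text \<open>A class of residue \<open>r\<close> and height \<open>h\<close> has element sum \<open>s h (h - 1) / 2 + r h\<close>, and the size of the
  partition is the sum of its \<open>k\<close> beta numbers minus \<open>k (k - 1) / 2\<close>. The terms \<open>r h\<close> contribute at
  most \<open>2n k\<close>, which goes into the error.\<close>

lemma cores_loops:
  assumes n: "0 < n"
  shows "\<exists>f. bij_betw f (loops n) (distinct_cores (2 * n + 1) (2 * n + 3)) \<and>
    (\<forall>l\<in>loops n. \<bar>2 * partition_size (f l) - (2 * real n * real (square_sum l) - (real (height_sum l))\<^sup>2)\<bar>
        \<le> real (square_sum l) + 2 * real n * real (height_sum l))"
proof -
  let ?s = "2 * n + 1" and ?t = "2 * n + 3"
  have b: "bij_betw beta_set (distinct_cores ?s ?t) (core_sets ?s ?t)"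
    by (rule bij_beta) simp_all
  define f where "f l = inv_into (distinct_cores ?s ?t) beta_set (residue_set ?s (height l))" for l
  have "f = inv_into (distinct_cores ?s ?t) beta_set \<circ> (\<lambda>l. residue_set ?s (height l))"
    by (simp add: f_def fun_eq_iff)
  then have bij: "bij_betw f (loops n) (distinct_cores ?s ?t)"
    using bij_betw_trans[OF bij_loops[OF n] bij_betw_inv_into[OF b]] by simp
  have "\<bar>2 * partition_size (f l) - (2 * real n * real (square_sum l) - (real (height_sum l))\<^sup>2)\<bar>
        \<le> real (square_sum l) + 2 * real n * real (height_sum l)" if l: "l \<in> loops n" for l
  proof -
    let ?h = "height l" and ?I = "residue_set ?s (height l)"
    have len: "length l = n" using l by (simp add: loops_def)
    have fl: "f l \<in> distinct_cores ?s ?t" using bij l by (auto simp: bij_betw_def)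
    then have p: "is_partition (f l)" by (simp add: distinct_cores_def is_core_def)
    have beta_set: "beta_set (f l) = ?I"
      unfolding f_def using bij_betw_inv_into_right[OF b] bij_loops[OF n] l by (auto simp: bij_betw_def)
    have sums: "(\<Sum>r\<in>{1..<?s}. g (?h r)) = (\<Sum>s\<leftarrow>l. g (fst s) + g (snd s))" for g :: "nat \<Rightarrow> real"
    proof -
      have "(\<Sum>r\<in>{1..<?s}. g (?h r)) = (\<Sum>i<n. g (snd (l ! i)) + g (fst (l ! i)))"
        unfolding sum_residues by (simp only: height_even height_odd)
      also have "\<dots> = (\<Sum>s\<leftarrow>l. g (fst s) + g (snd s))"
        unfolding sum_list_sum_nth by (simp add: len atLeast0LessThan add.commute)
      finally show ?thesis .
    qed
    have k: "(\<Sum>r\<in>{1..<?s}. real (?h r)) = real (height_sum l)"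
      unfolding height_sum_def using sums[of real] by (simp add: real_sum_list o_def)
    have S: "(\<Sum>r\<in>{1..<?s}. (real (?h r))\<^sup>2) = real (square_sum l)"
      unfolding square_sum_def using sums[of "\<lambda>x. (real x)\<^sup>2"] by (simp add: real_sum_list o_def)
    define R where "R = (\<Sum>r\<in>{1..<?s}. real r * real (?h r))"
    have card: "real (length (f l)) = real (height_sum l)"
    proof -
      have "real (length (f l)) = (\<Sum>x\<in>?I. 1)"
        using card_beta[OF p] beta_set by simp
      also have "\<dots> = real (height_sum l)"
        by (subst sum_residue_set, simp) (simp only: sum_constant card_lessThan mult_1_right k of_nat_id)
      finally show ?thesis .
    qed
    have "2 * (\<Sum>x\<in>?I. real x) = (\<Sum>r\<in>{1..<?s}. 2 * (\<Sum>q<?h r. real (q * ?s + r)))"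
      by (subst sum_residue_set) (simp_all add: sum_distrib_left)
    also have "\<dots> = real ?s * real (square_sum l) - real ?s * real (height_sum l) + 2 * R"
      unfolding sum_arith_progression
      by (simp only: sum.distrib sum_subtractf S[symmetric] k[symmetric] R_def sum_distrib_left mult.assoc)
    finally have total: "2 * (\<Sum>x\<in>?I. real x)
        = real ?s * real (square_sum l) - real ?s * real (height_sum l) + 2 * R" .
    have "real (2 * \<Sum>(beta_set (f l))) = real (2 * sum_list (f l) + length (f l) * (length (f l) - 1))"
      by (simp only: sum_beta[OF p])
    then have "2 * (\<Sum>x\<in>?I. real x) = 2 * partition_size (f l) + real (length (f l)) * (real (length (f l)) - 1)"
      unfolding beta_set partition_size_def by (cases "length (f l)") (simp_all add: algebra_simps)
    then have size: "2 * partition_size (f l) - (2 * real n * real (square_sum l) - (real (height_sum l))\<^sup>2)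
        = real (square_sum l) - 2 * real n * real (height_sum l) + 2 * R"
      unfolding total card by (simp add: algebra_simps power2_eq_square)
    have "0 \<le> R" unfolding R_def by (intro sum_nonneg) simp
    moreover have "R \<le> (\<Sum>r\<in>{1..<?s}. real (2 * n) * real (?h r))"
      unfolding R_def by (intro sum_mono mult_right_mono) auto
    then have "R \<le> 2 * real n * real (height_sum l)"
      by (simp only: sum_distrib_left[symmetric] k of_nat_mult of_nat_numeral)
    ultimately show ?thesis unfolding size by (simp add: abs_le_iff)
  qed
  then show ?thesis using bij by blast
qed

section \<open>Numerical values of the leading coefficients\<close>

text \<open>Sums over explicit lists can be evaluated by rewriting.\<close>

lemma sum_grid_list:
  fixes f :: "nat \<times> nat \<Rightarrow> real"
  shows "(\<Sum>p\<in>{..i} \<times> {..l} - Q. f p) =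
   sum_list (map f (filter (\<lambda>p. p \<notin> Q) (List.product [0..<Suc i] [0..<Suc l])))"
proof -
  have "{..i} \<times> {..l} - Q = set (filter (\<lambda>p. p \<notin> Q) (List.product [0..<Suc i] [0..<Suc l]))"
    by auto
  then show ?thesis
    by (simp only: sum_list_distinct_conv_sum_set distinct_filter distinct_product distinct_upt)
qed

lemmas psi_rec = lead_psi.simps[unfolded sum_grid_list]
lemmas bridge_rec = lead_bridge.simps[unfolded sum_grid_list]
lemmas loops_rec = lead_loops.simps[unfolded sum_grid_list]

lemma choose_table:
  shows "(2 :: nat) choose Suc 0 = 2" and "(3 :: nat) choose Suc 0 = 3" and "(3 :: nat) choose 2 = 3" and "(4 :: nat) choose Suc 0 = 4" and "(4 :: nat) choose 2 = 6" and "(4 :: nat) choose 3 = 4" and "(5 :: nat) choose Suc 0 = 5" and "(5 :: nat) choose 2 = 10" and "(5 :: nat) choose 3 = 10" and "(5 :: nat) choose 4 = 5" and "(6 :: nat) choose Suc 0 = 6" and "(6 :: nat) choose 2 = 15" and "(6 :: nat) choose 3 = 20" and "(6 :: nat) choose 4 = 15" and "(6 :: nat) choose 5 = 6" and "(7 :: nat) choose Suc 0 = 7" and "(7 :: nat) choose 2 = 21" and "(7 :: nat) choose 3 = 35" and "(7 :: nat) choose 4 = 35" and "(7 :: nat) choose 5 = 21" and "(7 :: nat) choose 6 = 7" and "(8 :: nat) choose Suc 0 = 8" and "(8 :: nat) choose 2 = 28" and "(8 :: nat) choose 3 = 56" and "(8 :: nat) choose 4 = 70" and "(8 :: nat) choose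 5 = 56" and "(8 :: nat) choose 6 = 28" and "(8 :: nat) choose 7 = 8"
  by (simp_all add: numeral_eq_Suc)

lemmas table_eval = upt_rec choose_table numeral_2_eq_2[symmetric]

lemma [simp]: "lead_psi 0 0 = 1"
  by (subst psi_rec) (simp add: table_eval)
lemma [simp]: "lead_psi 0 (Suc 0) = - (1 / 4)"
  by (subst psi_rec) (simp add: table_eval)
lemma [simp]: "lead_psi 0 2 = - (5 / 16)"
  by (subst psi_rec) (simp add: table_eval)
lemma [simp]: "lead_psi (Suc 0) 0 = - (1 / 4)"
  by (subst psi_rec) (simp add: table_eval)
lemma [simp]: "lead_psi 0 3 = - (45 / 32)"
  by (subst psi_rec) (simp add: table_eval)
lemma [simp]: "lead_psi (Suc 0) (Suc 0) = - (9 / 16)"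
  by (subst psi_rec) (simp add: table_eval)
lemma [simp]: "lead_psi 0 4 = - (3315 / 256)"
  by (subst psi_rec) (simp add: table_eval)
lemma [simp]: "lead_psi (Suc 0) 2 = - (221 / 64)"
  by (subst psi_rec) (simp add: table_eval)
lemma [simp]: "lead_psi 2 0 = - (19 / 16)"
  by (subst psi_rec) (simp add: table_eval)
lemma [simp]: "lead_psi 0 5 = - (25425 / 128)"
  by (subst psi_rec) (simp add: table_eval)
lemma [simp]: "lead_psi (Suc 0) 3 = - (5085 / 128)"
  by (subst psi_rec) (simp add: table_eval)
lemma [simp]: "lead_psi 2 (Suc 0) = - (153 / 16)"
  by (subst psi_rec) (simp add: table_eval)
lemma [simp]: "lead_psi 0 6 = - (18635625 / 4096)"
  by (subst psi_rec) (simp add: table_eval)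
lemma [simp]: "lead_psi (Suc 0) 4 = - (745425 / 1024)"
  by (subst psi_rec) (simp add: table_eval)
lemma [simp]: "lead_psi 2 2 = - (34503 / 256)"
  by (subst psi_rec) (simp add: table_eval)
lemma [simp]: "lead_psi 3 0 = - (1893 / 64)"
  by (subst psi_rec) (simp add: table_eval)
lemma [simp]: "lead_psi 0 7 = - (18592875 / 128)"
  by (subst psi_rec) (simp add: table_eval)
lemma [simp]: "lead_psi (Suc 0) 5 = - (1239525 / 64)"
  by (subst psi_rec) (simp add: table_eval)
lemma [simp]: "lead_psi 2 3 = - (745785 / 256)"
  by (subst psi_rec) (simp add: table_eval)
lemma [simp]: "lead_psi 3 (Suc 0) = - (64287 / 128)"
  by (subst psi_rec) (simp add: table_eval)
lemma [simp]: "lead_psi 0 8 = - (403839930375 / 65536)"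
  by (subst psi_rec) (simp add: table_eval)
lemma [simp]: "lead_psi (Suc 0) 6 = - (11538283725 / 16384)"
  by (subst psi_rec) (simp add: table_eval)
lemma [simp]: "lead_psi 2 4 = - (365347251 / 4096)"
  by (subst psi_rec) (simp add: table_eval)
lemma [simp]: "lead_psi 3 2 = - (12965259 / 1024)"
  by (subst psi_rec) (simp add: table_eval)
lemma [simp]: "lead_psi 4 0 = - (522951 / 256)"
  by (subst psi_rec) (simp add: table_eval)
lemma [simp]: "lead_bridge 0 0 = 1"
  by (subst bridge_rec) (simp add: table_eval)
lemma [simp]: "lead_bridge 0 (Suc 0) = 1 / 2"
  by (subst bridge_rec) (simp add: table_eval)
lemma [simp]: "lead_bridge 0 2 = 25 / 16"
  by (subst bridge_rec) (simp add: table_eval)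
lemma [simp]: "lead_bridge (Suc 0) 0 = 3 / 4"
  by (subst bridge_rec) (simp add: table_eval)
lemma [simp]: "lead_bridge 0 3 = 45 / 4"
  by (subst bridge_rec) (simp add: table_eval)
lemma [simp]: "lead_bridge (Suc 0) (Suc 0) = 27 / 8"
  by (subst bridge_rec) (simp add: table_eval)
lemma [simp]: "lead_bridge 0 4 = 36465 / 256"
  by (subst bridge_rec) (simp add: table_eval)
lemma [simp]: "lead_bridge (Suc 0) 2 = 1989 / 64"
  by (subst bridge_rec) (simp add: table_eval)
lemma [simp]: "lead_bridge 2 0 = 133 / 16"
  by (subst bridge_rec) (simp add: table_eval)
lemma [simp]: "lead_bridge 0 5 = 177975 / 64"
  by (subst bridge_rec) (simp add: table_eval)
lemma [simp]: "lead_bridge (Suc 0) 3 = 15255 / 32"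
  by (subst bridge_rec) (simp add: table_eval)
lemma [simp]: "lead_bridge 2 (Suc 0) = 765 / 8"
  by (subst bridge_rec) (simp add: table_eval)
lemma [simp]: "lead_bridge 0 6 = 316805625 / 4096"
  by (subst bridge_rec) (simp add: table_eval)
lemma [simp]: "lead_bridge (Suc 0) 4 = 11181375 / 1024"
  by (subst bridge_rec) (simp add: table_eval)
lemma [simp]: "lead_bridge 2 2 = 448539 / 256"
  by (subst bridge_rec) (simp add: table_eval)
lemma [simp]: "lead_bridge 3 0 = 20823 / 64"
  by (subst bridge_rec) (simp add: table_eval)
lemma [simp]: "lead_bridge 0 7 = 92964375 / 32"
  by (subst bridge_rec) (simp add: table_eval)
lemma [simp]: "lead_bridge (Suc 0) 5 = 11155725 / 32"
  by (subst bridge_rec) (simp add: table_eval)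
lemma [simp]: "lead_bridge 2 3 = 745785 / 16"
  by (subst bridge_rec) (simp add: table_eval)
lemma [simp]: "lead_bridge 3 (Suc 0) = 450009 / 64"
  by (subst bridge_rec) (simp add: table_eval)
lemma [simp]: "lead_bridge 0 8 = 9288318398625 / 65536"
  by (subst bridge_rec) (simp add: table_eval)
lemma [simp]: "lead_bridge (Suc 0) 6 = 242303958225 / 16384"
  by (subst bridge_rec) (simp add: table_eval)
lemma [simp]: "lead_bridge 2 4 = 6941597769 / 4096"
  by (subst bridge_rec) (simp add: table_eval)
lemma [simp]: "lead_bridge 3 2 = 220409403 / 1024"
  by (subst bridge_rec) (simp add: table_eval)
lemma [simp]: "lead_bridge 4 0 = 7844265 / 256"
  by (subst bridge_rec) (simp add: table_eval)
lemma [simp]: "lead_loops 0 0 = 1"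
  by (subst loops_rec) (simp add: table_eval)
lemma [simp]: "lead_loops 0 (Suc 0) = 3 / 4"
  by (subst loops_rec) (simp add: table_eval)
lemma [simp]: "lead_loops 0 2 = 9 / 4"
  by (subst loops_rec) (simp add: table_eval)
lemma [simp]: "lead_loops (Suc 0) 0 = 1"
  by (subst loops_rec) (simp add: table_eval)
lemma [simp]: "lead_loops 0 3 = 963 / 64"
  by (subst loops_rec) (simp add: table_eval)
lemma [simp]: "lead_loops (Suc 0) (Suc 0) = 35 / 8"
  by (subst loops_rec) (simp add: table_eval)
lemma [simp]: "lead_loops 0 4 = 1431 / 8"
  by (subst loops_rec) (simp add: table_eval)
lemma [simp]: "lead_loops (Suc 0) 2 = 615 / 16"
  by (subst loops_rec) (simp add: table_eval)
lemma [simp]: "lead_loops 2 0 = 10"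
  by (subst loops_rec) (simp add: table_eval)
lemma [simp]: "lead_loops 0 5 = 3410235 / 1024"
  by (subst loops_rec) (simp add: table_eval)
lemma [simp]: "lead_loops (Suc 0) 3 = 36231 / 64"
  by (subst loops_rec) (simp add: table_eval)
lemma [simp]: "lead_loops 2 (Suc 0) = 7161 / 64"
  by (subst loops_rec) (simp add: table_eval)
lemma [simp]: "lead_loops 0 6 = 11453805 / 128"
  by (subst loops_rec) (simp add: table_eval)
lemma [simp]: "lead_loops (Suc 0) 4 = 100539 / 8"
  by (subst loops_rec) (simp add: table_eval)
lemma [simp]: "lead_loops 2 2 = 31983 / 16"
  by (subst loops_rec) (simp add: table_eval)
lemma [simp]: "lead_loops 3 0 = 366"
  by (subst loops_rec) (simp add: table_eval)
lemma [simp]: "lead_loops 0 7 = 53702470395 / 16384"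
  by (subst loops_rec) (simp add: table_eval)
lemma [simp]: "lead_loops (Suc 0) 5 = 802741545 / 2048"
  by (subst loops_rec) (simp add: table_eval)
lemma [simp]: "lead_loops 2 3 = 53362167 / 1024"
  by (subst loops_rec) (simp add: table_eval)
lemma [simp]: "lead_loops 3 (Suc 0) = 997425 / 128"
  by (subst loops_rec) (simp add: table_eval)
lemma [simp]: "lead_loops 0 8 = 5023327995 / 32"
  by (subst loops_rec) (simp add: table_eval)
lemma [simp]: "lead_loops (Suc 0) 6 = 2091502215 / 128"
  by (subst loops_rec) (simp add: table_eval)
lemma [simp]: "lead_loops 2 4 = 119370105 / 64"
  by (subst loops_rec) (simp add: table_eval)
lemma [simp]: "lead_loops 3 2 = 30145041 / 128"
  by (subst loops_rec) (simp add: table_eval)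
lemma [simp]: "lead_loops 4 0 = 33240"
  by (subst loops_rec) (simp add: table_eval)

section \<open>Limits of moments and the kurtosis\<close>

definition avg :: "nat \<Rightarrow> (state list \<Rightarrow> real) \<Rightarrow> real" where
  "avg n g = (\<Sum>l\<in>loops n. g l) / 4 ^ n"

lemma card_loops: "card (loops n) = 4 ^ n"
proof -
  have "real (card (loops n)) = 4 ^ n"
    using moment_loops_nth[of 0 0 n] moment_loops_00[of n] by simp
  then show ?thesis by (metis of_nat_eq_iff of_nat_numeral of_nat_power)
qed

lemma avg_add: "avg n (\<lambda>l. g l + h l) = avg n g + avg n h"
  by (simp add: avg_def sum.distrib add_divide_distrib)

lemma avg_cmult: "avg n (\<lambda>l. c * g l) = c * avg n g"
  by (simp add: avg_def sum_distrib_left)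

lemma avg_mono: "(\<And>l. l \<in> loops n \<Longrightarrow> g l \<le> h l) \<Longrightarrow> avg n g \<le> avg n h"
  unfolding avg_def by (intro divide_right_mono sum_mono) auto

lemma avg_const: "avg n (\<lambda>_. c) = c"
  by (simp add: avg_def card_loops)

lemma avg_abs: "\<bar>avg n g\<bar> \<le> avg n (\<lambda>l. \<bar>g l\<bar>)"
  by (simp add: avg_def abs_divide divide_right_mono)

definition scaled_square_sum :: "nat \<Rightarrow> state list \<Rightarrow> real" where
  "scaled_square_sum n l = real (square_sum l) / real n ^ 2"

definition scaled_sum_squared :: "nat \<Rightarrow> state list \<Rightarrow> real" where
  "scaled_sum_squared n l = real (height_sum l) ^ 2 / real n ^ 3"

definition joint_lim :: "nat \<Rightarrow> nat \<Rightarrow> real" where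
  "joint_lim i q = lead_loops i (2 * q) / fact (2 * i + 3 * q)"

lemma joint_limit: "(\<lambda>n. avg n (\<lambda>l. scaled_square_sum n l ^ i * scaled_sum_squared n l ^ q)) \<longlonglongrightarrow> joint_lim i q"
proof -
  have "4 * int i + 3 * int (2 * q) + 2 = 2 * int (Suc (2 * i + 3 * q))" by simp
  then have "leading (2 * int (Suc (2 * i + 3 * q))) (lead_loops i (2 * q)) (moment loops_fps i (2 * q))"
    using loops_leading[of i "2 * q"] by (simp only: moment_leading_def)
  from leading_transfer[OF this]
  have "(\<lambda>n. moment loops_fps i (2 * q) $ n / (4 ^ n * real n ^ (2 * i + 3 * q))) \<longlonglongrightarrow> joint_lim i q"
    by (simp only: joint_lim_def)
  also have "(\<lambda>n. moment loops_fps i (2 * q) $ n / (4 ^ n * real n ^ (2 * i + 3 * q)))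
      = (\<lambda>n. avg n (\<lambda>l. scaled_square_sum n l ^ i * scaled_sum_squared n l ^ q))"
  proof
    fix n
    have "scaled_square_sum n l ^ i * scaled_sum_squared n l ^ q = real (square_sum l) ^ i * real (height_sum l) ^ (2 * q) / real n ^ (2 * i + 3 * q)" for l
      by (simp add: scaled_square_sum_def scaled_sum_squared_def power_divide power_mult power_add)
    then show "moment loops_fps i (2 * q) $ n / (4 ^ n * real n ^ (2 * i + 3 * q)) = avg n (\<lambda>l. scaled_square_sum n l ^ i * scaled_sum_squared n l ^ q)"
      unfolding moment_loops_nth avg_def square_sum_def[symmetric] height_sum_def[symmetric]
      by (simp add: sum_divide_distrib mult.commute)
  qed
  finally show ?thesis .
qed

fun linear_lim :: "real \<Rightarrow> real \<Rightarrow> real \<Rightarrow> nat \<Rightarrow> nat \<Rightarrow> nat \<Rightarrow> real" where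
  "linear_lim a b c 0 i q = joint_lim i q"
| "linear_lim a b c (Suc r) i q =
     a * linear_lim a b c r i q + b * linear_lim a b c r (Suc i) q + c * linear_lim a b c r i (Suc q)"

text \<open>All moments of affine combinations of the two scaled statistics converge, with limits given by
  multiplying out.\<close>

lemma linear_limit:
  "(\<lambda>n. avg n (\<lambda>l. scaled_square_sum n l ^ i * scaled_sum_squared n l ^ q * (a + b * scaled_square_sum n l + c * scaled_sum_squared n l) ^ r)) \<longlonglongrightarrow> linear_lim a b c r i q"
proof (induction r arbitrary: i q)
  case 0
  then show ?case using joint_limit by simp
next
  case (Suc r)
  let ?p = "\<lambda>n l. (a + b * scaled_square_sum n l + c * scaled_sum_squared n l) ^ r"
  have "avg n (\<lambda>l. scaled_square_sum n l ^ i * scaled_sum_squared n l ^ q * (a + b * scaled_square_sum n l + c * scaled_sum_squared n l) ^ Suc r)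
      = a * avg n (\<lambda>l. scaled_square_sum n l ^ i * scaled_sum_squared n l ^ q * ?p n l)
      + b * avg n (\<lambda>l. scaled_square_sum n l ^ Suc i * scaled_sum_squared n l ^ q * ?p n l)
      + c * avg n (\<lambda>l. scaled_square_sum n l ^ i * scaled_sum_squared n l ^ Suc q * ?p n l)" for n
    unfolding avg_cmult[symmetric] avg_add[symmetric] by (simp add: algebra_simps)
  then show ?case
    unfolding linear_lim.simps using Suc by (simp only:) (intro tendsto_intros)
qed

lemma power_diff_bound:
  fixes z y M d :: real
  assumes "\<bar>z\<bar> \<le> M" "\<bar>y\<bar> \<le> M" "\<bar>z - y\<bar> \<le> M * d"
  shows "\<bar>z ^ r - y ^ r\<bar> \<le> real r * M ^ r * d"
proof (induction r)
  case (Suc r)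
  have "M \<ge> 0" using assms(1) by linarith
  have "\<bar>z ^ Suc r - y ^ Suc r\<bar> = \<bar>z * (z ^ r - y ^ r) + y ^ r * (z - y)\<bar>"
    by (simp add: algebra_simps)
  also have "\<dots> \<le> \<bar>z\<bar> * \<bar>z ^ r - y ^ r\<bar> + \<bar>y\<bar> ^ r * \<bar>z - y\<bar>"
    by (metis abs_mult abs_triangle_ineq power_abs)
  also have "\<dots> \<le> M * (real r * M ^ r * d) + M ^ r * (M * d)"
    using assms Suc \<open>M \<ge> 0\<close> by (intro add_mono mult_mono power_mono) auto
  finally show ?case by (simp add: algebra_simps)
qed simp

text \<open>The size divided by \<open>n ^ 3\<close> differs from \<open>Y\<close> by at most \<open>B / sqrt n\<close>, and the moments of
  \<open>B\<close> stay bounded, so the moments have the limits of those of \<open>Y\<close>.\<close>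

lemma size_limit:
  assumes f: "\<And>n l. 0 < n \<Longrightarrow> l \<in> loops n \<Longrightarrow>
      \<bar>2 * X n l - (2 * real n * real (square_sum l) - (real (height_sum l))\<^sup>2)\<bar>
        \<le> real (square_sum l) + 2 * real n * real (height_sum l)"
  shows "(\<lambda>n. avg n (\<lambda>l. (X n l / real n ^ 3) ^ r)) \<longlonglongrightarrow> linear_lim 0 1 (- 1/2) r 0 0"
proof -
  define Y where "Y n l = scaled_square_sum n l - scaled_sum_squared n l / 2" for n l
  define Z where "Z n l = X n l / real n ^ 3" for n l
  define B where "B n l = 1 + scaled_square_sum n l + scaled_sum_squared n l" for n l
  have bound: "\<bar>Z n l ^ r - Y n l ^ r\<bar> \<le> real r * (2 * B n l) ^ r * (1 / sqrt (real n))"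
    if n: "0 < n" and l: "l \<in> loops n" for n l
  proof -
    have nn: "scaled_square_sum n l \<ge> 0" "scaled_sum_squared n l \<ge> 0" by (simp_all add: scaled_square_sum_def scaled_sum_squared_def)
    have sqrt1: "sqrt (real n) \<ge> 1" using n by simp
    define k where "k = real (height_sum l)"
    have n3: "real n ^ 3 > 0" using n by simp
    have "2 * (Z n l - Y n l) = (2 * X n l - (2 * real n * real (square_sum l) - k\<^sup>2)) / real n ^ 3"
      using n by (simp add: Z_def Y_def scaled_square_sum_def scaled_sum_squared_def k_def field_simps power2_eq_square power3_eq_cube)
    then have "2 * \<bar>Z n l - Y n l\<bar> = \<bar>2 * X n l - (2 * real n * real (square_sum l) - k\<^sup>2)\<bar> / real n ^ 3"
      using n3 by (metis abs_divide abs_mult abs_numeral abs_of_pos)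
    also have "\<dots> \<le> (real (square_sum l) + 2 * real n * k) / real n ^ 3"
      unfolding k_def using n3 f[OF n l] by (intro divide_right_mono) simp_all
    also have "\<dots> = scaled_square_sum n l / real n + 2 * (k / real n ^ 2)"
      using n by (simp add: scaled_square_sum_def field_simps power2_eq_square power3_eq_cube)
    also have "scaled_square_sum n l / real n \<le> scaled_square_sum n l / sqrt (real n)"
    proof (rule divide_left_mono)
      have "sqrt (real n) * 1 \<le> sqrt (real n) * sqrt (real n)" using sqrt1 by (intro mult_left_mono) auto
      then show "sqrt (real n) \<le> real n" by simp
    qed (use nn n in auto)
    also have "2 * (k / real n ^ 2) \<le> (1 + scaled_sum_squared n l) / sqrt (real n)"
    proof -
      define s where "s = sqrt (real n)"
      have s: "s > 0" "real n = s ^ 2" using n by (simp_all add: s_def)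
      \<comment> \<open>\<open>2u \<le> 1 + u ^ 2\<close> for \<open>u = k / n ^ (3/2)\<close> expresses the bound by even powers of \<open>k\<close>\<close>
      have "0 \<le> (k / s ^ 3 - 1)\<^sup>2" by simp
      then have "2 * (k / s ^ 3) \<le> 1 + k\<^sup>2 / s ^ 6"
        by (simp add: power2_diff power_divide flip: power_mult)
      then have "2 * (k / s ^ 3) / s \<le> (1 + k\<^sup>2 / s ^ 6) / s"
        using s by (intro divide_right_mono) auto
      moreover have "real n ^ 2 = s ^ 3 * s"
        unfolding s(2) by (simp add: eval_nat_numeral mult_ac)
      then have "2 * (k / s ^ 3) / s = 2 * (k / real n ^ 2)" by (simp only: divide_divide_eq_left times_divide_eq_right)
      moreover have "k\<^sup>2 / s ^ 6 = scaled_sum_squared n l" by (simp add: scaled_sum_squared_def k_def s(2) flip: power_mult)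
      ultimately have "2 * (k / real n ^ 2) \<le> (1 + scaled_sum_squared n l) / s" by (simp only:)
      then show ?thesis unfolding s_def .
    qed
    finally have "2 * \<bar>Z n l - Y n l\<bar> \<le> B n l / sqrt (real n)"
      by (simp add: B_def add_divide_distrib)
    moreover have "B n l / sqrt (real n) \<ge> 0" using nn by (simp add: B_def)
    ultimately have diff: "\<bar>Z n l - Y n l\<bar> \<le> B n l * (1 / sqrt (real n))" by simp
    have le: "B n l * (1 / sqrt (real n)) \<le> B n l * 1"
      using nn sqrt1 by (intro mult_left_mono) (auto simp: B_def)
    have Y: "\<bar>Y n l\<bar> \<le> B n l" using nn by (simp add: Y_def B_def abs_le_iff)
    show ?thesis
    proof (rule power_diff_bound)
      show "\<bar>Z n l\<bar> \<le> 2 * B n l" using diff le Y by linarith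
      show "\<bar>Y n l\<bar> \<le> 2 * B n l" using Y by linarith
      have "B n l * (1 / sqrt (real n)) \<le> 2 * B n l * (1 / sqrt (real n))"
        using nn by (intro mult_right_mono) (auto simp: B_def)
      then show "\<bar>Z n l - Y n l\<bar> \<le> 2 * B n l * (1 / sqrt (real n))" using diff by linarith
    qed
  qed
  define e where "e n = real r * 2 ^ r * avg n (\<lambda>l. B n l ^ r) * (1 / sqrt (real n))" for n
  have "(\<lambda>n. avg n (\<lambda>l. B n l ^ r)) \<longlonglongrightarrow> linear_lim 1 1 1 r 0 0"
    using linear_limit[of 0 0 1 1 1 r] by (simp add: B_def)
  moreover have "(\<lambda>n. 1 / sqrt (real n)) \<longlonglongrightarrow> 0" by real_asymp
  ultimately have "e \<longlonglongrightarrow> real r * 2 ^ r * linear_lim 1 1 1 r 0 0 * 0"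
    unfolding e_def by (intro tendsto_intros)
  then have e0: "e \<longlonglongrightarrow> 0" by simp
  have "\<forall>\<^sub>F n in sequentially. norm (avg n (\<lambda>l. Z n l ^ r) - avg n (\<lambda>l. Y n l ^ r)) \<le> e n"
    using eventually_gt_at_top[of 0]
  proof eventually_elim
    case (elim n)
    have "avg n (\<lambda>l. Z n l ^ r) - avg n (\<lambda>l. Y n l ^ r) = avg n (\<lambda>l. Z n l ^ r - Y n l ^ r)"
      by (simp add: avg_def sum_subtractf diff_divide_distrib)
    then have "norm (avg n (\<lambda>l. Z n l ^ r) - avg n (\<lambda>l. Y n l ^ r)) \<le> avg n (\<lambda>l. \<bar>Z n l ^ r - Y n l ^ r\<bar>)"
      using avg_abs by simp
    also have "\<dots> \<le> avg n (\<lambda>l. real r * (2 * B n l) ^ r * (1 / sqrt (real n)))"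
      using bound[OF elim] by (rule avg_mono)
    also have "\<dots> = avg n (\<lambda>l. (real r * 2 ^ r * (1 / sqrt (real n))) * B n l ^ r)"
      by (simp add: power_mult_distrib mult_ac)
    also have "\<dots> = e n" unfolding avg_cmult e_def by (simp add: mult_ac)
    finally show ?case .
  qed
  then have "(\<lambda>n. avg n (\<lambda>l. Z n l ^ r) - avg n (\<lambda>l. Y n l ^ r)) \<longlonglongrightarrow> 0"
    using e0 by (rule Lim_null_comparison)
  moreover have "(\<lambda>n. avg n (\<lambda>l. Y n l ^ r)) \<longlonglongrightarrow> linear_lim 0 1 (- 1/2) r 0 0"
    using linear_limit[of 0 0 0 1 "-1/2" r] by (simp add: Y_def)
  ultimately have "(\<lambda>n. (avg n (\<lambda>l. Z n l ^ r) - avg n (\<lambda>l. Y n l ^ r)) + avg n (\<lambda>l. Y n l ^ r))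
      \<longlonglongrightarrow> 0 + linear_lim 0 1 (- 1/2) r 0 0"
    by (rule tendsto_add)
  then show ?thesis by (simp add: Z_def)
qed

lemma limit_moments:
  "linear_lim 0 1 (- 1/2) 1 0 0 = 5 / 16"
  "linear_lim 0 1 (- 1/2) 2 0 0 = 1217 / 7680"
  "linear_lim 0 1 (- 1/2) 3 0 0 = 1601353 / 13762560"
  "linear_lim 0 1 (- 1/2) 4 0 0 = 3264219 / 28835840"
proof -
  have numerals: "Suc 2 = 3" "Suc 3 = 4" by simp_all
  have unroll: "linear_lim a b c 2 i q = a * linear_lim a b c 1 i q
      + b * linear_lim a b c 1 (Suc i) q + c * linear_lim a b c 1 i (Suc q)"
    "linear_lim a b c 3 i q = a * linear_lim a b c 2 i q
      + b * linear_lim a b c 2 (Suc i) q + c * linear_lim a b c 2 i (Suc q)"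
    "linear_lim a b c 4 i q = a * linear_lim a b c 3 i q
      + b * linear_lim a b c 3 (Suc i) q + c * linear_lim a b c 3 i (Suc q)" for a b c i q
    using linear_lim.simps(2)[of a b c 1 i q] linear_lim.simps(2)[of a b c 2 i q]
      linear_lim.simps(2)[of a b c 3 i q] by (simp_all only: Suc_1 numerals)
  show "linear_lim 0 1 (- 1/2) 1 0 0 = 5 / 16"
    "linear_lim 0 1 (- 1/2) 2 0 0 = 1217 / 7680"
    "linear_lim 0 1 (- 1/2) 3 0 0 = 1601353 / 13762560"
    "linear_lim 0 1 (- 1/2) 4 0 0 = 3264219 / 28835840"
    by (simp_all add: unroll joint_lim_def numeral_2_eq_2[symmetric] fact_numeral)
qed

text \<open>The kurtosis is invariant under scaling, so the size may be divided by \<open>n ^ 3\<close>.\<close>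

lemma kurtosis_eq:
  assumes n: "0 < n" and f: "bij_betw f (loops n) (distinct_cores (2 * n + 1) (2 * n + 3))"
  defines "e \<equiv> \<lambda>r. avg n (\<lambda>l. (partition_size (f l) / real n ^ 3) ^ r)"
  shows "kurtosis (uniform_core n) partition_size
    = (e 4 - 4 * e 3 * e 1 + 6 * e 2 * e 1 ^ 2 - 3 * e 1 ^ 4) / (e 2 - e 1 ^ 2) ^ 2"
proof -
  let ?A = "distinct_cores (2 * n + 1) (2 * n + 3)"
  have card: "card ?A = 4 ^ n" using bij_betw_same_card[OF f] card_loops by simp
  then have A: "finite ?A" "?A \<noteq> {}" by (metis card.infinite power_not_zero zero_neq_numeral, auto)
  define Z where "Z l = partition_size (f l) / real n ^ 3" for l
  have e: "e r = avg n (\<lambda>l. Z l ^ r)" for r by (simp add: e_def Z_def)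
  have ex: "measure_pmf.expectation (uniform_core n) g = avg n (\<lambda>l. g (f l))" for g :: "nat list \<Rightarrow> real"
    unfolding uniform_core_def
    by (subst integral_pmf_of_set[OF A(2,1)]) (simp only: card avg_def sum.reindex_bij_betw[OF f] of_nat_power of_nat_numeral)
  have size: "partition_size (f l) = real n ^ 3 * Z l" for l using n by (simp add: Z_def)
  have mean: "measure_pmf.expectation (uniform_core n) partition_size = real n ^ 3 * e 1"
    unfolding ex size avg_cmult e by simp
  have central: "measure_pmf.expectation (uniform_core n) (\<lambda>x. (partition_size x - real n ^ 3 * e 1) ^ r)
      = (real n ^ 3) ^ r * avg n (\<lambda>l. (Z l - e 1) ^ r)" for r
    unfolding ex size avg_cmult[symmetric] by (simp add: right_diff_distrib[symmetric] power_mult_distrib)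
  have var: "avg n (\<lambda>l. (Z l - e 1) ^ 2) = e 2 - e 1 ^ 2"
  proof -
    have "avg n (\<lambda>l. (Z l - e 1) ^ 2) = avg n (\<lambda>l. Z l ^ 2 + ((- 2 * e 1) * Z l ^ 1 + (e 1 ^ 2) * 1))"
      by (simp add: power2_eq_square algebra_simps)
    also have "\<dots> = e 2 + ((- 2 * e 1) * e 1 + e 1 ^ 2 * 1)"
      unfolding avg_add avg_cmult e[symmetric] avg_const ..
    finally show ?thesis by (simp add: power2_eq_square)
  qed
  have fourth: "avg n (\<lambda>l. (Z l - e 1) ^ 4) = e 4 - 4 * e 3 * e 1 + 6 * e 2 * e 1 ^ 2 - 3 * e 1 ^ 4"
  proof -
    have "avg n (\<lambda>l. (Z l - e 1) ^ 4) = avg n (\<lambda>l. Z l ^ 4 + ((- 4 * e 1) * Z l ^ 3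
        + ((6 * e 1 ^ 2) * Z l ^ 2 + ((- 4 * e 1 ^ 3) * Z l ^ 1 + e 1 ^ 4 * 1))))"
      by (rule arg_cong[of _ _ "avg n"]) (simp add: fun_eq_iff eval_nat_numeral algebra_simps)
    also have "\<dots> = e 4 + ((- 4 * e 1) * e 3 + ((6 * e 1 ^ 2) * e 2 + ((- 4 * e 1 ^ 3) * e 1 + e 1 ^ 4 * 1)))"
      unfolding avg_add avg_cmult e[symmetric] avg_const ..
    finally show ?thesis by (simp add: eval_nat_numeral algebra_simps)
  qed
  have "kurtosis (uniform_core n) partition_size
    = ((real n ^ 3) ^ 4 * avg n (\<lambda>l. (Z l - e 1) ^ 4)) / ((real n ^ 3) ^ 2 * avg n (\<lambda>l. (Z l - e 1) ^ 2)) ^ 2"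
    unfolding kurtosis_def mean central ..
  also have "\<dots> = avg n (\<lambda>l. (Z l - e 1) ^ 4) / (avg n (\<lambda>l. (Z l - e 1) ^ 2)) ^ 2"
    using n by (simp add: power_mult_distrib flip: power_mult)
  finally show ?thesis unfolding var fourth .
qed

theorem mainTheorem11:
  shows "(\<lambda>n. kurtosis (uniform_core n) partition_size) \<longlonglongrightarrow> 145309380 / 16792853"
proof -
  have "\<exists>f. 0 < n \<longrightarrow> bij_betw f (loops n) (distinct_cores (2 * n + 1) (2 * n + 3)) \<and>
    (\<forall>l\<in>loops n. \<bar>2 * partition_size (f l) - (2 * real n * real (square_sum l) - (real (height_sum l))\<^sup>2)\<bar>
        \<le> real (square_sum l) + 2 * real n * real (height_sum l))" for n
    using cores_loops[of n] by (cases "0 < n") auto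
  then obtain f where bij: "\<And>n. 0 < n \<Longrightarrow> bij_betw (f n) (loops n) (distinct_cores (2 * n + 1) (2 * n + 3))"
    and close: "\<And>n l. 0 < n \<Longrightarrow> l \<in> loops n \<Longrightarrow>
      \<bar>2 * partition_size (f n l) - (2 * real n * real (square_sum l) - (real (height_sum l))\<^sup>2)\<bar>
        \<le> real (square_sum l) + 2 * real n * real (height_sum l)"
    by metis
  define e where "e r n = avg n (\<lambda>l. (partition_size (f n l) / real n ^ 3) ^ r)" for r n
  have lim: "e r \<longlonglongrightarrow> linear_lim 0 1 (- 1/2) r 0 0" for r
    unfolding e_def by (rule size_limit[OF close])
  note lims = lim[of 1, unfolded limit_moments] lim[of 2, unfolded limit_moments]
    lim[of 3, unfolded limit_moments] lim[of 4, unfolded limit_moments]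
  have "(\<lambda>n. (e 4 n - 4 * e 3 n * e 1 n + 6 * e 2 n * e 1 n ^ 2 - 3 * e 1 n ^ 4) / (e 2 n - e 1 n ^ 2) ^ 2)
    \<longlonglongrightarrow> (3264219 / 28835840 - 4 * (1601353 / 13762560) * (5 / 16)
      + 6 * (1217 / 7680) * (5 / 16) ^ 2 - 3 * (5 / 16) ^ 4) / (1217 / 7680 - (5 / 16) ^ 2) ^ 2"
    by (intro tendsto_intros lims) (simp add: power2_eq_square)
  also have "(3264219 / 28835840 - 4 * (1601353 / 13762560) * (5 / 16)
      + 6 * (1217 / 7680) * (5 / 16) ^ 2 - 3 * (5 / 16) ^ 4) / (1217 / 7680 - (5 / 16) ^ 2) ^ 2
      = (145309380 / 16792853 :: real)"
    by (simp add: power_divide)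
  finally have "(\<lambda>n. (e 4 n - 4 * e 3 n * e 1 n + 6 * e 2 n * e 1 n ^ 2 - 3 * e 1 n ^ 4) / (e 2 n - e 1 n ^ 2) ^ 2)
    \<longlonglongrightarrow> 145309380 / 16792853" .
  moreover have "\<forall>\<^sub>F n in sequentially.
      (e 4 n - 4 * e 3 n * e 1 n + 6 * e 2 n * e 1 n ^ 2 - 3 * e 1 n ^ 4) / (e 2 n - e 1 n ^ 2) ^ 2
      = kurtosis (uniform_core n) partition_size"
    using eventually_gt_at_top[of 0]
    by eventually_elim (simp only: kurtosis_eq[OF _ bij] e_def)
  ultimately show ?thesis by (rule Lim_transform_eventually)
qed

end
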